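(* Let $\mathbf{T}=((T,m_{\mathbf{T}},e_{\mathbf{T}}),\omega,\xi)$ be an opmonoidal monad on a monoidal category $(\mathbb{V},\otimes,I,a,l,r)$, let $(\mathbb{A},\diamond,\alpha,\upsilon)$ be a left $\mathbb{V}$-category, let $\mathbf{S}=(S,m_{\mathbf{S}},e_{\mathbf{S}})$ be a $\mathbf{T}$-comodule-monad on $\mathbb{A}$ via $\chi_{V,X}:S(V\diamond X)\to T(V)\diamond S(X)$, let $(C,\delta,\varepsilon)$ be a comonoid in $\mathbb{V}$, and let $\mathcal{Z}=\mathbf{T}(C)$ be the corresponding $\mathbf{T}$-module-comonoid, with underlying object $Z=T(C)$. Suppose that (i) $\mathbb{A}$ admits equalisers of coreflexive $\phi_{\mathbf{S}}$-split pairs, (ii) the functors $S$, $C\diamond-$, $C\diamond(C\diamond-):\mathbb{A}\to\mathbb{A}$ preserve these equalisers, and (iii) the functor $S$ is conservative. Then the comparison functor $K:{}^{C}\mathbb{A}\to{}^{\mathcal{Z}}(\mathbb{A}_{\mathbf{S}})$ is an equivalence of categories if and only if the functor $\phi_{\mathbf{S}}\,{}^{C}U:{}^{C}\mathbb{A}\to\mathbb{A}_{\mathbf{S}}$ is $\mathcal{G}^l_{\mathcal{Z}}$-Galois.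
   Context: An opmonoidal functor $(T,\omega,\xi)$ on $\mathbb{V}$ consists of a functor $T:\mathbb{V}\to\mathbb{V}$, a natural transformation $\omega_{V,W}:T(V\otimes W)\to T(V)\otimes T(W)$ and a morphism $\xi:T(I)\to I$ that are coassociative and counital with respect to $a,l,r$ (i.e. a colax monoidal functor). An opmonoidal monad on $\mathbb{V}$ is a monad $(T,m_{\mathbf{T}},e_{\mathbf{T}})$ with $(T,\omega,\xi)$ opmonoidal and $m_{\mathbf{T}},e_{\mathbf{T}}$ opmonoidal natural transformations. Then the Eilenberg–Moore category $\mathbb{V}_{\mathbf{T}}$ of $\mathbf{T}$-modules is monoidal with $(V,h)\otimes(W,g)=(V\otimes W,(h\otimes g)\cdot\omega_{V,W})$ and unit $(I,\xi)$, the coherence isomorphisms being inherited from $\mathbb{V}$. A $\mathbf{T}$-module-comonoid is a comonoid in $\mathbb{V}_{\mathbf{T}}$. For a comonoid $(C,\delta,\varepsilon)$ in $\mathbb{V}$, the $\mathbf{T}$-module-comonoid $\mathbf{T}(C)$ is $T(C)$ with module structure $\sigma=(m_{\mathbf{T}})_C:TT(C)\to T(C)$, comultiplication $\omega_{C,C}\cdot T(\delta)$ and counit $\xi\cdot T(\varepsilon)$. A left $\mathbb{V}$-category is a category $\mathbb{A}$ with a bifunctor $-\diamond-:\mathbb{V}\times\mathbb{A}\to\mathbb{A}$ and coherent natural isomorphisms $\alpha_{V,W,X}:(V\otimes W)\diamond X\to V\diamond(W\diamond X)$ and $\upsilon_X:I\diamond X\to X$ (left action of a monoidal category). A comonoid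 $(C,\delta,\varepsilon)$ in $\mathbb{V}$ yields the comonad $C\diamond-$ on $\mathbb{A}$ with comultiplication $\alpha_{C,C,X}\cdot(\delta\diamond X)$ and counit $\upsilon_X\cdot(\varepsilon\diamond X)$; ${}^{C}\mathbb{A}$ is its Eilenberg–Moore category, with objects $(X,\theta:X\to C\diamond X)$, and ${}^{C}U\dashv{}^{C}\phi:\mathbb{A}\to{}^{C}\mathbb{A}$ is the forgetful–cofree adjunction. A $\mathbf{T}$-comodule-monad on $\mathbb{A}$ is a monad $\mathbf{S}=(S,m_{\mathbf{S}},e_{\mathbf{S}})$ on $\mathbb{A}$ with a natural transformation $\chi_{V,X}:S(V\diamond X)\to T(V)\diamond S(X)$ such that - $\alpha_{T(V),T(W),S(X)}\cdot(\omega_{V,W}\diamond S(X))\cdot\chi_{V\otimes W,X}=(T(V)\diamond\chi_{W,X})\cdot\chi_{V,W\diamond X}\cdot S(\alpha_{V,W,X})$, - $\upsilon_{S(X)}\cdot(\xi\diamond S(X))\cdot\chi_{I,X}=S(\upsilon_X)$, - $\chi_{V,X}\cdot(m_{\mathbf{S}})_{V\diamond X}=((m_{\mathbf{T}})_V\diamond(m_{\mathbf{S}})_X)\cdot\chi_{T(V),S(X)}\cdot S(\chi_{V,X})$, - $\chi_{V,X}\cdot(e_{\mathbf{S}})_{V\diamond X}=(e_{\mathbf{T}})_V\diamond(e_{\mathbf{S}})_X$. $\mathbb{A}_{\mathbf{S}}$ is the Eilenberg–Moore category of $\mathbf{S}$-modules with free–forgetful adjunction $\phi_{\mathbf{S}}\dashv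 U_{\mathbf{S}}$. $\mathbb{V}_{\mathbf{T}}$ acts from the left on $\mathbb{A}_{\mathbf{S}}$ by $(V,f)\diamond(X,h)=(V\diamond X,(f\diamond h)\cdot\chi_{V,X})$. For a $\mathbf{T}$-module-comonoid $\mathcal{Z}=((Z,\sigma),\delta_Z,\varepsilon_Z)$, $\mathcal{G}^l_{\mathcal{Z}}$ is the comonad $(Z,\sigma)\diamond-$ on $\mathbb{A}_{\mathbf{S}}$ and ${}^{\mathcal{Z}}(\mathbb{A}_{\mathbf{S}})$ is its Eilenberg–Moore category (generalised Hopf modules), with forgetful functor ${}^{\mathcal{Z}}U$ to $\mathbb{A}_{\mathbf{S}}$. The comparison functor $K:{}^{C}\mathbb{A}\to{}^{\mathcal{Z}}(\mathbb{A}_{\mathbf{S}})$ sends $(X,\theta)$ to $\phi_{\mathbf{S}}(X)=(S(X),(m_{\mathbf{S}})_X)$ with $\mathcal{G}^l_{\mathcal{Z}}$-coaction $\kappa_{(X,\theta)}=\chi_{C,X}\cdot S(\theta):S(X)\to Z\diamond S(X)$, and a morphism $f$ to $S(f)$; it satisfies ${}^{\mathcal{Z}}U\,K=\phi_{\mathbf{S}}\,{}^{C}U$. Galois: write $F=\phi_{\mathbf{S}}\,{}^{C}U$, $Q={}^{C}\phi\,U_{\mathbf{S}}$ for its right adjoint, and $\epsilon:FQ\to1$ for the counit. $F$ is $\mathcal{G}^l_{\mathcal{Z}}$-Galois if the comonad morphism $t_K:FQ\xrightarrow{\kappa Q}\mathcal{G}^l_{\mathcal{Z}}FQ\xrightarrow{\mathcal{G}^l_{\mathcal{Z}}\epsilon}\mathcal{G}^l_{\mathcal{Z}}$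 is an isomorphism. A functor is conservative if it reflects isomorphisms. A parallel pair is coreflexive if its two morphisms have a common left inverse; a parallel pair $(f,g)$ in $\mathbb{A}$ is $\phi_{\mathbf{S}}$-split if $(\phi_{\mathbf{S}}(f),\phi_{\mathbf{S}}(g))$ has a split equaliser in $\mathbb{A}_{\mathbf{S}}$. *)

theory Defs
  imports Main
begin

section \<open>Categories, functors, natural transformations\<close>

text \<open>
  A category is given by a set of objects and a set of arrows; every arrow determines its domain
  and codomain, so hom-sets are disjoint. Operations are unconstrained outside the carriers.
  Composition is written in applicative order: \<open>g \<cdot> f\<close> is ``first \<open>f\<close>, then \<open>g\<close>''.
\<close>

record ('o, 'a) cat =
  Obj :: "'o set"
  Arr :: "'a set"
  Dom :: "'a \<Rightarrow> 'o"
  Cod :: "'a \<Rightarrow> 'o"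
  Ident :: "'o \<Rightarrow> 'a" ("\<one>\<index>")
  Comp :: "'a \<Rightarrow> 'a \<Rightarrow> 'a" (infixr "\<cdot>\<index>" 65)

definition hom :: "('o, 'a, 'z) cat_scheme \<Rightarrow> 'o \<Rightarrow> 'o \<Rightarrow> 'a set" where
  "hom C X Y = {f \<in> Arr C. Dom C f = X \<and> Cod C f = Y}"

locale category =
  fixes C :: "('o, 'a, 'z) cat_scheme" (structure)
  assumes Dom_Obj: "f \<in> Arr C \<Longrightarrow> Dom C f \<in> Obj C"
    and Cod_Obj: "f \<in> Arr C \<Longrightarrow> Cod C f \<in> Obj C"
    and Ident_hom: "X \<in> Obj C \<Longrightarrow> \<one> X \<in> hom C X X"
    and Comp_hom: "f \<in> hom C X Y \<Longrightarrow> g \<in> hom C Y Z \<Longrightarrow> g \<cdot> f \<in> hom C X Z"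
    and Comp_Ident_right: "f \<in> hom C X Y \<Longrightarrow> f \<cdot> \<one> X = f"
    and Comp_Ident_left: "f \<in> hom C X Y \<Longrightarrow> \<one> Y \<cdot> f = f"
    and Comp_assoc: "f \<in> hom C W X \<Longrightarrow> g \<in> hom C X Y \<Longrightarrow> h \<in> hom C Y Z \<Longrightarrow>
          (h \<cdot> g) \<cdot> f = h \<cdot> (g \<cdot> f)"

definition iso :: "('o, 'a, 'z) cat_scheme \<Rightarrow> 'a \<Rightarrow> bool" where
  "iso C f \<longleftrightarrow> f \<in> Arr C \<and>
     (\<exists>g \<in> hom C (Cod C f) (Dom C f).
        g \<cdot>\<^bsub>C\<^esub> f = \<one>\<^bsub>C\<^esub> (Dom C f) \<and> f \<cdot>\<^bsub>C\<^esub> g = \<one>\<^bsub>C\<^esub> (Cod C f))"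

definition prod_cat ::
  "('o, 'a, 'z) cat_scheme \<Rightarrow> ('p, 'b, 'y) cat_scheme \<Rightarrow> ('o \<times> 'p, 'a \<times> 'b) cat" where
  "prod_cat C D = \<lparr>
     Obj = Obj C \<times> Obj D,
     Arr = Arr C \<times> Arr D,
     Dom = map_prod (Dom C) (Dom D),
     Cod = map_prod (Cod C) (Cod D),
     Ident = map_prod (Ident C) (Ident D),
     Comp = (\<lambda>(g, g') (f, f'). (g \<cdot>\<^bsub>C\<^esub> f, g' \<cdot>\<^bsub>D\<^esub> f')) \<rparr>"

record ('o, 'a, 'p, 'b) fctr =
  omap :: "'o \<Rightarrow> 'p"
  amap :: "'a \<Rightarrow> 'b"

locale cat_functor = C: category C + D: category D
  for C :: "('o, 'a, 'z) cat_scheme" and D :: "('p, 'b, 'y) cat_scheme" +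
  fixes F :: "('o, 'a, 'p, 'b, 'x) fctr_scheme"
  assumes omap_Obj: "X \<in> Obj C \<Longrightarrow> omap F X \<in> Obj D"
    and amap_hom: "f \<in> hom C X Y \<Longrightarrow> amap F f \<in> hom D (omap F X) (omap F Y)"
    and amap_Ident: "X \<in> Obj C \<Longrightarrow> amap F (\<one>\<^bsub>C\<^esub> X) = \<one>\<^bsub>D\<^esub> (omap F X)"
    and amap_Comp: "f \<in> hom C X Y \<Longrightarrow> g \<in> hom C Y Z \<Longrightarrow>
          amap F (g \<cdot>\<^bsub>C\<^esub> f) = amap F g \<cdot>\<^bsub>D\<^esub> amap F f"

definition id_fctr :: "('o, 'a, 'o, 'a) fctr" where
  "id_fctr = \<lparr> omap = (\<lambda>X. X), amap = (\<lambda>f. f) \<rparr>"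

text \<open>\<open>comp_fctr G F\<close> is the composite \<open>GF\<close>.\<close>

definition comp_fctr ::
  "('p, 'b, 'q, 'c, 'y) fctr_scheme \<Rightarrow> ('o, 'a, 'p, 'b, 'x) fctr_scheme \<Rightarrow> ('o, 'a, 'q, 'c) fctr"
  where
  "comp_fctr G F = \<lparr> omap = (\<lambda>X. omap G (omap F X)), amap = (\<lambda>f. amap G (amap F f)) \<rparr>"

locale nat_trans = F: cat_functor C D F + G: cat_functor C D G
  for C :: "('o, 'a, 'z) cat_scheme" and D :: "('p, 'b, 'y) cat_scheme"
    and F :: "('o, 'a, 'p, 'b, 'x) fctr_scheme" and G :: "('o, 'a, 'p, 'b, 'w) fctr_scheme" +
  fixes \<tau> :: "'o \<Rightarrow> 'b"
  assumes component_hom: "X \<in> Obj C \<Longrightarrow> \<tau> X \<in> hom D (omap F X) (omap G X)"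
    and naturality: "f \<in> hom C X Y \<Longrightarrow> \<tau> Y \<cdot>\<^bsub>D\<^esub> amap F f = amap G f \<cdot>\<^bsub>D\<^esub> \<tau> X"

locale nat_iso = nat_trans +
  assumes component_iso: "X \<in> Obj C \<Longrightarrow> iso D (\<tau> X)"

definition equivalence_of_categories ::
  "('o, 'a, 'z) cat_scheme \<Rightarrow> ('p, 'b, 'y) cat_scheme \<Rightarrow> ('o, 'a, 'p, 'b, 'x) fctr_scheme \<Rightarrow> bool"
  where
  "equivalence_of_categories C D K \<longleftrightarrow> cat_functor C D K \<and>
     (\<exists>(L :: ('p, 'b, 'o, 'a) fctr) \<eta> \<epsilon>. cat_functor D C L \<and>
        nat_iso C C id_fctr (comp_fctr L K) \<eta> \<and> nat_iso D D (comp_fctr K L) id_fctr \<epsilon>)"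

definition conservative ::
  "('o, 'a, 'z) cat_scheme \<Rightarrow> ('p, 'b, 'y) cat_scheme \<Rightarrow> ('o, 'a, 'p, 'b, 'x) fctr_scheme \<Rightarrow> bool"
  where
  "conservative C D F \<longleftrightarrow> (\<forall>f \<in> Arr C. iso D (amap F f) \<longrightarrow> iso C f)"


section \<open>Equalisers\<close>

definition parallel_pair :: "('o, 'a, 'z) cat_scheme \<Rightarrow> 'a \<Rightarrow> 'a \<Rightarrow> bool" where
  "parallel_pair C f g \<longleftrightarrow> f \<in> Arr C \<and> g \<in> Arr C \<and> Dom C f = Dom C g \<and> Cod C f = Cod C g"

definition is_equaliser :: "('o, 'a, 'z) cat_scheme \<Rightarrow> 'a \<Rightarrow> 'a \<Rightarrow> 'a \<Rightarrow> bool" where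
  "is_equaliser C f g e \<longleftrightarrow> parallel_pair C f g \<and> e \<in> Arr C \<and> Cod C e = Dom C f \<and>
     f \<cdot>\<^bsub>C\<^esub> e = g \<cdot>\<^bsub>C\<^esub> e \<and>
     (\<forall>k \<in> Arr C. Cod C k = Dom C f \<and> f \<cdot>\<^bsub>C\<^esub> k = g \<cdot>\<^bsub>C\<^esub> k \<longrightarrow>
        (\<exists>!u. u \<in> hom C (Dom C k) (Dom C e) \<and> e \<cdot>\<^bsub>C\<^esub> u = k))"

definition coreflexive_pair :: "('o, 'a, 'z) cat_scheme \<Rightarrow> 'a \<Rightarrow> 'a \<Rightarrow> bool" where
  "coreflexive_pair C f g \<longleftrightarrow> parallel_pair C f g \<and>
     (\<exists>s \<in> hom C (Cod C f) (Dom C f).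
        s \<cdot>\<^bsub>C\<^esub> f = \<one>\<^bsub>C\<^esub> (Dom C f) \<and> s \<cdot>\<^bsub>C\<^esub> g = \<one>\<^bsub>C\<^esub> (Dom C f))"

text \<open>Convention: \<open>t\<close> splits the first arrow \<open>f\<close> of the pair. Quantifying over all pairs, the
  choice is immaterial, since \<open>(f, g)\<close> and \<open>(g, f)\<close> have the same equalisers.\<close>

definition has_split_equaliser :: "('o, 'a, 'z) cat_scheme \<Rightarrow> 'a \<Rightarrow> 'a \<Rightarrow> bool" where
  "has_split_equaliser C f g \<longleftrightarrow> parallel_pair C f g \<and>
     (\<exists>E \<in> Obj C. \<exists>e \<in> hom C E (Dom C f). \<exists>s \<in> hom C (Dom C f) E. \<exists>t \<in> hom C (Cod C f) (Dom C f).
        f \<cdot>\<^bsub>C\<^esub> e = g \<cdot>\<^bsub>C\<^esub> e \<and> s \<cdot>\<^bsub>C\<^esub> e = \<one>\<^bsub>C\<^esub> E \<and>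
        t \<cdot>\<^bsub>C\<^esub> f = \<one>\<^bsub>C\<^esub> (Dom C f) \<and> t \<cdot>\<^bsub>C\<^esub> g = e \<cdot>\<^bsub>C\<^esub> s)"

text \<open>The functor \<open>F\<close> goes from \<open>C\<close> to \<open>D\<close>.\<close>

definition coreflexive_split_pair ::
  "('o, 'a, 'z) cat_scheme \<Rightarrow> ('p, 'b, 'y) cat_scheme \<Rightarrow> ('o, 'a, 'p, 'b, 'x) fctr_scheme \<Rightarrow>
   'a \<Rightarrow> 'a \<Rightarrow> bool" where
  "coreflexive_split_pair C D F f g \<longleftrightarrow>
     coreflexive_pair C f g \<and> has_split_equaliser D (amap F f) (amap F g)"

definition preserves_equalisers_of ::
  "('o, 'a, 'z) cat_scheme \<Rightarrow> ('p, 'b, 'y) cat_scheme \<Rightarrow> ('a \<Rightarrow> 'a \<Rightarrow> bool) \<Rightarrow>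
   ('o, 'a, 'p, 'b, 'x) fctr_scheme \<Rightarrow> bool" where
  "preserves_equalisers_of C D P F \<longleftrightarrow>
     (\<forall>f g e. P f g \<and> is_equaliser C f g e \<longrightarrow> is_equaliser D (amap F f) (amap F g) (amap F e))"


section \<open>Monads, comonads and their Eilenberg--Moore categories\<close>

record ('o, 'a) mnd = "('o, 'a, 'o, 'a) fctr" +
  mult :: "'o \<Rightarrow> 'a"
  ret :: "'o \<Rightarrow> 'a"

locale monad =
  fixes C :: "('o, 'a, 'z) cat_scheme" (structure) and T :: "('o, 'a, 'x) mnd_scheme"
  assumes T_functor: "cat_functor C C T"
    and mult_nat: "nat_trans C C (comp_fctr T T) T (mult T)"
    and ret_nat: "nat_trans C C id_fctr T (ret T)"
    and mult_assoc: "X \<in> Obj C \<Longrightarrow> mult T X \<cdot> amap T (mult T X) = mult T X \<cdot> mult T (omap T X)"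
    and mult_ret_left: "X \<in> Obj C \<Longrightarrow> mult T X \<cdot> ret T (omap T X) = \<one> (omap T X)"
    and mult_ret_right: "X \<in> Obj C \<Longrightarrow> mult T X \<cdot> amap T (ret T X) = \<one> (omap T X)"

text \<open>
  Objects of Eilenberg--Moore categories are pairs (carrier, structure arrow). To keep hom-sets
  disjoint, an arrow is a triple (domain, underlying arrow, codomain).
\<close>

type_synonym ('o, 'a) em_obj = "'o \<times> 'a"
type_synonym ('o, 'a) em_arr = "('o \<times> 'a) \<times> 'a \<times> ('o \<times> 'a)"

abbreviation und :: "('o, 'a) em_arr \<Rightarrow> 'a" where
  "und p \<equiv> fst (snd p)"

definition em_obj :: "('o, 'a, 'z) cat_scheme \<Rightarrow> ('o, 'a, 'x) mnd_scheme \<Rightarrow> ('o, 'a) em_obj set"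
  where
  "em_obj C T = {(X, h). X \<in> Obj C \<and> h \<in> hom C (omap T X) X \<and>
     h \<cdot>\<^bsub>C\<^esub> amap T h = h \<cdot>\<^bsub>C\<^esub> mult T X \<and> h \<cdot>\<^bsub>C\<^esub> ret T X = \<one>\<^bsub>C\<^esub> X}"

definition em_cat ::
  "('o, 'a, 'z) cat_scheme \<Rightarrow> ('o, 'a, 'x) mnd_scheme \<Rightarrow> (('o, 'a) em_obj, ('o, 'a) em_arr) cat"
  where
  "em_cat C T = \<lparr>
     Obj = em_obj C T,
     Arr = {((X, h), f, (Y, g)) | X h f Y g. (X, h) \<in> em_obj C T \<and> (Y, g) \<in> em_obj C T \<and>
              f \<in> hom C X Y \<and> f \<cdot>\<^bsub>C\<^esub> h = g \<cdot>\<^bsub>C\<^esub> amap T f},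
     Dom = (\<lambda>p. fst p),
     Cod = (\<lambda>p. snd (snd p)),
     Ident = (\<lambda>M. (M, \<one>\<^bsub>C\<^esub> (fst M), M)),
     Comp = (\<lambda>q p. (fst p, und q \<cdot>\<^bsub>C\<^esub> und p, snd (snd q))) \<rparr>"

definition em_forget :: "(('o, 'a) em_obj, ('o, 'a) em_arr, 'o, 'a) fctr" where
  "em_forget = \<lparr> omap = (\<lambda>M. fst M), amap = (\<lambda>p. und p) \<rparr>"

definition em_free ::
  "('o, 'a, 'z) cat_scheme \<Rightarrow> ('o, 'a, 'x) mnd_scheme \<Rightarrow>
   ('o, 'a, ('o, 'a) em_obj, ('o, 'a) em_arr) fctr" where
  "em_free C T = \<lparr>
     omap = (\<lambda>X. (omap T X, mult T X)),
     amap = (\<lambda>f. ((omap T (Dom C f), mult T (Dom C f)), amap T f,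
                  (omap T (Cod C f), mult T (Cod C f)))) \<rparr>"

text \<open>Counit of \<open>em_free \<stileturn> em_forget\<close>: at \<open>(X, h)\<close> it is \<open>h\<close>, viewed as an arrow
  from the free module on \<open>X\<close> to \<open>(X, h)\<close>.\<close>

definition em_counit :: "('o, 'a, 'x) mnd_scheme \<Rightarrow> ('o, 'a) em_obj \<Rightarrow> ('o, 'a) em_arr" where
  "em_counit T M = ((omap T (fst M), mult T (fst M)), snd M, M)"

record ('o, 'a) comnd = "('o, 'a, 'o, 'a) fctr" +
  comult :: "'o \<Rightarrow> 'a"
  counit :: "'o \<Rightarrow> 'a"

locale comonad =
  fixes C :: "('o, 'a, 'z) cat_scheme" (structure) and G :: "('o, 'a, 'x) comnd_scheme"
  assumes G_functor: "cat_functor C C G"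
    and comult_nat: "nat_trans C C G (comp_fctr G G) (comult G)"
    and counit_nat: "nat_trans C C G id_fctr (counit G)"
    and comult_coassoc: "X \<in> Obj C \<Longrightarrow>
          amap G (comult G X) \<cdot> comult G X = comult G (omap G X) \<cdot> comult G X"
    and counit_comult_left: "X \<in> Obj C \<Longrightarrow> counit G (omap G X) \<cdot> comult G X = \<one> (omap G X)"
    and counit_comult_right: "X \<in> Obj C \<Longrightarrow> amap G (counit G X) \<cdot> comult G X = \<one> (omap G X)"

definition coem_obj :: "('o, 'a, 'z) cat_scheme \<Rightarrow> ('o, 'a, 'x) comnd_scheme \<Rightarrow> ('o, 'a) em_obj set"
  where
  "coem_obj C G = {(X, \<theta>). X \<in> Obj C \<and> \<theta> \<in> hom C X (omap G X) \<and>
     amap G \<theta> \<cdot>\<^bsub>C\<^esub> \<theta> = comult G X \<cdot>\<^bsub>C\<^esub> \<theta> \<and> counit G X \<cdot>\<^bsub>C\<^esub> \<theta> = \<one>\<^bsub>C\<^esub> X}"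

definition coem_cat ::
  "('o, 'a, 'z) cat_scheme \<Rightarrow> ('o, 'a, 'x) comnd_scheme \<Rightarrow> (('o, 'a) em_obj, ('o, 'a) em_arr) cat"
  where
  "coem_cat C G = \<lparr>
     Obj = coem_obj C G,
     Arr = {((X, \<theta>), f, (Y, \<zeta>)) | X \<theta> f Y \<zeta>. (X, \<theta>) \<in> coem_obj C G \<and> (Y, \<zeta>) \<in> coem_obj C G \<and>
              f \<in> hom C X Y \<and> \<zeta> \<cdot>\<^bsub>C\<^esub> f = amap G f \<cdot>\<^bsub>C\<^esub> \<theta>},
     Dom = (\<lambda>p. fst p),
     Cod = (\<lambda>p. snd (snd p)),
     Ident = (\<lambda>M. (M, \<one>\<^bsub>C\<^esub> (fst M), M)),
     Comp = (\<lambda>q p. (fst p, und q \<cdot>\<^bsub>C\<^esub> und p, snd (snd q))) \<rparr>"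

definition coem_forget :: "(('o, 'a) em_obj, ('o, 'a) em_arr, 'o, 'a) fctr" where
  "coem_forget = \<lparr> omap = (\<lambda>M. fst M), amap = (\<lambda>p. und p) \<rparr>"

definition coem_cofree ::
  "('o, 'a, 'z) cat_scheme \<Rightarrow> ('o, 'a, 'x) comnd_scheme \<Rightarrow>
   ('o, 'a, ('o, 'a) em_obj, ('o, 'a) em_arr) fctr" where
  "coem_cofree C G = \<lparr>
     omap = (\<lambda>X. (omap G X, comult G X)),
     amap = (\<lambda>f. ((omap G (Dom C f), comult G (Dom C f)), amap G f,
                  (omap G (Cod C f), comult G (Cod C f)))) \<rparr>"

text \<open>The counit of \<open>coem_forget \<stileturn> coem_cofree\<close> is \<open>counit G\<close>.\<close>


section \<open>Monoidal categories, comonoids, opmonoidal monads\<close>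

record ('o, 'a) moncat = "('o, 'a) cat" +
  tensor :: "('o \<times> 'o, 'a \<times> 'a, 'o, 'a) fctr"
  unit_obj :: "'o"
  assc :: "'o \<Rightarrow> 'o \<Rightarrow> 'o \<Rightarrow> 'a"
  lunit :: "'o \<Rightarrow> 'a"
  runit :: "'o \<Rightarrow> 'a"

abbreviation tensor_obj :: "('o, 'a, 'z) moncat_scheme \<Rightarrow> 'o \<Rightarrow> 'o \<Rightarrow> 'o" (infixr "\<otimes>\<^sub>o\<index>" 75) where
  "X \<otimes>\<^sub>o\<^bsub>V\<^esub> Y \<equiv> omap (tensor V) (X, Y)"

abbreviation tensor_arr :: "('o, 'a, 'z) moncat_scheme \<Rightarrow> 'a \<Rightarrow> 'a \<Rightarrow> 'a" (infixr "\<otimes>\<index>" 75) where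
  "f \<otimes>\<^bsub>V\<^esub> g \<equiv> amap (tensor V) (f, g)"

locale monoidal_category = category V
  for V :: "('o, 'a, 'z) moncat_scheme" (structure) +
  assumes tensor_functor: "cat_functor (prod_cat V V) V (tensor V)"
    and unit_Obj: "unit_obj V \<in> Obj V"
    and assc_hom: "X \<in> Obj V \<Longrightarrow> Y \<in> Obj V \<Longrightarrow> Z \<in> Obj V \<Longrightarrow>
          assc V X Y Z \<in> hom V ((X \<otimes>\<^sub>o Y) \<otimes>\<^sub>o Z) (X \<otimes>\<^sub>o (Y \<otimes>\<^sub>o Z))"
    and assc_iso: "X \<in> Obj V \<Longrightarrow> Y \<in> Obj V \<Longrightarrow> Z \<in> Obj V \<Longrightarrow> iso V (assc V X Y Z)"
    and assc_natural: "f \<in> hom V X X' \<Longrightarrow> g \<in> hom V Y Y' \<Longrightarrow> h \<in> hom V Z Z' \<Longrightarrow>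
          assc V X' Y' Z' \<cdot> ((f \<otimes> g) \<otimes> h) = (f \<otimes> (g \<otimes> h)) \<cdot> assc V X Y Z"
    and lunit_hom: "X \<in> Obj V \<Longrightarrow> lunit V X \<in> hom V (unit_obj V \<otimes>\<^sub>o X) X"
    and lunit_iso: "X \<in> Obj V \<Longrightarrow> iso V (lunit V X)"
    and lunit_natural: "f \<in> hom V X X' \<Longrightarrow> lunit V X' \<cdot> (\<one> (unit_obj V) \<otimes> f) = f \<cdot> lunit V X"
    and runit_hom: "X \<in> Obj V \<Longrightarrow> runit V X \<in> hom V (X \<otimes>\<^sub>o unit_obj V) X"
    and runit_iso: "X \<in> Obj V \<Longrightarrow> iso V (runit V X)"
    and runit_natural: "f \<in> hom V X X' \<Longrightarrow> runit V X' \<cdot> (f \<otimes> \<one> (unit_obj V)) = f \<cdot> runit V X"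
    and pentagon: "W \<in> Obj V \<Longrightarrow> X \<in> Obj V \<Longrightarrow> Y \<in> Obj V \<Longrightarrow> Z \<in> Obj V \<Longrightarrow>
          (\<one> W \<otimes> assc V X Y Z) \<cdot> assc V W (X \<otimes>\<^sub>o Y) Z \<cdot> (assc V W X Y \<otimes> \<one> Z)
          = assc V W X (Y \<otimes>\<^sub>o Z) \<cdot> assc V (W \<otimes>\<^sub>o X) Y Z"
    and triangle: "X \<in> Obj V \<Longrightarrow> Y \<in> Obj V \<Longrightarrow>
          (\<one> X \<otimes> lunit V Y) \<cdot> assc V X (unit_obj V) Y = runit V X \<otimes> \<one> Y"

record ('o, 'a) comon =
  co_obj :: "'o"
  co_mult :: "'a"
  co_unit :: "'a"

locale comonoid =
  fixes V :: "('o, 'a, 'z) moncat_scheme" (structure) and C :: "('o, 'a, 'x) comon_scheme"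
  assumes co_Obj: "co_obj C \<in> Obj V"
    and co_mult_hom: "co_mult C \<in> hom V (co_obj C) (co_obj C \<otimes>\<^sub>o co_obj C)"
    and co_unit_hom: "co_unit C \<in> hom V (co_obj C) (unit_obj V)"
    and co_assoc: "assc V (co_obj C) (co_obj C) (co_obj C) \<cdot> (co_mult C \<otimes> \<one> (co_obj C)) \<cdot> co_mult C
          = (\<one> (co_obj C) \<otimes> co_mult C) \<cdot> co_mult C"
    and co_unit_left: "lunit V (co_obj C) \<cdot> (co_unit C \<otimes> \<one> (co_obj C)) \<cdot> co_mult C = \<one> (co_obj C)"
    and co_unit_right: "runit V (co_obj C) \<cdot> (\<one> (co_obj C) \<otimes> co_unit C) \<cdot> co_mult C = \<one> (co_obj C)"

locale opmonoidal_functor =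
  fixes V :: "('o, 'a, 'z) moncat_scheme" (structure)
    and T :: "('o, 'a, 'o, 'a, 'x) fctr_scheme" and \<omega> :: "'o \<Rightarrow> 'o \<Rightarrow> 'a" and \<xi> :: "'a"
  assumes T_functor: "cat_functor V V T"
    and omega_hom: "X \<in> Obj V \<Longrightarrow> Y \<in> Obj V \<Longrightarrow>
          \<omega> X Y \<in> hom V (omap T (X \<otimes>\<^sub>o Y)) (omap T X \<otimes>\<^sub>o omap T Y)"
    and omega_natural: "f \<in> hom V X X' \<Longrightarrow> g \<in> hom V Y Y' \<Longrightarrow>
          \<omega> X' Y' \<cdot> amap T (f \<otimes> g) = (amap T f \<otimes> amap T g) \<cdot> \<omega> X Y"
    and xi_hom: "\<xi> \<in> hom V (omap T (unit_obj V)) (unit_obj V)"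
    and omega_coassoc: "X \<in> Obj V \<Longrightarrow> Y \<in> Obj V \<Longrightarrow> Z \<in> Obj V \<Longrightarrow>
          assc V (omap T X) (omap T Y) (omap T Z) \<cdot> (\<omega> X Y \<otimes> \<one> (omap T Z)) \<cdot> \<omega> (X \<otimes>\<^sub>o Y) Z
          = (\<one> (omap T X) \<otimes> \<omega> Y Z) \<cdot> \<omega> X (Y \<otimes>\<^sub>o Z) \<cdot> amap T (assc V X Y Z)"
    and omega_counit_left: "X \<in> Obj V \<Longrightarrow>
          lunit V (omap T X) \<cdot> (\<xi> \<otimes> \<one> (omap T X)) \<cdot> \<omega> (unit_obj V) X = amap T (lunit V X)"
    and omega_counit_right: "X \<in> Obj V \<Longrightarrow>
          runit V (omap T X) \<cdot> (\<one> (omap T X) \<otimes> \<xi>) \<cdot> \<omega> X (unit_obj V) = amap T (runit V X)"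

definition opmonoidal_nat_trans ::
  "('o, 'a, 'z) moncat_scheme \<Rightarrow>
   ('o, 'a, 'o, 'a, 'x) fctr_scheme \<Rightarrow> ('o \<Rightarrow> 'o \<Rightarrow> 'a) \<Rightarrow> 'a \<Rightarrow>
   ('o, 'a, 'o, 'a, 'y) fctr_scheme \<Rightarrow> ('o \<Rightarrow> 'o \<Rightarrow> 'a) \<Rightarrow> 'a \<Rightarrow> ('o \<Rightarrow> 'a) \<Rightarrow> bool" where
  "opmonoidal_nat_trans V F \<omega> \<xi> G \<omega>' \<xi>' \<tau> \<longleftrightarrow> nat_trans V V F G \<tau> \<and>
     (\<forall>X \<in> Obj V. \<forall>Y \<in> Obj V. \<omega>' X Y \<cdot>\<^bsub>V\<^esub> \<tau> (X \<otimes>\<^sub>o\<^bsub>V\<^esub> Y) = (\<tau> X \<otimes>\<^bsub>V\<^esub> \<tau> Y) \<cdot>\<^bsub>V\<^esub> \<omega> X Y) \<and>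
     \<xi>' \<cdot>\<^bsub>V\<^esub> \<tau> (unit_obj V) = \<xi>"

record ('o, 'a) opmnd = "('o, 'a) mnd" +
  omega :: "'o \<Rightarrow> 'o \<Rightarrow> 'a"
  xi :: "'a"

text \<open>The composite \<open>TT\<close> and the identity functor carry their usual opmonoidal structures.\<close>

locale opmonoidal_monad =
  fixes V :: "('o, 'a, 'z) moncat_scheme" (structure) and T :: "('o, 'a, 'x) opmnd_scheme"
  assumes T_monad: "monad V T"
    and T_opmonoidal: "opmonoidal_functor V T (omega T) (xi T)"
    and mult_opmonoidal: "opmonoidal_nat_trans V
          (comp_fctr T T) (\<lambda>X Y. omega T (omap T X) (omap T Y) \<cdot> amap T (omega T X Y))
            (xi T \<cdot> amap T (xi T))
          T (omega T) (xi T) (mult T)"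
    and ret_opmonoidal: "opmonoidal_nat_trans V
          id_fctr (\<lambda>X Y. \<one> (X \<otimes>\<^sub>o Y)) (\<one> (unit_obj V))
          T (omega T) (xi T) (ret T)"

text \<open>The monoidal category of modules over an opmonoidal monad.\<close>

definition em_tensor_obj ::
  "('o, 'a, 'z) moncat_scheme \<Rightarrow> ('o, 'a, 'x) opmnd_scheme \<Rightarrow>
   ('o, 'a) em_obj \<Rightarrow> ('o, 'a) em_obj \<Rightarrow> ('o, 'a) em_obj" where
  "em_tensor_obj V T M N =
     (fst M \<otimes>\<^sub>o\<^bsub>V\<^esub> fst N, (snd M \<otimes>\<^bsub>V\<^esub> snd N) \<cdot>\<^bsub>V\<^esub> omega T (fst M) (fst N))"

definition em_moncat ::
  "('o, 'a, 'z) moncat_scheme \<Rightarrow> ('o, 'a, 'x) opmnd_scheme \<Rightarrow>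
   (('o, 'a) em_obj, ('o, 'a) em_arr) moncat" where
  "em_moncat V T = cat.extend (em_cat V T) (moncat.fields
     \<lparr> omap = (\<lambda>(M, N). em_tensor_obj V T M N),
       amap = (\<lambda>(p, q). (em_tensor_obj V T (fst p) (fst q), und p \<otimes>\<^bsub>V\<^esub> und q,
                         em_tensor_obj V T (snd (snd p)) (snd (snd q)))) \<rparr>
     (unit_obj V, xi T)
     (\<lambda>L M N. (em_tensor_obj V T (em_tensor_obj V T L M) N,
               assc V (fst L) (fst M) (fst N),
               em_tensor_obj V T L (em_tensor_obj V T M N)))
     (\<lambda>M. (em_tensor_obj V T (unit_obj V, xi T) M, lunit V (fst M), M))
     (\<lambda>M. (em_tensor_obj V T M (unit_obj V, xi T), runit V (fst M), M)))"

text \<open>The module-comonoid \<open>T(C)\<close>, as a comonoid in \<open>em_moncat V T\<close>.\<close>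

definition free_module_comonoid ::
  "('o, 'a, 'z) moncat_scheme \<Rightarrow> ('o, 'a, 'x) opmnd_scheme \<Rightarrow> ('o, 'a) comon \<Rightarrow>
   (('o, 'a) em_obj, ('o, 'a) em_arr) comon" where
  "free_module_comonoid V T C =
     (let c = co_obj C; Z = (omap T c, mult T c) in
      \<lparr> co_obj = Z,
        co_mult = (Z, omega T c c \<cdot>\<^bsub>V\<^esub> amap T (co_mult C), em_tensor_obj V T Z Z),
        co_unit = (Z, xi T \<cdot>\<^bsub>V\<^esub> amap T (co_unit C), (unit_obj V, xi T)) \<rparr>)"


section \<open>Actions of monoidal categories\<close>

text \<open>A left \<open>V\<close>-category; \<open>'v\<close> and \<open>'w\<close> are the types of objects and arrows of \<open>V\<close>.\<close>

record ('v, 'w, 'o, 'a) actcat = "('o, 'a) cat" +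
  act :: "('v \<times> 'o, 'w \<times> 'a, 'o, 'a) fctr"
  act_assoc :: "'v \<Rightarrow> 'v \<Rightarrow> 'o \<Rightarrow> 'a"
  act_unit :: "'o \<Rightarrow> 'a"

abbreviation act_obj :: "('v, 'w, 'o, 'a, 'z) actcat_scheme \<Rightarrow> 'v \<Rightarrow> 'o \<Rightarrow> 'o"
    (infixr "\<diamond>\<^sub>o\<index>" 75) where
  "v \<diamond>\<^sub>o\<^bsub>A\<^esub> X \<equiv> omap (act A) (v, X)"

abbreviation act_arr :: "('v, 'w, 'o, 'a, 'z) actcat_scheme \<Rightarrow> 'w \<Rightarrow> 'a \<Rightarrow> 'a"
    (infixr "\<diamond>\<index>" 75) where
  "p \<diamond>\<^bsub>A\<^esub> f \<equiv> amap (act A) (p, f)"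

text \<open>Coherence consists of the pentagon and both unit triangles.\<close>

locale left_category = V: monoidal_category V + A: category A
  for V :: "('v, 'w, 'z) moncat_scheme"
    and A :: "('v, 'w, 'o, 'a, 'y) actcat_scheme" (structure) +
  assumes act_functor: "cat_functor (prod_cat V A) A (act A)"
    and act_assoc_hom: "v \<in> Obj V \<Longrightarrow> w \<in> Obj V \<Longrightarrow> X \<in> Obj A \<Longrightarrow>
          act_assoc A v w X \<in> hom A ((v \<otimes>\<^sub>o\<^bsub>V\<^esub> w) \<diamond>\<^sub>o X) (v \<diamond>\<^sub>o (w \<diamond>\<^sub>o X))"
    and act_assoc_iso: "v \<in> Obj V \<Longrightarrow> w \<in> Obj V \<Longrightarrow> X \<in> Obj A \<Longrightarrow> iso A (act_assoc A v w X)"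
    and act_assoc_natural:
      "p \<in> hom V v v' \<Longrightarrow> q \<in> hom V w w' \<Longrightarrow> f \<in> hom A X X' \<Longrightarrow>
          act_assoc A v' w' X' \<cdot> ((p \<otimes>\<^bsub>V\<^esub> q) \<diamond> f) = (p \<diamond> (q \<diamond> f)) \<cdot> act_assoc A v w X"
    and act_unit_hom: "X \<in> Obj A \<Longrightarrow> act_unit A X \<in> hom A (unit_obj V \<diamond>\<^sub>o X) X"
    and act_unit_iso: "X \<in> Obj A \<Longrightarrow> iso A (act_unit A X)"
    and act_unit_natural:
      "f \<in> hom A X X' \<Longrightarrow> act_unit A X' \<cdot> (\<one>\<^bsub>V\<^esub> (unit_obj V) \<diamond> f) = f \<cdot> act_unit A X"
    and act_pentagon: "u \<in> Obj V \<Longrightarrow> v \<in> Obj V \<Longrightarrow> w \<in> Obj V \<Longrightarrow> X \<in> Obj A \<Longrightarrow>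
          (\<one>\<^bsub>V\<^esub> u \<diamond> act_assoc A v w X) \<cdot> act_assoc A u (v \<otimes>\<^sub>o\<^bsub>V\<^esub> w) X \<cdot> (assc V u v w \<diamond> \<one> X)
          = act_assoc A u v (w \<diamond>\<^sub>o X) \<cdot> act_assoc A (u \<otimes>\<^sub>o\<^bsub>V\<^esub> v) w X"
    and act_triangle_left: "v \<in> Obj V \<Longrightarrow> X \<in> Obj A \<Longrightarrow>
          act_unit A (v \<diamond>\<^sub>o X) \<cdot> act_assoc A (unit_obj V) v X = lunit V v \<diamond> \<one> X"
    and act_triangle_right: "v \<in> Obj V \<Longrightarrow> X \<in> Obj A \<Longrightarrow>
          (\<one>\<^bsub>V\<^esub> v \<diamond> act_unit A X) \<cdot> act_assoc A v (unit_obj V) X = runit V v \<diamond> \<one> X"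

text \<open>The comonad \<open>C \<diamond> -\<close> on \<open>A\<close> induced by a comonoid \<open>C\<close> in \<open>V\<close>.\<close>

definition act_comonad ::
  "('v, 'w, 'z) moncat_scheme \<Rightarrow> ('v, 'w, 'o, 'a, 'y) actcat_scheme \<Rightarrow> ('v, 'w) comon \<Rightarrow>
   ('o, 'a) comnd" where
  "act_comonad V A C =
     (let c = co_obj C in
      \<lparr> omap = (\<lambda>X. c \<diamond>\<^sub>o\<^bsub>A\<^esub> X),
        amap = (\<lambda>f. \<one>\<^bsub>V\<^esub> c \<diamond>\<^bsub>A\<^esub> f),
        comult = (\<lambda>X. act_assoc A c c X \<cdot>\<^bsub>A\<^esub> (co_mult C \<diamond>\<^bsub>A\<^esub> \<one>\<^bsub>A\<^esub> X)),
        counit = (\<lambda>X. act_unit A X \<cdot>\<^bsub>A\<^esub> (co_unit C \<diamond>\<^bsub>A\<^esub> \<one>\<^bsub>A\<^esub> X)) \<rparr>)"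


section \<open>Comodule-monads and generalised Hopf modules\<close>

record ('v, 'o, 'a) comodmnd = "('o, 'a) mnd" +
  chi :: "'v \<Rightarrow> 'o \<Rightarrow> 'a"

locale comodule_monad =
  fixes V :: "('v, 'w, 'z) moncat_scheme" and T :: "('v, 'w, 'x) opmnd_scheme"
    and A :: "('v, 'w, 'o, 'a, 'y) actcat_scheme" (structure)
    and S :: "('v, 'o, 'a, 'u) comodmnd_scheme"
  assumes S_monad: "monad A S"
    and chi_hom: "v \<in> Obj V \<Longrightarrow> X \<in> Obj A \<Longrightarrow>
          chi S v X \<in> hom A (omap S (v \<diamond>\<^sub>o X)) (omap T v \<diamond>\<^sub>o omap S X)"
    and chi_natural: "p \<in> hom V v v' \<Longrightarrow> f \<in> hom A X X' \<Longrightarrow>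
          chi S v' X' \<cdot> amap S (p \<diamond> f) = (amap T p \<diamond> amap S f) \<cdot> chi S v X"
    and chi_assoc: "v \<in> Obj V \<Longrightarrow> w \<in> Obj V \<Longrightarrow> X \<in> Obj A \<Longrightarrow>
          act_assoc A (omap T v) (omap T w) (omap S X) \<cdot> (omega T v w \<diamond> \<one> (omap S X))
            \<cdot> chi S (v \<otimes>\<^sub>o\<^bsub>V\<^esub> w) X
          = (\<one>\<^bsub>V\<^esub> (omap T v) \<diamond> chi S w X) \<cdot> chi S v (w \<diamond>\<^sub>o X) \<cdot> amap S (act_assoc A v w X)"
    and chi_unit: "X \<in> Obj A \<Longrightarrow>
          act_unit A (omap S X) \<cdot> (xi T \<diamond> \<one> (omap S X)) \<cdot> chi S (unit_obj V) X
          = amap S (act_unit A X)"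
    and chi_mult: "v \<in> Obj V \<Longrightarrow> X \<in> Obj A \<Longrightarrow>
          chi S v X \<cdot> mult S (v \<diamond>\<^sub>o X)
          = (mult T v \<diamond> mult S X) \<cdot> chi S (omap T v) (omap S X) \<cdot> amap S (chi S v X)"
    and chi_ret: "v \<in> Obj V \<Longrightarrow> X \<in> Obj A \<Longrightarrow>
          chi S v X \<cdot> ret S (v \<diamond>\<^sub>o X) = ret T v \<diamond> ret S X"

text \<open>The category of \<open>S\<close>-modules with its action of the monoidal category \<open>em_moncat V T\<close>.\<close>

definition em_act_obj ::
  "('v, 'w, 'o, 'a, 'y) actcat_scheme \<Rightarrow> ('v, 'o, 'a, 'u) comodmnd_scheme \<Rightarrow>
   ('v, 'w) em_obj \<Rightarrow> ('o, 'a) em_obj \<Rightarrow> ('o, 'a) em_obj" where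
  "em_act_obj A S M N =
     (fst M \<diamond>\<^sub>o\<^bsub>A\<^esub> fst N, (snd M \<diamond>\<^bsub>A\<^esub> snd N) \<cdot>\<^bsub>A\<^esub> chi S (fst M) (fst N))"

definition em_actcat ::
  "('v, 'w, 'z) moncat_scheme \<Rightarrow> ('v, 'w, 'x) opmnd_scheme \<Rightarrow>
   ('v, 'w, 'o, 'a, 'y) actcat_scheme \<Rightarrow> ('v, 'o, 'a, 'u) comodmnd_scheme \<Rightarrow>
   (('v, 'w) em_obj, ('v, 'w) em_arr, ('o, 'a) em_obj, ('o, 'a) em_arr) actcat" where
  "em_actcat V T A S = cat.extend (em_cat A S) (actcat.fields
     \<lparr> omap = (\<lambda>(M, N). em_act_obj A S M N),
       amap = (\<lambda>(p, q). (em_act_obj A S (fst p) (fst q), und p \<diamond>\<^bsub>A\<^esub> und q,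
                         em_act_obj A S (snd (snd p)) (snd (snd q)))) \<rparr>
     (\<lambda>L M N. (em_act_obj A S (em_tensor_obj V T L M) N,
               act_assoc A (fst L) (fst M) (fst N),
               em_act_obj A S L (em_act_obj A S M N)))
     (\<lambda>N. (em_act_obj A S (unit_obj V, xi T) N, act_unit A (fst N), N)))"

text \<open>The comonad \<open>Z \<diamond> -\<close> on \<open>S\<close>-modules given by a module-comonoid \<open>Z\<close>, and its category of
  comodules.\<close>

definition hopf_comonad ::
  "('v, 'w, 'z) moncat_scheme \<Rightarrow> ('v, 'w, 'x) opmnd_scheme \<Rightarrow>
   ('v, 'w, 'o, 'a, 'y) actcat_scheme \<Rightarrow> ('v, 'o, 'a, 'u) comodmnd_scheme \<Rightarrow>
   (('v, 'w) em_obj, ('v, 'w) em_arr) comon \<Rightarrow> (('o, 'a) em_obj, ('o, 'a) em_arr) comnd" where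
  "hopf_comonad V T A S Z = act_comonad (em_moncat V T) (em_actcat V T A S) Z"

definition hopf_modules ::
  "('v, 'w, 'z) moncat_scheme \<Rightarrow> ('v, 'w, 'x) opmnd_scheme \<Rightarrow>
   ('v, 'w, 'o, 'a, 'y) actcat_scheme \<Rightarrow> ('v, 'o, 'a, 'u) comodmnd_scheme \<Rightarrow>
   (('v, 'w) em_obj, ('v, 'w) em_arr) comon \<Rightarrow>
   ((('o, 'a) em_obj, ('o, 'a) em_arr) em_obj, (('o, 'a) em_obj, ('o, 'a) em_arr) em_arr) cat" where
  "hopf_modules V T A S Z = coem_cat (em_cat A S) (hopf_comonad V T A S Z)"

text \<open>The coaction \<open>\<kappa>\<close> on \<open>em_free A S X\<close> for a \<open>C\<close>-comodule \<open>M = (X, \<theta>)\<close>, and the comparison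
  functor \<open>K\<close>; the target comodules are those over \<open>free_module_comonoid V T C\<close>.\<close>

definition hopf_coaction ::
  "('v, 'w, 'x) opmnd_scheme \<Rightarrow>
   ('v, 'w, 'o, 'a, 'y) actcat_scheme \<Rightarrow> ('v, 'o, 'a, 'u) comodmnd_scheme \<Rightarrow> ('v, 'w) comon \<Rightarrow>
   ('o, 'a) em_obj \<Rightarrow> ('o, 'a) em_arr" where
  "hopf_coaction T A S C M =
     (let c = co_obj C; X = fst M; \<theta> = snd M in
      (omap (em_free A S) X, chi S c X \<cdot>\<^bsub>A\<^esub> amap S \<theta>,
       em_act_obj A S (omap T c, mult T c) (omap (em_free A S) X)))"

definition comparison_functor ::
  "('v, 'w, 'x) opmnd_scheme \<Rightarrow>
   ('v, 'w, 'o, 'a, 'y) actcat_scheme \<Rightarrow> ('v, 'o, 'a, 'u) comodmnd_scheme \<Rightarrow> ('v, 'w) comon \<Rightarrow>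
   (('o, 'a) em_obj, ('o, 'a) em_arr,
    (('o, 'a) em_obj, ('o, 'a) em_arr) em_obj, (('o, 'a) em_obj, ('o, 'a) em_arr) em_arr) fctr" where
  "comparison_functor T A S C =
     (let K = (\<lambda>M. (omap (em_free A S) (fst M), hopf_coaction T A S C M)) in
      \<lparr> omap = K,
        amap = (\<lambda>p. (K (fst p), amap (em_free A S) (und p), K (snd (snd p)))) \<rparr>)"


section \<open>Galois functors\<close>

text \<open>
  Let \<open>F\<close> be a functor to \<open>B\<close> with right adjoint \<open>Q\<close> and counit \<open>\<epsilon> : FQ \<rightarrow> 1\<close>, let \<open>G\<close> be a
  comonad on \<open>B\<close> and \<open>\<kappa> : F \<rightarrow> GF\<close> a coaction. Then \<open>galois_map B Q \<epsilon> G \<kappa>\<close> is the composite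
  of \<open>\<kappa>Q : FQ \<rightarrow> GFQ\<close> and \<open>G\<epsilon> : GFQ \<rightarrow> G\<close>.
\<close>

definition galois_map ::
  "('p, 'b, 'z) cat_scheme \<Rightarrow> ('p, 'b, 'o, 'a, 'y) fctr_scheme \<Rightarrow> ('p \<Rightarrow> 'b) \<Rightarrow>
   ('p, 'b, 'u) comnd_scheme \<Rightarrow> ('o \<Rightarrow> 'b) \<Rightarrow> 'p \<Rightarrow> 'b" where
  "galois_map B Q \<epsilon> G \<kappa> Y = amap G (\<epsilon> Y) \<cdot>\<^bsub>B\<^esub> \<kappa> (omap Q Y)"

definition galois ::
  "('p, 'b, 'z) cat_scheme \<Rightarrow> ('o, 'a, 'p, 'b, 'x) fctr_scheme \<Rightarrow>
   ('p, 'b, 'o, 'a, 'y) fctr_scheme \<Rightarrow> ('p \<Rightarrow> 'b) \<Rightarrow>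
   ('p, 'b, 'u) comnd_scheme \<Rightarrow> ('o \<Rightarrow> 'b) \<Rightarrow> bool" where
  "galois B F Q \<epsilon> G \<kappa> \<longleftrightarrow> nat_iso B B (comp_fctr F Q) G (galois_map B Q \<epsilon> G \<kappa>)"

text \<open>The free \<open>S\<close>-module functor on \<open>G\<close>-comodules, for a comonad \<open>G\<close> and a monad \<open>S\<close> on \<open>A\<close>;
  its right adjoint; and the counit of the composite adjunction, whose component at an
  \<open>S\<close>-module \<open>(Y, h)\<close> is \<open>em_free(G(Y)) \<rightarrow> em_free(Y) \<rightarrow> (Y, h)\<close>.\<close>

definition free_comod ::
  "('o, 'a, 'z) cat_scheme \<Rightarrow> ('o, 'a, 'x) mnd_scheme \<Rightarrow>
   (('o, 'a) em_obj, ('o, 'a) em_arr, ('o, 'a) em_obj, ('o, 'a) em_arr) fctr" where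
  "free_comod A S = comp_fctr (em_free A S) coem_forget"

definition cofree_mod ::
  "('o, 'a, 'z) cat_scheme \<Rightarrow> ('o, 'a, 'y) comnd_scheme \<Rightarrow>
   (('o, 'a) em_obj, ('o, 'a) em_arr, ('o, 'a) em_obj, ('o, 'a) em_arr) fctr" where
  "cofree_mod A G = comp_fctr (coem_cofree A G) em_forget"

definition free_comod_counit ::
  "('o, 'a, 'z) cat_scheme \<Rightarrow> ('o, 'a, 'x) mnd_scheme \<Rightarrow> ('o, 'a, 'y) comnd_scheme \<Rightarrow>
   ('o, 'a) em_obj \<Rightarrow> ('o, 'a) em_arr" where
  "free_comod_counit A S G N =
     em_counit S N \<cdot>\<^bsub>em_cat A S\<^esub> amap (em_free A S) (counit G (omap em_forget N))"

end

theory Submission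
  imports Defs
begin

text \<open>
  Let \<open>F \<stileturn> Q\<close> with a coaction \<open>F \<rightarrow> GF\<close> of a comonad \<open>G\<close>, inducing \<open>K\<close> into the \<open>G\<close>-comodules and
  the comonad morphism \<open>t : FQ \<rightarrow> G\<close>.
  If \<open>K\<close> is an equivalence, the cofree comodule on \<open>N\<close> is isomorphic to some \<open>KM\<close>; transposing its
  counit gives \<open>M \<rightarrow> QN\<close>, whose image under \<open>F\<close> provides a right inverse of \<open>t\<^sub>N\<close>, and fullness of \<open>K\<close>
  makes it two-sided.
  If \<open>t\<close> is invertible, a \<open>G\<close>-comodule \<open>(N, \<theta>)\<close> amounts to \<open>\<theta>' = t\<inverse>\<theta> : N \<rightarrow> FQN\<close>, and the pair
  \<open>\<eta>QN, Q\<theta>'\<close> is coreflexive and \<open>F\<close>-split with split equaliser \<open>\<theta>'\<close>. An equaliser of that pair preserved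
  by \<open>F\<close> is therefore sent by \<open>K\<close> to \<open>(N, \<theta>)\<close>; applied to \<open>KM\<close>, conservativity of \<open>F\<close> makes \<open>\<eta>M\<close> an
  equaliser, so \<open>K\<close> is fully faithful.
  For \<open>F\<close> the free \<open>S\<close>-module functor on \<open>C\<close>-comodules, such equalisers are created from \<open>A\<close>:
  preservation by \<open>C \<diamond> -\<close> and its square yields the coaction and its coassociativity.
\<close>

section \<open>Categories and equivalences\<close>

text \<open>The hypotheses concern equalisers in A, whereas Beck's argument takes equalisers of
  C-comodules. The gap closes because F factors through the forgetful functor to A: a coreflexive
  F-split pair of comodules has an underlying coreflexive pair in A that is split by the free
  \<open>S\<close>-module functor, and F preserves an equaliser of comodules as soon as
  \<open>S\<close> preserves the underlying one. No adjoint of \<open>K\<close> is built.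
  \<open>K\<close> is shown to be fully faithful and essentially surjective, and a quasi-inverse is
  then obtained by choice. The comonad on \<open>S\<close>-modules is handled through its underlying
  arrows: these are the structure arrows of the comonad on A given by the comonoid T(C) in V, so the
  comonad laws are inherited from A. What has to be proved is that the structure arrows are
  morphisms of \<open>S\<close>-modules, and there the axioms of \<open>chi\<close> enter.\<close>

lemma hom_iff [simp]: "f \<in> hom C X Y \<longleftrightarrow> f \<in> Arr C \<and> Dom C f = X \<and> Cod C f = Y"
  by (simp add: hom_def)

lemma id_fctr_simps [simp]: "omap id_fctr X = X" "amap id_fctr f = f"
  by (simp_all add: id_fctr_def)

lemma comp_fctr_simps [simp]:
  "omap (comp_fctr G F) X = omap G (omap F X)" "amap (comp_fctr G F) f = amap G (amap F f)"
  by (simp_all add: comp_fctr_def)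

section \<open>Composition, isomorphisms and equalisers in one category\<close>

context category
begin

lemma dom_obj [simp]: "f \<in> Arr C \<Longrightarrow> Dom C f \<in> Obj C"
  by (rule Dom_Obj)

lemma cod_obj [simp]: "f \<in> Arr C \<Longrightarrow> Cod C f \<in> Obj C"
  by (rule Cod_Obj)

lemma id_arr [simp]:
  assumes "X \<in> Obj C"
  shows "\<one> X \<in> Arr C" "Dom C (\<one> X) = X" "Cod C (\<one> X) = X"
  using Ident_hom [OF assms] by simp_all

lemma comp_arr [simp]:
  assumes "f \<in> Arr C" "g \<in> Arr C" "Dom C g = Cod C f"
  shows "g \<cdot> f \<in> Arr C" "Dom C (g \<cdot> f) = Dom C f" "Cod C (g \<cdot> f) = Cod C g"
  using Comp_hom [of f "Dom C f" "Cod C f" g "Cod C g"] assms by simp_all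

lemma comp_id_right [simp]: "f \<in> Arr C \<Longrightarrow> X = Dom C f \<Longrightarrow> f \<cdot> \<one> X = f"
  by (rule Comp_Ident_right [of _ _ "Cod C f"]) simp

lemma comp_id_left [simp]: "f \<in> Arr C \<Longrightarrow> X = Cod C f \<Longrightarrow> \<one> X \<cdot> f = f"
  by (rule Comp_Ident_left [of _ "Dom C f"]) simp

lemma comp_assoc [simp]:
  assumes "f \<in> Arr C" "g \<in> Arr C" "h \<in> Arr C" "Dom C g = Cod C f" "Dom C h = Cod C g"
  shows "(h \<cdot> g) \<cdot> f = h \<cdot> (g \<cdot> f)"
  using Comp_assoc [of f "Dom C f" "Dom C g" g "Dom C h" h "Cod C h"] assms by simp

text \<open>Since \<open>comp_assoc\<close> nests composites to the right, an equation
  \<open>g \<cdot> f = k\<close> no longer matches inside a longer composite. This form carries the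
  tail \<open>x\<close> along; instances of it serve as rewrite rules throughout.\<close>

lemma comp_reduce:
  assumes "g \<cdot> f = k" "x \<in> Arr C" "f \<in> Arr C" "g \<in> Arr C" "Dom C f = Cod C x" "Dom C g = Cod C f"
  shows "g \<cdot> (f \<cdot> x) = k \<cdot> x"
  using assms comp_assoc by metis

lemma isoE:
  assumes "iso C f"
  obtains g where "f \<in> Arr C" "g \<in> Arr C" "Dom C g = Cod C f" "Cod C g = Dom C f"
    "g \<cdot> f = \<one> (Dom C f)" "f \<cdot> g = \<one> (Cod C f)"
  using assms by (auto simp: iso_def)

lemma isoI:
  assumes "f \<in> Arr C" "g \<in> Arr C" "Dom C g = Cod C f" "Cod C g = Dom C f"
    "g \<cdot> f = \<one> (Dom C f)" "f \<cdot> g = \<one> (Cod C f)"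
  shows "iso C f"
  using assms by (auto simp: iso_def)

lemma iso_cancel:
  assumes "iso C f" "f \<cdot> u = f \<cdot> v" "u \<in> Arr C" "v \<in> Arr C" "Dom C u = Dom C v"
    "Cod C u = Dom C f" "Cod C v = Dom C f"
  shows "u = v"
proof -
  obtain g where g: "f \<in> Arr C" "g \<in> Arr C" "Dom C g = Cod C f" "Cod C g = Dom C f"
    "g \<cdot> f = \<one> (Dom C f)"
    using assms(1) by (rule isoE)
  have "g \<cdot> (f \<cdot> u) = g \<cdot> (f \<cdot> v)" by (simp only: assms(2))
  then show ?thesis using g assms(3-) by (simp add: comp_reduce [OF g(5)])
qed

text \<open>Cancelling \<open>f\<close> identifies \<open>u\<close> with the inverse of
  \<open>f\<close>, so a one-sided equation is enough.\<close>

lemma iso_section: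
  assumes "iso C f" "u \<in> Arr C" "Cod C u = Dom C f" "f \<cdot> u = \<one> (Dom C u)" "Dom C u = Cod C f"
  shows "iso C u"
proof -
  obtain g where g: "f \<in> Arr C" "g \<in> Arr C" "Dom C g = Cod C f" "Cod C g = Dom C f"
    "g \<cdot> f = \<one> (Dom C f)" "f \<cdot> g = \<one> (Cod C f)"
    using assms(1) by (rule isoE)
  have "u = g" using g assms by (rule_tac iso_cancel [OF assms(1)]) simp_all
  with g show ?thesis by (intro isoI [of u f]) simp_all
qed

lemma mono_equaliser:
  assumes "is_equaliser C f g e" "u \<in> Arr C" "v \<in> Arr C" "Dom C u = Dom C v"
    "Cod C u = Dom C e" "Cod C v = Dom C e" "e \<cdot> u = e \<cdot> v"
  shows "u = v"
proof -
  have e: "e \<in> Arr C" "f \<in> Arr C" "g \<in> Arr C" "Cod C e = Dom C f" "Dom C g = Dom C f" "f \<cdot> e = g \<cdot> e"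
    using assms(1) unfolding is_equaliser_def parallel_pair_def by metis+
  have "f \<cdot> (e \<cdot> u) = g \<cdot> (e \<cdot> u)"
    using e assms(2,5) by (metis comp_assoc)
  then have "\<exists>!w. w \<in> hom C (Dom C (e \<cdot> u)) (Dom C e) \<and> e \<cdot> w = e \<cdot> u"
    using assms(1,2,5) e comp_arr [of u e] unfolding is_equaliser_def by metis
  then show ?thesis using assms(2-) e(1) comp_arr [of u e] by (metis hom_iff)
qed

lemma equaliser_factor:
  assumes "is_equaliser C f g e" "k \<in> Arr C" "Cod C k = Dom C f" "f \<cdot> k = g \<cdot> k"
  obtains u where "u \<in> Arr C" "Dom C u = Dom C k" "Cod C u = Dom C e" "e \<cdot> u = k"
proof -
  have "\<exists>!u. u \<in> hom C (Dom C k) (Dom C e) \<and> e \<cdot> u = k"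
    using assms unfolding is_equaliser_def by blast
  then show ?thesis using that by auto
qed

lemma is_equaliserD:
  assumes "is_equaliser C f g e"
  shows "e \<in> Arr C" "f \<in> Arr C" "g \<in> Arr C" "Cod C e = Dom C f" "Dom C g = Dom C f"
    "Cod C g = Cod C f" "f \<cdot> e = g \<cdot> e"
  using assms unfolding is_equaliser_def parallel_pair_def by metis+

lemma is_equaliserI:
  assumes "e \<in> Arr C" "f \<in> Arr C" "g \<in> Arr C" "Cod C e = Dom C f" "Dom C g = Dom C f"
    "Cod C g = Cod C f" "f \<cdot> e = g \<cdot> e"
    and "\<And>k. k \<in> Arr C \<Longrightarrow> Cod C k = Dom C f \<Longrightarrow> f \<cdot> k = g \<cdot> k \<Longrightarrow>
           \<exists>u \<in> Arr C. Dom C u = Dom C k \<and> Cod C u = Dom C e \<and> e \<cdot> u = k"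
    and "\<And>u v. u \<in> Arr C \<Longrightarrow> v \<in> Arr C \<Longrightarrow> Dom C u = Dom C v \<Longrightarrow> Cod C u = Dom C e \<Longrightarrow>
           Cod C v = Dom C e \<Longrightarrow> e \<cdot> u = e \<cdot> v \<Longrightarrow> u = v"
  shows "is_equaliser C f g e"
  unfolding is_equaliser_def parallel_pair_def
proof (intro conjI ballI impI)
  fix k assume "k \<in> Arr C" and "Cod C k = Dom C f \<and> f \<cdot> k = g \<cdot> k"
  with assms(8) obtain u where u: "u \<in> Arr C" "Dom C u = Dom C k" "Cod C u = Dom C e" "e \<cdot> u = k"
    by blast
  show "\<exists>!u. u \<in> hom C (Dom C k) (Dom C e) \<and> e \<cdot> u = k"
    using u assms(9) by (intro ex1I [of _ u]) auto
qed (use assms in auto)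

text \<open>Equalisers are determined only up to isomorphism. This lets an arrow be recognised as an
  equaliser once it factors through a given one by an isomorphism.\<close>

lemma equaliser_iso:
  assumes "is_equaliser C f g e" "iso C v" "Cod C v = Dom C e"
  shows "is_equaliser C f g (e \<cdot> v)"
proof -
  note e = is_equaliserD [OF assms(1)]
  obtain v' where v: "v \<in> Arr C" "v' \<in> Arr C" "Dom C v' = Cod C v" "Cod C v' = Dom C v"
    "v' \<cdot> v = \<one> (Dom C v)" "v \<cdot> v' = \<one> (Cod C v)"
    using assms(2) by (rule isoE)
  show ?thesis
  proof (rule is_equaliserI)
    show "f \<cdot> (e \<cdot> v) = g \<cdot> (e \<cdot> v)"
      using e(1-4) assms(3) v(1) by (simp add: comp_reduce [OF e(7)] e(5))
  next
    fix k assume k: "k \<in> Arr C" "Cod C k = Dom C f" "f \<cdot> k = g \<cdot> k"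
    obtain u where u: "u \<in> Arr C" "Dom C u = Dom C k" "Cod C u = Dom C e" "e \<cdot> u = k"
      by (rule equaliser_factor [OF assms(1) k])
    show "\<exists>u \<in> Arr C. Dom C u = Dom C k \<and> Cod C u = Dom C (e \<cdot> v) \<and> (e \<cdot> v) \<cdot> u = k"
      using e(1-4) assms(3) v(1-4) u
      by (intro bexI [of _ "v' \<cdot> u"]) (simp_all add: comp_reduce [OF v(6)])
  next
    fix x y
    assume xy: "x \<in> Arr C" "y \<in> Arr C" "Dom C x = Dom C y" "Cod C x = Dom C (e \<cdot> v)"
      "Cod C y = Dom C (e \<cdot> v)" "(e \<cdot> v) \<cdot> x = (e \<cdot> v) \<cdot> y"
    then have "v \<cdot> x = v \<cdot> y"
      using e(1-4) assms(3) v(1) by (rule_tac mono_equaliser [OF assms(1)]) simp_all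
    then show "x = y"
      using xy e(1-4) assms(3) v(1) by (rule_tac iso_cancel [OF assms(2)]) simp_all
  qed (use e assms(3) v in simp_all)
qed

end

section \<open>Functors and natural transformations\<close>

context cat_functor
begin

lemma omap_obj [simp]: "X \<in> Obj C \<Longrightarrow> omap F X \<in> Obj D"
  by (rule omap_Obj)

lemma amap_arr [simp]:
  assumes "f \<in> Arr C"
  shows "amap F f \<in> Arr D" "Dom D (amap F f) = omap F (Dom C f)" "Cod D (amap F f) = omap F (Cod C f)"
  using amap_hom [of f "Dom C f" "Cod C f"] assms by simp_all

lemma amap_id [simp]: "X \<in> Obj C \<Longrightarrow> amap F (\<one>\<^bsub>C\<^esub> X) = \<one>\<^bsub>D\<^esub> (omap F X)"
  by (rule amap_Ident)

lemma amap_comp: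
  assumes "f \<in> Arr C" "g \<in> Arr C" "Dom C g = Cod C f"
  shows "amap F (g \<cdot>\<^bsub>C\<^esub> f) = amap F g \<cdot>\<^bsub>D\<^esub> amap F f"
  using amap_Comp [of f "Dom C f" "Cod C f" g "Cod C g"] assms by simp

lemma comp_amap:
  assumes "f \<in> Arr C" "g \<in> Arr C" "Dom C g = Cod C f" "x \<in> Arr D" "Cod D x = omap F (Dom C f)"
  shows "amap F g \<cdot>\<^bsub>D\<^esub> (amap F f \<cdot>\<^bsub>D\<^esub> x) = amap F (g \<cdot>\<^bsub>C\<^esub> f) \<cdot>\<^bsub>D\<^esub> x"
  using assms by (simp add: amap_comp)

lemma preserves_iso:
  assumes "iso C f"
  shows "iso D (amap F f)"
  using assms
proof (rule C.isoE)
  fix g assume "f \<in> Arr C" "g \<in> Arr C" "Dom C g = Cod C f" "Cod C g = Dom C f"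
    "g \<cdot>\<^bsub>C\<^esub> f = \<one>\<^bsub>C\<^esub> (Dom C f)" "f \<cdot>\<^bsub>C\<^esub> g = \<one>\<^bsub>C\<^esub> (Cod C f)"
  then show ?thesis by (intro D.isoI [of _ "amap F g"]) (simp_all flip: amap_comp)
qed

end

lemma (in category) id_cat_functor: "cat_functor C C id_fctr"
  by unfold_locales auto

lemma comp_cat_functor:
  assumes "cat_functor C D F" "cat_functor D E G"
  shows "cat_functor C E (comp_fctr G F)"
proof -
  interpret F: cat_functor C D F by fact
  interpret G: cat_functor D E G by fact
  show ?thesis by unfold_locales (auto simp: F.amap_comp G.amap_comp)
qed

context nat_trans
begin

lemma component_arr [simp]:
  assumes "X \<in> Obj C"
  shows "\<tau> X \<in> Arr D" "Dom D (\<tau> X) = omap F X" "Cod D (\<tau> X) = omap G X"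
  using component_hom [OF assms] by simp_all

lemma natural:
  "f \<in> Arr C \<Longrightarrow> \<tau> (Cod C f) \<cdot>\<^bsub>D\<^esub> amap F f = amap G f \<cdot>\<^bsub>D\<^esub> \<tau> (Dom C f)"
  by (rule naturality) simp

end

lemma nat_transI:
  assumes "cat_functor C D F" "cat_functor C D G"
    and "\<And>X. X \<in> Obj C \<Longrightarrow> \<tau> X \<in> hom D (omap F X) (omap G X)"
    and "\<And>f. f \<in> Arr C \<Longrightarrow> \<tau> (Cod C f) \<cdot>\<^bsub>D\<^esub> amap F f = amap G f \<cdot>\<^bsub>D\<^esub> \<tau> (Dom C f)"
  shows "nat_trans C D F G \<tau>"
proof -
  interpret F: cat_functor C D F by fact
  interpret G: cat_functor C D G by fact
  show ?thesis using assms(3,4) by unfold_locales auto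
qed

section \<open>Equivalences and fully faithful, essentially surjective functors\<close>

lemma equivalence_imp_ess_surj:
  fixes C :: "('o, 'a, 'z) cat_scheme" and D :: "('p, 'b, 'y) cat_scheme"
  assumes "equivalence_of_categories C D K" "Y \<in> Obj D"
  obtains X \<beta> where "X \<in> Obj C" "iso D \<beta>" "Dom D \<beta> = omap K X" "Cod D \<beta> = Y"
proof -
  obtain L :: "('p, 'b, 'o, 'a) fctr" and \<epsilon> where L: "cat_functor D C L" "nat_iso D D (comp_fctr K L) id_fctr \<epsilon>"
    using assms(1) unfolding equivalence_of_categories_def by blast
  interpret L: cat_functor D C L by fact
  interpret e: nat_iso D D "comp_fctr K L" id_fctr \<epsilon> by fact
  show ?thesis
    by (rule that [of "omap L Y" "\<epsilon> Y"]) (use assms(2) e.component_iso in auto)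
qed

text \<open>The preimage is \<open>L f\<close> conjugated by \<open>\<eta>\<close>. Naturality of
  \<open>\<eta>\<close> only shows that it agrees with \<open>f\<close> after \<open>L\<close>. As
  no triangle identity links \<open>\<eta>\<close> and \<open>\<epsilon>\<close>, the functor
  \<open>L\<close> is stripped off by a separate use of \<open>\<epsilon>\<close>.\<close>

lemma equivalence_imp_full:
  fixes C :: "('o, 'a, 'z) cat_scheme" and D :: "('p, 'b, 'y) cat_scheme"
  assumes "equivalence_of_categories C D K" "X \<in> Obj C" "Y \<in> Obj C"
    and f: "f \<in> Arr D" "Dom D f = omap K X" "Cod D f = omap K Y"
  obtains g where "g \<in> Arr C" "Dom C g = X" "Cod C g = Y" "amap K g = f"
proof -
  obtain L :: "('p, 'b, 'o, 'a) fctr" and \<eta> \<epsilon> where L: "cat_functor C D K" "cat_functor D C L"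
    "nat_iso C C id_fctr (comp_fctr L K) \<eta>" "nat_iso D D (comp_fctr K L) id_fctr \<epsilon>"
    using assms(1) unfolding equivalence_of_categories_def by blast
  interpret K: cat_functor C D K by fact
  interpret L: cat_functor D C L by fact
  interpret h: nat_iso C C id_fctr "comp_fctr L K" \<eta> by fact
  interpret e: nat_iso D D "comp_fctr K L" id_fctr \<epsilon> by fact
  obtain \<eta>' where h': "\<eta>' \<in> Arr C" "Dom C \<eta>' = Cod C (\<eta> Y)" "Cod C \<eta>' = Y"
    "\<eta>' \<cdot>\<^bsub>C\<^esub> \<eta> Y = \<one>\<^bsub>C\<^esub> Y" "\<eta> Y \<cdot>\<^bsub>C\<^esub> \<eta>' = \<one>\<^bsub>C\<^esub> (Cod C (\<eta> Y))"
    using h.component_iso [OF assms(3)] assms(3) by (auto elim!: K.C.isoE)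
  obtain \<eta>'' where h'': "\<eta>'' \<in> Arr C" "Dom C \<eta>'' = Cod C (\<eta> X)" "Cod C \<eta>'' = X"
    "\<eta>'' \<cdot>\<^bsub>C\<^esub> \<eta> X = \<one>\<^bsub>C\<^esub> X" "\<eta> X \<cdot>\<^bsub>C\<^esub> \<eta>'' = \<one>\<^bsub>C\<^esub> (Cod C (\<eta> X))"
    using h.component_iso [OF assms(2)] assms(2) by (auto elim!: K.C.isoE)
  define g where "g = \<eta>' \<cdot>\<^bsub>C\<^esub> amap L f \<cdot>\<^bsub>C\<^esub> \<eta> X"
  have g: "g \<in> Arr C" "Dom C g = X" "Cod C g = Y"
    unfolding g_def using assms(2,3) f h' by simp_all
  have "amap L (amap K g) \<cdot>\<^bsub>C\<^esub> \<eta> X = \<eta> Y \<cdot>\<^bsub>C\<^esub> g" using h.natural [OF g(1)] g by simp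
  also have "\<dots> = amap L f \<cdot>\<^bsub>C\<^esub> \<eta> X"
    unfolding g_def using assms(2,3) f h' by (simp add: K.C.comp_reduce [OF h'(5)])
  finally have "(amap L (amap K g) \<cdot>\<^bsub>C\<^esub> \<eta> X) \<cdot>\<^bsub>C\<^esub> \<eta>'' = (amap L f \<cdot>\<^bsub>C\<^esub> \<eta> X) \<cdot>\<^bsub>C\<^esub> \<eta>''" by simp
  then have LL: "amap L (amap K g) = amap L f"
    using g f h'' assms(2,3) by simp
  let ?e = "\<epsilon> (omap K X)"
  obtain e' where e': "e' \<in> Arr D" "Dom D e' = Cod D ?e" "Cod D e' = Dom D ?e"
    "?e \<cdot>\<^bsub>D\<^esub> e' = \<one>\<^bsub>D\<^esub> (Cod D ?e)"
    using e.component_iso [of "omap K X"] assms(2) by (auto elim!: K.D.isoE)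
  \<comment> \<open>Applying \<open>K\<close> to \<open>LL\<close> and using naturality of
    \<open>\<epsilon>\<close> at both arrows compares them after the isomorphism \<open>?e\<close>,
    which is then cancelled.\<close>
  have "amap K g \<cdot>\<^bsub>D\<^esub> ?e = f \<cdot>\<^bsub>D\<^esub> ?e"
    using e.natural [of "amap K g"] e.natural [OF f(1)] g f LL by simp
  then have "(amap K g \<cdot>\<^bsub>D\<^esub> ?e) \<cdot>\<^bsub>D\<^esub> e' = (f \<cdot>\<^bsub>D\<^esub> ?e) \<cdot>\<^bsub>D\<^esub> e'" by simp
  then have "amap K g = f" using g f e' assms(2) by simp
  with g show ?thesis by (rule that)
qed

text \<open>Choice provides, for each \<open>Y\<close>, a preimage \<open>P Y\<close> with mutually
  inverse arrows \<open>b Y\<close> and \<open>c Y\<close>, and for each arrow between images a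
  preimage \<open>h\<close>. Every equation required in \<open>C\<close> is proved after applying
  \<open>K\<close>, by faithfulness; there the pairs \<open>b\<close>, \<open>c\<close>
  cancel.\<close>

lemma equivalenceI:
  fixes C :: "('o, 'a, 'z) cat_scheme" and D :: "('p, 'b, 'y) cat_scheme"
    and K :: "('o, 'a, 'p, 'b, 'x) fctr_scheme"
  assumes "cat_functor C D K"
    and full: "\<And>X Y f. X \<in> Obj C \<Longrightarrow> Y \<in> Obj C \<Longrightarrow> f \<in> Arr D \<Longrightarrow> Dom D f = omap K X \<Longrightarrow>
      Cod D f = omap K Y \<Longrightarrow> \<exists>g \<in> Arr C. Dom C g = X \<and> Cod C g = Y \<and> amap K g = f"
    and faithful: "\<And>f g. f \<in> Arr C \<Longrightarrow> g \<in> Arr C \<Longrightarrow> Dom C f = Dom C g \<Longrightarrow> Cod C f = Cod C g \<Longrightarrow>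
      amap K f = amap K g \<Longrightarrow> f = g"
    and ess_surj: "\<And>Y. Y \<in> Obj D \<Longrightarrow> \<exists>X \<in> Obj C. \<exists>\<beta>. iso D \<beta> \<and> Dom D \<beta> = omap K X \<and> Cod D \<beta> = Y"
  shows "equivalence_of_categories C D K"
proof -
  interpret K: cat_functor C D K by fact
  have "\<forall>Y. \<exists>X \<beta> \<gamma>. Y \<in> Obj D \<longrightarrow> X \<in> Obj C \<and> \<beta> \<in> Arr D \<and> \<gamma> \<in> Arr D \<and> Dom D \<beta> = omap K X \<and>
      Cod D \<beta> = Y \<and> Dom D \<gamma> = Y \<and> Cod D \<gamma> = omap K X \<and>
      \<gamma> \<cdot>\<^bsub>D\<^esub> \<beta> = \<one>\<^bsub>D\<^esub> (omap K X) \<and> \<beta> \<cdot>\<^bsub>D\<^esub> \<gamma> = \<one>\<^bsub>D\<^esub> Y"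
    using ess_surj by (metis K.D.isoE)
  then obtain P b c where "\<forall>Y. Y \<in> Obj D \<longrightarrow> P Y \<in> Obj C \<and> b Y \<in> Arr D \<and> c Y \<in> Arr D \<and>
      Dom D (b Y) = omap K (P Y) \<and> Cod D (b Y) = Y \<and> Dom D (c Y) = Y \<and> Cod D (c Y) = omap K (P Y) \<and>
      c Y \<cdot>\<^bsub>D\<^esub> b Y = \<one>\<^bsub>D\<^esub> (omap K (P Y)) \<and> b Y \<cdot>\<^bsub>D\<^esub> c Y = \<one>\<^bsub>D\<^esub> Y"
    by metis
  then have P [simp]: "P Y \<in> Obj C" "b Y \<in> Arr D" "c Y \<in> Arr D"
      "Dom D (b Y) = omap K (P Y)" "Cod D (b Y) = Y" "Dom D (c Y) = Y" "Cod D (c Y) = omap K (P Y)"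
      "c Y \<cdot>\<^bsub>D\<^esub> b Y = \<one>\<^bsub>D\<^esub> (omap K (P Y))" "b Y \<cdot>\<^bsub>D\<^esub> c Y = \<one>\<^bsub>D\<^esub> Y" if "Y \<in> Obj D" for Y
    using that by auto
  have cancel [simp]: "c Y \<cdot>\<^bsub>D\<^esub> (b Y \<cdot>\<^bsub>D\<^esub> x) = x" if "Y \<in> Obj D" "x \<in> Arr D" "Cod D x = omap K (P Y)" for Y x
    using that by (simp add: K.D.comp_reduce [OF P(8)])
  have cancel' [simp]: "b Y \<cdot>\<^bsub>D\<^esub> (c Y \<cdot>\<^bsub>D\<^esub> x) = x" if "Y \<in> Obj D" "x \<in> Arr D" "Cod D x = Y" for Y x
    using that by (simp add: K.D.comp_reduce [OF P(9)])
  have "\<forall>X Y f. \<exists>g. X \<in> Obj C \<longrightarrow> Y \<in> Obj C \<longrightarrow> f \<in> Arr D \<longrightarrow> Dom D f = omap K X \<longrightarrow>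
      Cod D f = omap K Y \<longrightarrow> g \<in> Arr C \<and> Dom C g = X \<and> Cod C g = Y \<and> amap K g = f"
    using full by metis
  then obtain h where "\<forall>X Y f. X \<in> Obj C \<longrightarrow> Y \<in> Obj C \<longrightarrow> f \<in> Arr D \<longrightarrow> Dom D f = omap K X \<longrightarrow>
      Cod D f = omap K Y \<longrightarrow> h X Y f \<in> Arr C \<and> Dom C (h X Y f) = X \<and> Cod C (h X Y f) = Y \<and>
      amap K (h X Y f) = f"
    by metis
  then have h [simp]: "h X Y f \<in> Arr C" "Dom C (h X Y f) = X" "Cod C (h X Y f) = Y"
      "amap K (h X Y f) = f"
    if "X \<in> Obj C" "Y \<in> Obj C" "f \<in> Arr D" "Dom D f = omap K X" "Cod D f = omap K Y" for X Y f
    using that by auto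
  \<comment> \<open>On arrows, the preimage under \<open>K\<close> of \<open>f\<close> transported
    along the chosen isomorphisms.\<close>
  define L :: "('p, 'b, 'o, 'a) fctr" where "L = \<lparr> omap = P,
    amap = (\<lambda>f. h (P (Dom D f)) (P (Cod D f)) (c (Cod D f) \<cdot>\<^bsub>D\<^esub> f \<cdot>\<^bsub>D\<^esub> b (Dom D f))) \<rparr>"
  have L [simp]: "omap L Y = P Y"
    "amap L f = h (P (Dom D f)) (P (Cod D f)) (c (Cod D f) \<cdot>\<^bsub>D\<^esub> f \<cdot>\<^bsub>D\<^esub> b (Dom D f))" for Y f
    by (simp_all add: L_def)
  \<comment> \<open>The unit and its inverse are the preimages of \<open>c\<close> and
    \<open>b\<close> at \<open>K X\<close>; the counit of the equivalence is \<open>b\<close>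
    itself.\<close>
  define \<eta> where "\<eta> X = h X (P (omap K X)) (c (omap K X))" for X
  define \<eta>' where "\<eta>' X = h (P (omap K X)) X (b (omap K X))" for X
  have L_functor: "cat_functor D C L"
    by unfold_locales (auto intro!: faithful simp: K.amap_comp)
  have \<eta>_iso: "iso C (\<eta> X)" if "X \<in> Obj C" for X
    using that unfolding \<eta>_def
    by (intro K.C.isoI [of _ "\<eta>' X"]) (auto intro!: faithful simp: K.amap_comp \<eta>'_def)
  have "nat_trans C C id_fctr (comp_fctr L K) \<eta>"
    by (rule nat_transI [OF K.C.id_cat_functor comp_cat_functor [OF \<open>cat_functor C D K\<close> L_functor]])
      (auto simp: \<eta>_def K.amap_comp intro!: faithful)
  then have \<eta>: "nat_iso C C id_fctr (comp_fctr L K) \<eta>"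
    using \<eta>_iso by (simp add: nat_iso_def nat_iso_axioms_def)
  have b_iso: "iso D (b Y)" if "Y \<in> Obj D" for Y
    using that by (intro K.D.isoI [of _ "c Y"]) auto
  have "nat_trans D D (comp_fctr K L) id_fctr b"
    by (rule nat_transI [OF comp_cat_functor [OF L_functor \<open>cat_functor C D K\<close>] K.D.id_cat_functor]) auto
  then have "nat_iso D D (comp_fctr K L) id_fctr b"
    using b_iso by (simp add: nat_iso_def nat_iso_axioms_def)
  with \<eta> L_functor assms(1) show ?thesis unfolding equivalence_of_categories_def by blast
qed

section \<open>Eilenberg--Moore categories\<close>

text \<open>Arrows are described by projections instead of a tuple pattern, so that the equations
  rewrite an arbitrary \<open>p\<close> without a case split.\<close>

lemma em_cat_simps:
  "Obj (em_cat C T) = em_obj C T" "Dom (em_cat C T) p = fst p" "Cod (em_cat C T) p = snd (snd p)"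
  "Ident (em_cat C T) M = (M, \<one>\<^bsub>C\<^esub> (fst M), M)"
  "q \<cdot>\<^bsub>em_cat C T\<^esub> p = (fst p, und q \<cdot>\<^bsub>C\<^esub> und p, snd (snd q))"
  "p \<in> Arr (em_cat C T) \<longleftrightarrow> fst p \<in> em_obj C T \<and> snd (snd p) \<in> em_obj C T \<and> und p \<in> Arr C \<and>
     Dom C (und p) = fst (fst p) \<and> Cod C (und p) = fst (snd (snd p)) \<and>
     und p \<cdot>\<^bsub>C\<^esub> snd (fst p) = snd (snd (snd p)) \<cdot>\<^bsub>C\<^esub> amap T (und p)"
  by (cases p; force simp: em_cat_def)+

lemma em_obj_iff:
  "M \<in> em_obj C T \<longleftrightarrow> fst M \<in> Obj C \<and> snd M \<in> Arr C \<and> Dom C (snd M) = omap T (fst M) \<and>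
     Cod C (snd M) = fst M \<and> snd M \<cdot>\<^bsub>C\<^esub> amap T (snd M) = snd M \<cdot>\<^bsub>C\<^esub> mult T (fst M) \<and>
     snd M \<cdot>\<^bsub>C\<^esub> ret T (fst M) = \<one>\<^bsub>C\<^esub> (fst M)"
  by (auto simp: em_obj_def)

lemma coem_cat_simps:
  "Obj (coem_cat C G) = coem_obj C G" "Dom (coem_cat C G) p = fst p"
  "Cod (coem_cat C G) p = snd (snd p)" "Ident (coem_cat C G) M = (M, \<one>\<^bsub>C\<^esub> (fst M), M)"
  "q \<cdot>\<^bsub>coem_cat C G\<^esub> p = (fst p, und q \<cdot>\<^bsub>C\<^esub> und p, snd (snd q))"
  "p \<in> Arr (coem_cat C G) \<longleftrightarrow> fst p \<in> coem_obj C G \<and> snd (snd p) \<in> coem_obj C G \<and> und p \<in> Arr C \<and>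
     Dom C (und p) = fst (fst p) \<and> Cod C (und p) = fst (snd (snd p)) \<and>
     snd (snd (snd p)) \<cdot>\<^bsub>C\<^esub> und p = amap G (und p) \<cdot>\<^bsub>C\<^esub> snd (fst p)"
  by (cases p; force simp: coem_cat_def)+

lemma coem_obj_iff:
  "M \<in> coem_obj C G \<longleftrightarrow> fst M \<in> Obj C \<and> snd M \<in> Arr C \<and> Dom C (snd M) = fst M \<and>
     Cod C (snd M) = omap G (fst M) \<and> amap G (snd M) \<cdot>\<^bsub>C\<^esub> snd M = comult G (fst M) \<cdot>\<^bsub>C\<^esub> snd M \<and>
     counit G (fst M) \<cdot>\<^bsub>C\<^esub> snd M = \<one>\<^bsub>C\<^esub> (fst M)"
  by (auto simp: coem_obj_def)

section \<open>Monads and comonads with their free and cofree functors\<close>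

sublocale monad \<subseteq> category C
  using T_functor by (rule cat_functor.axioms)

sublocale comonad \<subseteq> category C
  using G_functor by (rule cat_functor.axioms)

sublocale monad \<subseteq> T: cat_functor C C T
  by (rule T_functor)

sublocale comonad \<subseteq> G: cat_functor C C G
  by (rule G_functor)

context monad
begin

lemma mult_arr [simp]:
  assumes "X \<in> Obj C"
  shows "mult T X \<in> Arr C" "Dom C (mult T X) = omap T (omap T X)" "Cod C (mult T X) = omap T X"
  using nat_trans.component_arr [OF mult_nat assms] by simp_all

lemma ret_arr [simp]:
  assumes "X \<in> Obj C"
  shows "ret T X \<in> Arr C" "Dom C (ret T X) = X" "Cod C (ret T X) = omap T X"
  using nat_trans.component_arr [OF ret_nat assms] by simp_all

lemma mult_natural:
  "f \<in> Arr C \<Longrightarrow> mult T (Cod C f) \<cdot> amap T (amap T f) = amap T f \<cdot> mult T (Dom C f)"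
  using nat_trans.natural [OF mult_nat, of f] by simp

lemma ret_natural: "f \<in> Arr C \<Longrightarrow> ret T (Cod C f) \<cdot> f = amap T f \<cdot> ret T (Dom C f)"
  using nat_trans.natural [OF ret_nat, of f] by simp

lemma em_category: "category (em_cat C T)"
proof
  fix p q and X Y Z
  assume "p \<in> hom (em_cat C T) X Y" "q \<in> hom (em_cat C T) Y Z"
  then have p: "fst p = X" "snd (snd p) = Y" "X \<in> em_obj C T" "Y \<in> em_obj C T" "und p \<in> Arr C"
    "Dom C (und p) = fst X" "Cod C (und p) = fst Y" "und p \<cdot> snd X = snd Y \<cdot> amap T (und p)"
    and q: "fst q = Y" "snd (snd q) = Z" "Z \<in> em_obj C T" "und q \<in> Arr C"
    "Dom C (und q) = fst Y" "Cod C (und q) = fst Z" "und q \<cdot> snd Y = snd Z \<cdot> amap T (und q)"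
    by (auto simp: em_cat_simps)
  have "(und q \<cdot> und p) \<cdot> snd X = snd Z \<cdot> amap T (und q \<cdot> und p)"
    using p q by (simp add: em_obj_iff comp_reduce [OF q(7)] T.amap_comp)
  with p q show "q \<cdot>\<^bsub>em_cat C T\<^esub> p \<in> hom (em_cat C T) X Z"
    by (simp add: em_cat_simps)
qed (auto simp: em_cat_simps em_obj_iff prod_eq_iff)

end

context comonad
begin

lemma comult_arr [simp]:
  assumes "X \<in> Obj C"
  shows "comult G X \<in> Arr C" "Dom C (comult G X) = omap G X"
    "Cod C (comult G X) = omap G (omap G X)"
  using nat_trans.component_arr [OF comult_nat assms] by simp_all

lemma counit_arr [simp]:
  assumes "X \<in> Obj C"
  shows "counit G X \<in> Arr C" "Dom C (counit G X) = omap G X" "Cod C (counit G X) = X"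
  using nat_trans.component_arr [OF counit_nat assms] by simp_all

lemma comult_natural:
  "f \<in> Arr C \<Longrightarrow> comult G (Cod C f) \<cdot> amap G f = amap G (amap G f) \<cdot> comult G (Dom C f)"
  using nat_trans.natural [OF comult_nat, of f] by simp

lemma counit_natural: "f \<in> Arr C \<Longrightarrow> counit G (Cod C f) \<cdot> amap G f = f \<cdot> counit G (Dom C f)"
  using nat_trans.natural [OF counit_nat, of f] by simp

lemma cofree_obj: "X \<in> Obj C \<Longrightarrow> (omap G X, comult G X) \<in> coem_obj C G"
  using comult_coassoc counit_comult_left by (simp add: coem_obj_iff)

lemma coem_category: "category (coem_cat C G)"
proof
  fix p q and X Y Z
  assume "p \<in> hom (coem_cat C G) X Y" "q \<in> hom (coem_cat C G) Y Z"
  then have p: "fst p = X" "snd (snd p) = Y" "X \<in> coem_obj C G" "Y \<in> coem_obj C G" "und p \<in> Arr C"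
    "Dom C (und p) = fst X" "Cod C (und p) = fst Y" "snd Y \<cdot> und p = amap G (und p) \<cdot> snd X"
    and q: "fst q = Y" "snd (snd q) = Z" "Z \<in> coem_obj C G" "und q \<in> Arr C"
    "Dom C (und q) = fst Y" "Cod C (und q) = fst Z" "snd Z \<cdot> und q = amap G (und q) \<cdot> snd Y"
    by (auto simp: coem_cat_simps)
  have "snd Z \<cdot> (und q \<cdot> und p) = amap G (und q \<cdot> und p) \<cdot> snd X"
    using p q by (simp add: coem_obj_iff comp_reduce [OF q(7)] G.amap_comp)
  with p q show "q \<cdot>\<^bsub>coem_cat C G\<^esub> p \<in> hom (coem_cat C G) X Z"
    by (simp add: coem_cat_simps)
qed (auto simp: coem_cat_simps coem_obj_iff prod_eq_iff)

text \<open>The inverse of an underlying isomorphism is automatically a comodule morphism: multiply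
  the morphism equation of \<open>f\<close> by \<open>G g\<close> on the left and by
  \<open>g\<close> on the right.\<close>

lemma coem_isoI:
  assumes "p \<in> Arr (coem_cat C G)" "iso C (und p)"
  shows "iso (coem_cat C G) p"
proof -
  obtain X h f Y k where p: "p = ((X, h), f, (Y, k))" by (metis prod.collapse)
  have f: "f \<in> Arr C" "Dom C f = X" "Cod C f = Y" "X \<in> Obj C" "Y \<in> Obj C" "h \<in> Arr C" "k \<in> Arr C"
    "Dom C h = X" "Cod C h = omap G X" "Dom C k = Y" "Cod C k = omap G Y"
    and eq: "k \<cdot> f = amap G f \<cdot> h"
    and Ob: "(X, h) \<in> coem_obj C G" "(Y, k) \<in> coem_obj C G"
    using assms(1) by (auto simp: p coem_cat_simps coem_obj_iff)
  obtain g where g: "g \<in> Arr C" "Dom C g = Y" "Cod C g = X" "g \<cdot> f = \<one> X" "f \<cdot> g = \<one> Y"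
    using assms(2) f by (auto simp: p elim: isoE)
  have Gg: "amap G g \<cdot> amap G f = \<one> (omap G X)"
    using f g by (simp flip: G.amap_comp)
  have "h \<cdot> g = amap G g \<cdot> (amap G f \<cdot> h) \<cdot> g"
    using f g by (simp add: comp_reduce [OF Gg])
  also have "\<dots> = amap G g \<cdot> (k \<cdot> f) \<cdot> g"
    by (simp only: eq)
  also have "\<dots> = amap G g \<cdot> k"
    using f g by simp
  finally have "((Y, k), g, (X, h)) \<in> Arr (coem_cat C G)"
    using f g Ob by (simp add: coem_cat_simps)
  with assms(1) f g show ?thesis
    by (intro category.isoI [OF coem_category, of _ "((Y, k), g, (X, h))"])
      (simp_all add: p coem_cat_simps)
qed

lemma coem_forget_functor: "cat_functor (coem_cat C G) C coem_forget"
proof -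
  interpret E: category "coem_cat C G" by (rule coem_category)
  show ?thesis
    by unfold_locales (auto simp: coem_forget_def coem_cat_simps coem_obj_iff)
qed

lemma coem_cofree_functor: "cat_functor C (coem_cat C G) (coem_cofree C G)"
proof -
  interpret E: category "coem_cat C G" by (rule coem_category)
  show ?thesis
    by unfold_locales (auto simp: coem_cofree_def coem_cat_simps cofree_obj comult_natural G.amap_comp)
qed

end

context monad
begin

lemma free_obj: "X \<in> Obj C \<Longrightarrow> (omap T X, mult T X) \<in> em_obj C T"
  using mult_assoc mult_ret_left by (simp add: em_obj_iff)

lemma em_forget_functor: "cat_functor (em_cat C T) C em_forget"
proof -
  interpret E: category "em_cat C T" by (rule em_category)
  show ?thesis
    by unfold_locales (auto simp: em_forget_def em_cat_simps em_obj_iff)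
qed

lemma em_free_functor: "cat_functor C (em_cat C T) (em_free C T)"
proof -
  interpret E: category "em_cat C T" by (rule em_category)
  show ?thesis
    by unfold_locales (auto simp: em_free_def em_cat_simps free_obj mult_natural T.amap_comp)
qed

end

section \<open>The comparison theorem for a comonad coacting on a left adjoint\<close>

text \<open>The coaction \<open>\<kappa>\<close> amounts to a lift of \<open>F\<close> through the
  forgetful functor of the \<open>G\<close>-comodules. Its coassociativity and counit law are packed
  into \<open>coaction_obj\<close>, so that together with \<open>coaction_natural\<close> they say
  that \<open>K\<close> is a functor into the comodules.\<close>

locale coaction_adjunction =
  F: cat_functor X B F + Q: cat_functor B X Q + G: comonad B G
  for X :: "('o, 'a, 'z) cat_scheme" and B :: "('p, 'b, 'y) cat_scheme"
    and F :: "('o, 'a, 'p, 'b, 'f) fctr_scheme" and Q :: "('p, 'b, 'o, 'a, 'q) fctr_scheme"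
    and G :: "('p, 'b, 'g) comnd_scheme" +
  fixes \<eta> :: "'o \<Rightarrow> 'a" and \<epsilon> :: "'p \<Rightarrow> 'b" and \<kappa> :: "'o \<Rightarrow> 'b"
  assumes unit_nat: "nat_trans X X id_fctr (comp_fctr Q F) \<eta>"
    and counit_nat: "nat_trans B B (comp_fctr F Q) id_fctr \<epsilon>"
    and triangle_F: "M \<in> Obj X \<Longrightarrow> \<epsilon> (omap F M) \<cdot>\<^bsub>B\<^esub> amap F (\<eta> M) = \<one>\<^bsub>B\<^esub> (omap F M)"
    and triangle_Q: "N \<in> Obj B \<Longrightarrow> amap Q (\<epsilon> N) \<cdot>\<^bsub>X\<^esub> \<eta> (omap Q N) = \<one>\<^bsub>X\<^esub> (omap Q N)"
    and coaction_obj: "M \<in> Obj X \<Longrightarrow> (omap F M, \<kappa> M) \<in> coem_obj B G"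
    and coaction_natural: "f \<in> Arr X \<Longrightarrow> \<kappa> (Cod X f) \<cdot>\<^bsub>B\<^esub> amap F f = amap G (amap F f) \<cdot>\<^bsub>B\<^esub> \<kappa> (Dom X f)"
begin

lemma unit_arr [simp]:
  assumes "M \<in> Obj X"
  shows "\<eta> M \<in> Arr X" "Dom X (\<eta> M) = M" "Cod X (\<eta> M) = omap Q (omap F M)"
  using nat_trans.component_arr [OF unit_nat assms] by simp_all

lemma counit_arr [simp]:
  assumes "N \<in> Obj B"
  shows "\<epsilon> N \<in> Arr B" "Dom B (\<epsilon> N) = omap F (omap Q N)" "Cod B (\<epsilon> N) = N"
  using nat_trans.component_arr [OF counit_nat assms] by simp_all

lemma unit_natural: "f \<in> Arr X \<Longrightarrow> \<eta> (Cod X f) \<cdot>\<^bsub>X\<^esub> f = amap Q (amap F f) \<cdot>\<^bsub>X\<^esub> \<eta> (Dom X f)"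
  using nat_trans.natural [OF unit_nat, of f] by simp

lemma counit_natural: "f \<in> Arr B \<Longrightarrow> \<epsilon> (Cod B f) \<cdot>\<^bsub>B\<^esub> amap F (amap Q f) = f \<cdot>\<^bsub>B\<^esub> \<epsilon> (Dom B f)"
  using nat_trans.natural [OF counit_nat, of f] by simp

lemma coaction_arr [simp]:
  assumes "M \<in> Obj X"
  shows "\<kappa> M \<in> Arr B" "Dom B (\<kappa> M) = omap F M" "Cod B (\<kappa> M) = omap G (omap F M)"
  using coaction_obj [OF assms] by (simp_all add: coem_obj_iff)

lemma coaction_coassoc: "M \<in> Obj X \<Longrightarrow> amap G (\<kappa> M) \<cdot>\<^bsub>B\<^esub> \<kappa> M = comult G (omap F M) \<cdot>\<^bsub>B\<^esub> \<kappa> M"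
  and coaction_counit: "M \<in> Obj X \<Longrightarrow> counit G (omap F M) \<cdot>\<^bsub>B\<^esub> \<kappa> M = \<one>\<^bsub>B\<^esub> (omap F M)"
  using coaction_obj by (simp_all add: coem_obj_iff)

lemma triangle_F_tail:
  "M \<in> Obj X \<Longrightarrow> x \<in> Arr B \<Longrightarrow> Cod B x = omap F M \<Longrightarrow>
    \<epsilon> (omap F M) \<cdot>\<^bsub>B\<^esub> (amap F (\<eta> M) \<cdot>\<^bsub>B\<^esub> x) = x"
  by (simp add: F.D.comp_reduce [OF triangle_F])

definition K :: "('o, 'a, ('p, 'b) em_obj, ('p, 'b) em_arr) fctr" where
  "K = \<lparr> omap = (\<lambda>M. (omap F M, \<kappa> M)),
     amap = (\<lambda>f. ((omap F (Dom X f), \<kappa> (Dom X f)), amap F f, (omap F (Cod X f), \<kappa> (Cod X f)))) \<rparr>"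

lemma K_simps:
  "omap K M = (omap F M, \<kappa> M)"
  "amap K f = ((omap F (Dom X f), \<kappa> (Dom X f)), amap F f, (omap F (Cod X f), \<kappa> (Cod X f)))"
  by (simp_all add: K_def)

lemma K_functor: "cat_functor X (coem_cat B G) K"
proof -
  interpret E: category "coem_cat B G" by (rule G.coem_category)
  show ?thesis
    by unfold_locales
      (auto simp: K_simps coem_cat_simps coaction_obj coaction_natural F.amap_comp)
qed

section \<open>The Galois map, a comonad morphism from FQ to G\<close>

abbreviation can :: "'p \<Rightarrow> 'b" where
  "can \<equiv> galois_map B Q \<epsilon> G \<kappa>"

lemma can_def: "can N = amap G (\<epsilon> N) \<cdot>\<^bsub>B\<^esub> \<kappa> (omap Q N)"
  by (simp add: galois_map_def)

lemma can_arr [simp]: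
  assumes "N \<in> Obj B"
  shows "can N \<in> Arr B" "Dom B (can N) = omap F (omap Q N)" "Cod B (can N) = omap G N"
  using assms by (simp_all add: can_def)

lemma can_natural:
  assumes "f \<in> Arr B"
  shows "can (Cod B f) \<cdot>\<^bsub>B\<^esub> amap F (amap Q f) = amap G f \<cdot>\<^bsub>B\<^esub> can (Dom B f)"
proof -
  have "can (Cod B f) \<cdot>\<^bsub>B\<^esub> amap F (amap Q f) =
      amap G (\<epsilon> (Cod B f)) \<cdot>\<^bsub>B\<^esub> (\<kappa> (omap Q (Cod B f)) \<cdot>\<^bsub>B\<^esub> amap F (amap Q f))"
    using assms by (simp add: can_def)
  also have "\<dots> = amap G (\<epsilon> (Cod B f)) \<cdot>\<^bsub>B\<^esub> (amap G (amap F (amap Q f)) \<cdot>\<^bsub>B\<^esub> \<kappa> (omap Q (Dom B f)))"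
    using assms coaction_natural [of "amap Q f"] by simp
  also have "\<dots> = amap G f \<cdot>\<^bsub>B\<^esub> can (Dom B f)"
    using assms by (simp add: can_def G.G.comp_amap counit_natural)
  finally show ?thesis .
qed

text \<open>Naturality of the counit moves it past \<open>G \<epsilon>\<close>, where the counit law
  of \<open>\<kappa>\<close> absorbs it. So \<open>can\<close> respects the counits of the comonads
  FQ and \<open>G\<close>.\<close>

lemma counit_can:
  assumes "N \<in> Obj B"
  shows "counit G N \<cdot>\<^bsub>B\<^esub> can N = \<epsilon> N"
proof -
  have "counit G N \<cdot>\<^bsub>B\<^esub> can N = (counit G (Cod B (\<epsilon> N)) \<cdot>\<^bsub>B\<^esub> amap G (\<epsilon> N)) \<cdot>\<^bsub>B\<^esub> \<kappa> (omap Q N)"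
    using assms by (simp add: can_def)
  also have "\<dots> = (\<epsilon> N \<cdot>\<^bsub>B\<^esub> counit G (Dom B (\<epsilon> N))) \<cdot>\<^bsub>B\<^esub> \<kappa> (omap Q N)"
    using assms by (subst G.counit_natural) auto
  also have "\<dots> = \<epsilon> N"
    using assms coaction_counit by simp
  finally show ?thesis .
qed

text \<open>Rests on coassociativity of \<open>\<kappa>\<close>. It makes \<open>can N\<close> a
  comodule morphism from \<open>K (Q N)\<close> to the cofree comodule on \<open>N\<close>; combined
  with \<open>can_unit\<close> at \<open>Q N\<close> it says that \<open>can\<close> respects
  comultiplications, that of FQ being \<open>F \<eta> Q\<close>.\<close>

lemma comult_can:
  assumes "N \<in> Obj B"
  shows "comult G N \<cdot>\<^bsub>B\<^esub> can N = amap G (can N) \<cdot>\<^bsub>B\<^esub> \<kappa> (omap Q N)"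
proof -
  have "comult G N \<cdot>\<^bsub>B\<^esub> can N = (comult G (Cod B (\<epsilon> N)) \<cdot>\<^bsub>B\<^esub> amap G (\<epsilon> N)) \<cdot>\<^bsub>B\<^esub> \<kappa> (omap Q N)"
    using assms by (simp add: can_def)
  also have "\<dots> = (amap G (amap G (\<epsilon> N)) \<cdot>\<^bsub>B\<^esub> comult G (Dom B (\<epsilon> N))) \<cdot>\<^bsub>B\<^esub> \<kappa> (omap Q N)"
    using assms by (subst G.comult_natural) auto
  also have "\<dots> = amap G (amap G (\<epsilon> N)) \<cdot>\<^bsub>B\<^esub> (amap G (\<kappa> (omap Q N)) \<cdot>\<^bsub>B\<^esub> \<kappa> (omap Q N))"
    using assms coaction_coassoc by simp
  also have "\<dots> = amap G (can N) \<cdot>\<^bsub>B\<^esub> \<kappa> (omap Q N)"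
    using assms by (simp add: can_def G.G.amap_comp)
  finally show ?thesis .
qed

text \<open>An arrow \<open>c\<close> from \<open>F M\<close> to \<open>N\<close> has two mates: its
  transpose into \<open>Q N\<close>, and the comodule morphism \<open>G c \<cdot> \<kappa> M\<close>
  from \<open>K M\<close> to the cofree comodule on \<open>N\<close>. The Galois map carries
  \<open>F\<close> of the first to the second.\<close>

lemma can_transpose:
  assumes "M \<in> Obj X" "c \<in> Arr B" "Dom B c = omap F M"
  shows "can (Cod B c) \<cdot>\<^bsub>B\<^esub> amap F (amap Q c \<cdot>\<^bsub>X\<^esub> \<eta> M) = amap G c \<cdot>\<^bsub>B\<^esub> \<kappa> M"
proof -
  have "can (Cod B c) \<cdot>\<^bsub>B\<^esub> amap F (amap Q c \<cdot>\<^bsub>X\<^esub> \<eta> M) =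
      (can (Cod B c) \<cdot>\<^bsub>B\<^esub> amap F (amap Q c)) \<cdot>\<^bsub>B\<^esub> amap F (\<eta> M)"
    using assms by (simp add: F.amap_comp)
  also have "\<dots> = amap G c \<cdot>\<^bsub>B\<^esub> (amap G (\<epsilon> (omap F M)) \<cdot>\<^bsub>B\<^esub> (\<kappa> (Cod X (\<eta> M)) \<cdot>\<^bsub>B\<^esub> amap F (\<eta> M)))"
    using assms by (simp add: can_natural) (simp add: can_def)
  also have "\<dots> = amap G c \<cdot>\<^bsub>B\<^esub> (amap G (\<epsilon> (omap F M)) \<cdot>\<^bsub>B\<^esub> (amap G (amap F (\<eta> M)) \<cdot>\<^bsub>B\<^esub> \<kappa> M))"
    using assms coaction_natural [of "\<eta> M"] by simp
  also have "\<dots> = amap G c \<cdot>\<^bsub>B\<^esub> \<kappa> M"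
    using assms by (simp add: G.G.comp_amap triangle_F)
  finally show ?thesis .
qed

lemma can_unit: "M \<in> Obj X \<Longrightarrow> can (omap F M) \<cdot>\<^bsub>B\<^esub> amap F (\<eta> M) = \<kappa> M"
  using can_transpose [of M "\<one>\<^bsub>B\<^esub> (omap F M)"] by simp

text \<open>With \<open>transpose_unique\<close> this is the bijection between arrows from
  \<open>F M\<close> to \<open>N\<close> and from \<open>M\<close> to \<open>Q N\<close>; each half
  uses one triangle identity.\<close>

lemma counit_transpose:
  assumes "M \<in> Obj X" "c \<in> Arr B" "Dom B c = omap F M"
  shows "\<epsilon> (Cod B c) \<cdot>\<^bsub>B\<^esub> amap F (amap Q c \<cdot>\<^bsub>X\<^esub> \<eta> M) = c"
proof -
  have "\<epsilon> (Cod B c) \<cdot>\<^bsub>B\<^esub> amap F (amap Q c \<cdot>\<^bsub>X\<^esub> \<eta> M) = (\<epsilon> (Cod B c) \<cdot>\<^bsub>B\<^esub> amap F (amap Q c)) \<cdot>\<^bsub>B\<^esub> amap F (\<eta> M)"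
    using assms by (simp add: F.amap_comp)
  then show ?thesis using assms by (simp add: counit_natural triangle_F)
qed

lemma transpose_unique:
  assumes "N \<in> Obj B" "d \<in> Arr X" "Cod X d = omap Q N"
  shows "amap Q (\<epsilon> N \<cdot>\<^bsub>B\<^esub> amap F d) \<cdot>\<^bsub>X\<^esub> \<eta> (Dom X d) = d"
proof -
  have "amap Q (\<epsilon> N \<cdot>\<^bsub>B\<^esub> amap F d) \<cdot>\<^bsub>X\<^esub> \<eta> (Dom X d) = amap Q (\<epsilon> N) \<cdot>\<^bsub>X\<^esub> (\<eta> (Cod X d) \<cdot>\<^bsub>X\<^esub> d)"
    using assms unit_natural [of d] by (simp add: Q.amap_comp)
  also have "\<dots> = d"
    using assms by (simp add: F.C.comp_reduce [OF triangle_Q])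
  finally show ?thesis .
qed

lemma can_nat_trans: "nat_trans B B (comp_fctr F Q) G can"
proof (rule nat_transI)
  show "cat_functor B B (comp_fctr F Q)"
    by (rule comp_cat_functor [OF Q.cat_functor_axioms F.cat_functor_axioms])
qed (use can_natural in \<open>auto simp: G.G_functor\<close>)

theorem equivalence_imp_galois:
  assumes "equivalence_of_categories X (coem_cat B G) K"
  shows "galois B F Q \<epsilon> G \<kappa>"
proof -
  interpret E: category "coem_cat B G" by (rule G.coem_category)
  have "iso B (can N)" if N: "N \<in> Obj B" for N
  proof -
    have cofree: "(omap G N, comult G N) \<in> Obj (coem_cat B G)"
      using G.cofree_obj [OF N] by (simp add: coem_cat_simps)
    obtain M p where M: "M \<in> Obj X" and p: "iso (coem_cat B G) p"
      "Dom (coem_cat B G) p = omap K M" "Cod (coem_cat B G) p = (omap G N, comult G N)"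
      by (rule equivalence_imp_ess_surj [OF assms cofree])
    note p = p(1) p(2,3) [unfolded coem_cat_simps K_simps]
    from p(1) obtain q where "p \<in> Arr (coem_cat B G)" "q \<in> Arr (coem_cat B G)"
      "Dom (coem_cat B G) q = Cod (coem_cat B G) p" "Cod (coem_cat B G) q = Dom (coem_cat B G) p"
      "q \<cdot>\<^bsub>coem_cat B G\<^esub> p = Ident (coem_cat B G) (Dom (coem_cat B G) p)"
      "p \<cdot>\<^bsub>coem_cat B G\<^esub> q = Ident (coem_cat B G) (Cod (coem_cat B G) p)"
      by (rule E.isoE)
    note pq = this [unfolded coem_cat_simps p(2,3)]
    define b where "b = und p"
    define b' where "b' = und q"
    have b: "b \<in> Arr B" "Dom B b = omap F M" "Cod B b = omap G N"
      and b': "b' \<in> Arr B" "Dom B b' = omap G N" "Cod B b' = omap F M"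
      and bb': "b' \<cdot>\<^bsub>B\<^esub> b = \<one>\<^bsub>B\<^esub> (omap F M)" "b \<cdot>\<^bsub>B\<^esub> b' = \<one>\<^bsub>B\<^esub> (omap G N)"
      and b_comod: "comult G N \<cdot>\<^bsub>B\<^esub> b = amap G b \<cdot>\<^bsub>B\<^esub> \<kappa> M"
      and b'_comod: "\<kappa> M \<cdot>\<^bsub>B\<^esub> b' = amap G b' \<cdot>\<^bsub>B\<^esub> comult G N"
      using pq unfolding b_def b'_def by auto
    \<comment> \<open>The mate of \<open>b\<close> under the cofree adjunction: although only the
      counit is kept, \<open>b\<close> is recovered as
      \<open>G c \<cdot> \<kappa> M\<close>.\<close>
    define c where "c = counit G N \<cdot>\<^bsub>B\<^esub> b"
    have c: "c \<in> Arr B" "Dom B c = omap F M" "Cod B c = N"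
      using b N by (simp_all add: c_def)
    have "amap G c \<cdot>\<^bsub>B\<^esub> \<kappa> M = amap G (counit G N) \<cdot>\<^bsub>B\<^esub> (amap G b \<cdot>\<^bsub>B\<^esub> \<kappa> M)"
      using b N M by (simp add: c_def G.G.amap_comp)
    also have "\<dots> = amap G (counit G N) \<cdot>\<^bsub>B\<^esub> (comult G N \<cdot>\<^bsub>B\<^esub> b)"
      by (simp only: b_comod)
    also have "\<dots> = b"
      using b N by (simp add: F.D.comp_reduce [OF G.counit_comult_right])
    finally have Gc: "amap G c \<cdot>\<^bsub>B\<^esub> \<kappa> M = b" .
    \<comment> \<open>Second transposition, now along F and Q. By \<open>can_transpose\<close> its
      image under \<open>F\<close> is a lift of the isomorphism \<open>b\<close> along
      \<open>can N\<close>.\<close>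
    define c' where "c' = amap Q c \<cdot>\<^bsub>X\<^esub> \<eta> M"
    have c': "c' \<in> Arr X" "Dom X c' = M" "Cod X c' = omap Q N"
      using c M by (simp_all add: c'_def)
    have can_c': "can N \<cdot>\<^bsub>B\<^esub> amap F c' = b"
      using can_transpose [OF M c(1,2)] c Gc by (simp add: c'_def)
    have \<epsilon>c': "\<epsilon> N \<cdot>\<^bsub>B\<^esub> amap F c' = c"
      using counit_transpose [OF M c(1,2)] c by (simp add: c'_def)
    \<comment> \<open>Both factors are comodule morphisms: \<open>can N\<close> goes from
      \<open>K (Q N)\<close> to the cofree comodule by \<open>comult_can\<close>, and
      \<open>b'\<close> from there to \<open>K M\<close>. Source and target of the composite lie in
      the image of \<open>K\<close>, so fullness applies.\<close>
    have "\<kappa> M \<cdot>\<^bsub>B\<^esub> (b' \<cdot>\<^bsub>B\<^esub> can N) = amap G b' \<cdot>\<^bsub>B\<^esub> (comult G N \<cdot>\<^bsub>B\<^esub> can N)"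
      using b' M N by (simp add: F.D.comp_reduce [OF b'_comod])
    also have "\<dots> = amap G (b' \<cdot>\<^bsub>B\<^esub> can N) \<cdot>\<^bsub>B\<^esub> \<kappa> (omap Q N)"
      using b' M N by (simp add: comult_can G.G.amap_comp)
    finally have r: "((omap F (omap Q N), \<kappa> (omap Q N)), b' \<cdot>\<^bsub>B\<^esub> can N, (omap F M, \<kappa> M)) \<in> Arr (coem_cat B G)"
      (is "?r \<in> _")
      using b' M N by (simp add: coem_cat_simps coaction_obj)
    obtain d where "d \<in> Arr X" "Dom X d = omap Q N" "Cod X d = M" "amap K d = ?r"
      by (rule equivalence_imp_full [OF assms, of "omap Q N" M ?r])
        (use M N r in \<open>simp_all add: coem_cat_simps K_simps\<close>)
    then have d: "d \<in> Arr X" "Dom X d = omap Q N" "Cod X d = M" "amap F d = b' \<cdot>\<^bsub>B\<^esub> can N"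
      by (simp_all add: K_simps)
    \<comment> \<open>Arrows into \<open>Q N\<close> are determined by their transposes, so
      \<open>c' \<cdot> d\<close> is compared with the identity after \<open>F\<close> and
      \<open>\<epsilon> N\<close>.\<close>
    have "\<epsilon> N \<cdot>\<^bsub>B\<^esub> amap F (c' \<cdot>\<^bsub>X\<^esub> d) = c \<cdot>\<^bsub>B\<^esub> amap F d"
      using c' d(1-3) N by (simp add: F.amap_comp F.D.comp_reduce [OF \<epsilon>c'])
    also have "\<dots> = counit G N \<cdot>\<^bsub>B\<^esub> can N"
      using b b' N by (simp add: c_def d F.D.comp_reduce [OF bb'(2)])
    also have "\<dots> = \<epsilon> N \<cdot>\<^bsub>B\<^esub> amap F (\<one>\<^bsub>X\<^esub> (omap Q N))"
      using N by (simp add: counit_can)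
    finally have eq: "\<epsilon> N \<cdot>\<^bsub>B\<^esub> amap F (c' \<cdot>\<^bsub>X\<^esub> d) = \<epsilon> N \<cdot>\<^bsub>B\<^esub> amap F (\<one>\<^bsub>X\<^esub> (omap Q N))" .
    have "c' \<cdot>\<^bsub>X\<^esub> d = \<one>\<^bsub>X\<^esub> (omap Q N)"
      using transpose_unique [OF N, of "c' \<cdot>\<^bsub>X\<^esub> d"] transpose_unique [OF N, of "\<one>\<^bsub>X\<^esub> (omap Q N)"] c' d N
      by (simp add: eq)
    then have "amap F c' \<cdot>\<^bsub>B\<^esub> amap F d = \<one>\<^bsub>B\<^esub> (omap F (omap Q N))"
      using c' d(1-3) N by (simp flip: F.amap_comp)
    \<comment> \<open>The inverse of \<open>can N\<close> is \<open>F c' \<cdot> b'\<close>. On one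
      side \<open>can_c'\<close> leaves \<open>b \<cdot> b'\<close>; on the other
      \<open>b' \<cdot> can N\<close> is \<open>F d\<close>, which leaves
      \<open>F (c' \<cdot> d)\<close>.\<close>
    then show ?thesis
      using c' d b' N bb'(2) F.D.comp_reduce [OF can_c', of b']
      by (intro F.D.isoI [of _ "amap F c' \<cdot>\<^bsub>B\<^esub> b'"]) (simp_all add: b)
  qed
  then show ?thesis
    using can_nat_trans by (simp add: galois_def nat_iso_def nat_iso_axioms_def)
qed

text \<open>Transported along the isomorphism \<open>can\<close>, the comodule laws of
  \<open>\<theta>\<close> become the laws of a coalgebra \<open>\<theta>'\<close> over the comonad
  FQ. The pair is the one from Beck's comonadicity theorem, which the counits split in
  \<open>B\<close>.\<close>

lemma canonical_pair:
  assumes iso: "\<And>N. N \<in> Obj B \<Longrightarrow> iso B (can N)"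
    and N\<theta>: "(N, \<theta>) \<in> coem_obj B G"
    and \<theta>': "\<theta>' \<in> Arr B" "Dom B \<theta>' = N" "Cod B \<theta>' = omap F (omap Q N)" "can N \<cdot>\<^bsub>B\<^esub> \<theta>' = \<theta>"
  shows "\<epsilon> N \<cdot>\<^bsub>B\<^esub> \<theta>' = \<one>\<^bsub>B\<^esub> N"
    and "amap F (\<eta> (omap Q N)) \<cdot>\<^bsub>B\<^esub> \<theta>' = amap F (amap Q \<theta>') \<cdot>\<^bsub>B\<^esub> \<theta>'"
    and "coreflexive_split_pair X B F (\<eta> (omap Q N)) (amap Q \<theta>')"
proof -
  have \<theta>: "N \<in> Obj B" "\<theta> \<in> Arr B" "Dom B \<theta> = N" "Cod B \<theta> = omap G N"
    and coassoc: "amap G \<theta> \<cdot>\<^bsub>B\<^esub> \<theta> = comult G N \<cdot>\<^bsub>B\<^esub> \<theta>" and counital: "counit G N \<cdot>\<^bsub>B\<^esub> \<theta> = \<one>\<^bsub>B\<^esub> N"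
    using N\<theta> by (auto simp: coem_obj_iff)
  have "\<epsilon> N \<cdot>\<^bsub>B\<^esub> \<theta>' = counit G N \<cdot>\<^bsub>B\<^esub> (can N \<cdot>\<^bsub>B\<^esub> \<theta>')"
    using \<theta>(1) \<theta>'(1-3) by (simp flip: counit_can)
  then show counit: "\<epsilon> N \<cdot>\<^bsub>B\<^esub> \<theta>' = \<one>\<^bsub>B\<^esub> N"
    by (simp add: \<theta>'(4) counital)
  \<comment> \<open>Coassociativity of \<open>\<theta>\<close> with the comultiplication replaced
    through \<open>comult_can\<close>. The common factor \<open>G (can N)\<close> can be cancelled
    because \<open>G\<close> preserves isomorphisms.\<close>
  have "amap G (can N) \<cdot>\<^bsub>B\<^esub> (\<kappa> (omap Q N) \<cdot>\<^bsub>B\<^esub> \<theta>') = comult G N \<cdot>\<^bsub>B\<^esub> (can N \<cdot>\<^bsub>B\<^esub> \<theta>')"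
    using \<theta>(1) \<theta>'(1-3) by (simp add: F.D.comp_reduce [OF comult_can [symmetric]])
  also have "\<dots> = amap G (can N \<cdot>\<^bsub>B\<^esub> \<theta>') \<cdot>\<^bsub>B\<^esub> (can N \<cdot>\<^bsub>B\<^esub> \<theta>')"
    by (simp only: \<theta>'(4) coassoc)
  also have "\<dots> = amap G (can N) \<cdot>\<^bsub>B\<^esub> (amap G \<theta>' \<cdot>\<^bsub>B\<^esub> (can N \<cdot>\<^bsub>B\<^esub> \<theta>'))"
    using \<theta>(1) \<theta>'(1-3) by (simp add: G.G.amap_comp)
  finally have eq: "\<kappa> (omap Q N) \<cdot>\<^bsub>B\<^esub> \<theta>' = amap G \<theta>' \<cdot>\<^bsub>B\<^esub> (can N \<cdot>\<^bsub>B\<^esub> \<theta>')"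
    using \<theta>(1) \<theta>'(1-3) iso [OF \<theta>(1)]
    by (rule_tac F.D.iso_cancel [OF G.G.preserves_iso [OF iso [OF \<theta>(1)]]]) simp_all
  \<comment> \<open>The two sides of the fork are compared after \<open>can\<close> at
    \<open>F Q N\<close>: one becomes \<open>\<kappa>\<close> by \<open>can_unit\<close>, the other
    is rewritten by naturality. Hence invertibility of \<open>can\<close> is used at
    \<open>F Q N\<close> as well as at \<open>N\<close>.\<close>
  have "can (omap F (omap Q N)) \<cdot>\<^bsub>B\<^esub> (amap F (\<eta> (omap Q N)) \<cdot>\<^bsub>B\<^esub> \<theta>') = \<kappa> (omap Q N) \<cdot>\<^bsub>B\<^esub> \<theta>'"
    using \<theta>(1) \<theta>'(1-3) by (simp add: F.D.comp_reduce [OF can_unit])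
  also have "\<dots> = (amap G \<theta>' \<cdot>\<^bsub>B\<^esub> can N) \<cdot>\<^bsub>B\<^esub> \<theta>'"
    using \<theta>(1) \<theta>'(1-3) by (simp add: eq)
  also have "\<dots> = (can (omap F (omap Q N)) \<cdot>\<^bsub>B\<^esub> amap F (amap Q \<theta>')) \<cdot>\<^bsub>B\<^esub> \<theta>'"
    using can_natural [OF \<theta>'(1)] \<theta>'(2,3) by simp
  also have "\<dots> = can (omap F (omap Q N)) \<cdot>\<^bsub>B\<^esub> (amap F (amap Q \<theta>') \<cdot>\<^bsub>B\<^esub> \<theta>')"
    using \<theta>(1) \<theta>'(1-3) by simp
  finally show fork: "amap F (\<eta> (omap Q N)) \<cdot>\<^bsub>B\<^esub> \<theta>' = amap F (amap Q \<theta>') \<cdot>\<^bsub>B\<^esub> \<theta>'"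
    using \<theta>(1) \<theta>'(1-3)
    by (rule_tac F.D.iso_cancel [OF iso [of "omap F (omap Q N)"]]) simp_all
  \<comment> \<open>The common retraction is \<open>Q (\<epsilon> N)\<close>: for
    \<open>\<eta>\<close> by a triangle identity, for \<open>Q \<theta>'\<close> by the counit law
    just shown.\<close>
  have "amap Q (\<epsilon> N) \<cdot>\<^bsub>X\<^esub> amap Q \<theta>' = \<one>\<^bsub>X\<^esub> (omap Q N)"
    using \<theta>(1) \<theta>'(1-3) by (simp add: counit flip: Q.amap_comp)
  then have "coreflexive_pair X (\<eta> (omap Q N)) (amap Q \<theta>')"
    using \<theta>(1) \<theta>'(1-3) triangle_Q [OF \<theta>(1)]
    unfolding coreflexive_pair_def parallel_pair_def
    by (auto intro!: bexI [of _ "amap Q (\<epsilon> N)"])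
  \<comment> \<open>In the notation of \<open>has_split_equaliser\<close>, \<open>e\<close> is
    \<open>\<theta>'\<close>, \<open>s\<close> is \<open>\<epsilon> N\<close> and \<open>t\<close>
    is \<open>\<epsilon>\<close> at \<open>F Q N\<close>; naturality of \<open>\<epsilon>\<close> at
    \<open>\<theta>'\<close> is the last equation required.\<close>
  moreover have "\<epsilon> (omap F (omap Q N)) \<cdot>\<^bsub>B\<^esub> amap F (amap Q \<theta>') = \<theta>' \<cdot>\<^bsub>B\<^esub> \<epsilon> N"
    using counit_natural [OF \<theta>'(1)] \<theta>' by simp
  then have "has_split_equaliser B (amap F (\<eta> (omap Q N))) (amap F (amap Q \<theta>'))"
    using \<theta>(1) \<theta>'(1-3) counit fork triangle_F [of "omap Q N"]
    unfolding has_split_equaliser_def parallel_pair_def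
    by (intro conjI bexI [of _ N] bexI [of _ \<theta>'] bexI [of _ "\<epsilon> N"]
        bexI [of _ "\<epsilon> (omap F (omap Q N))"]) simp_all
  ultimately show "coreflexive_split_pair X B F (\<eta> (omap Q N)) (amap Q \<theta>')"
    by (simp add: coreflexive_split_pair_def)
qed

text \<open>In \<open>B\<close>, both \<open>F e\<close> and \<open>\<theta>'\<close> equalise the
  same pair universally, so they differ by an isomorphism. As \<open>\<epsilon> N\<close> is a
  retraction of \<open>\<theta>'\<close>, this isomorphism is
  \<open>\<epsilon> N \<cdot> F e\<close>. The second claim makes it a comodule morphism from
  \<open>K (Dom X e)\<close> to \<open>(N, \<theta>)\<close>.\<close>

lemma descent:
  assumes iso: "\<And>N. N \<in> Obj B \<Longrightarrow> iso B (can N)"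
    and N\<theta>: "(N, \<theta>) \<in> coem_obj B G"
    and \<theta>': "\<theta>' \<in> Arr B" "Dom B \<theta>' = N" "Cod B \<theta>' = omap F (omap Q N)" "can N \<cdot>\<^bsub>B\<^esub> \<theta>' = \<theta>"
    and e: "is_equaliser X (\<eta> (omap Q N)) (amap Q \<theta>') e"
    and Fe: "is_equaliser B (amap F (\<eta> (omap Q N))) (amap F (amap Q \<theta>')) (amap F e)"
  shows "iso B (\<epsilon> N \<cdot>\<^bsub>B\<^esub> amap F e)"
    and "\<theta> \<cdot>\<^bsub>B\<^esub> (\<epsilon> N \<cdot>\<^bsub>B\<^esub> amap F e) = amap G (\<epsilon> N \<cdot>\<^bsub>B\<^esub> amap F e) \<cdot>\<^bsub>B\<^esub> \<kappa> (Dom X e)"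
proof -
  have N: "N \<in> Obj B"
    using N\<theta> by (simp add: coem_obj_iff)
  have e': "e \<in> Arr X" "Cod X e = omap Q N" "\<eta> (omap Q N) \<cdot>\<^bsub>X\<^esub> e = amap Q \<theta>' \<cdot>\<^bsub>X\<^esub> e"
    using F.C.is_equaliserD [OF e] N by auto
  define u where "u = \<epsilon> N \<cdot>\<^bsub>B\<^esub> amap F e"
  have u: "u \<in> Arr B" "Dom B u = omap F (Dom X e)" "Cod B u = N"
    using e'(1,2) N by (simp_all add: u_def)
  note pair = canonical_pair [OF iso N\<theta> \<theta>', simplified]
  \<comment> \<open>The splitting at work: naturality turns
    \<open>\<theta>' \<cdot> \<epsilon> N\<close> into
    \<open>\<epsilon> \<cdot> F Q \<theta>'\<close>, the fork replaces \<open>Q \<theta>'\<close> by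
    \<open>\<eta>\<close>, and a triangle identity removes \<open>\<eta>\<close>.\<close>
  have "\<theta>' \<cdot>\<^bsub>B\<^esub> u = (\<epsilon> (omap F (omap Q N)) \<cdot>\<^bsub>B\<^esub> amap F (amap Q \<theta>')) \<cdot>\<^bsub>B\<^esub> amap F e"
    using counit_natural [OF \<theta>'(1)] \<theta>'(1-3) e'(1,2) N by (simp add: u_def)
  also have "\<dots> = \<epsilon> (omap F (omap Q N)) \<cdot>\<^bsub>B\<^esub> amap F (\<eta> (omap Q N) \<cdot>\<^bsub>X\<^esub> e)"
    using \<theta>'(1-3) e' N by (simp add: F.amap_comp [of e "amap Q \<theta>'"])
  also have "\<dots> = amap F e"
    using e'(1,2) N by (simp add: F.amap_comp triangle_F_tail)
  finally have \<theta>'u: "\<theta>' \<cdot>\<^bsub>B\<^esub> u = amap F e" .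
  obtain v where v: "v \<in> Arr B" "Dom B v = N" "Cod B v = omap F (Dom X e)" "amap F e \<cdot>\<^bsub>B\<^esub> v = \<theta>'"
    by (rule F.D.equaliser_factor [OF Fe \<theta>'(1)]) (use N \<theta>' e' pair in auto)
  have uv: "u \<cdot>\<^bsub>B\<^esub> v = \<one>\<^bsub>B\<^esub> N"
    using v e'(1,2) N pair(1) by (simp add: u_def)
  have "amap F e \<cdot>\<^bsub>B\<^esub> (v \<cdot>\<^bsub>B\<^esub> u) = amap F e \<cdot>\<^bsub>B\<^esub> \<one>\<^bsub>B\<^esub> (omap F (Dom X e))"
    using v(1-3) u e'(1,2) by (simp add: F.D.comp_reduce [OF v(4)] \<theta>'u)
  then have "v \<cdot>\<^bsub>B\<^esub> u = \<one>\<^bsub>B\<^esub> (omap F (Dom X e))"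
    using v u e'(1,2) by (rule_tac F.D.mono_equaliser [OF Fe]) simp_all
  with uv v u show "iso B (\<epsilon> N \<cdot>\<^bsub>B\<^esub> amap F e)"
    unfolding u_def [symmetric] by (intro F.D.isoI [of u v]) simp_all
  \<comment> \<open>Writing \<open>\<theta>\<close> as \<open>can N \<cdot> \<theta>'\<close>
    eliminates it in favour of \<open>F e\<close>; what remains is naturality of
    \<open>\<kappa>\<close> at \<open>e\<close>.\<close>
  have "\<theta> \<cdot>\<^bsub>B\<^esub> u = can N \<cdot>\<^bsub>B\<^esub> amap F e"
    using \<theta>'(1-3) u N by (simp flip: \<theta>'(4) \<theta>'u)
  also have "\<dots> = amap G u \<cdot>\<^bsub>B\<^esub> \<kappa> (Dom X e)"
    using coaction_natural [OF e'(1)] e'(1,2) N by (simp add: can_def u_def G.G.amap_comp)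
  finally show "\<theta> \<cdot>\<^bsub>B\<^esub> (\<epsilon> N \<cdot>\<^bsub>B\<^esub> amap F e) = amap G (\<epsilon> N \<cdot>\<^bsub>B\<^esub> amap F e) \<cdot>\<^bsub>B\<^esub> \<kappa> (Dom X e)"
    by (simp only: u_def)
qed

text \<open>For the comodule \<open>K M\<close>, the lift of \<open>\<kappa> M\<close> along
  \<open>can\<close> is \<open>F (\<eta> M)\<close>, by \<open>can_unit\<close>. The arrow from
  \<open>\<eta> M\<close> to an equaliser of the resulting pair is inverted by \<open>F\<close>,
  hence is itself an isomorphism.\<close>

lemma unit_equaliser:
  assumes iso: "\<And>N. N \<in> Obj B \<Longrightarrow> iso B (can N)"
    and beck: "\<And>f g. coreflexive_split_pair X B F f g \<Longrightarrow>
      \<exists>e. is_equaliser X f g e \<and> is_equaliser B (amap F f) (amap F g) (amap F e)"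
    and conservative: "conservative X B F"
    and M: "M \<in> Obj X"
  shows "is_equaliser X (\<eta> (omap Q (omap F M))) (amap Q (amap F (\<eta> M))) (\<eta> M)"
proof -
  let ?N = "omap F M"
  have N: "?N \<in> Obj B" using M by simp
  have \<theta>': "amap F (\<eta> M) \<in> Arr B" "Dom B (amap F (\<eta> M)) = ?N"
    "Cod B (amap F (\<eta> M)) = omap F (omap Q ?N)" "can ?N \<cdot>\<^bsub>B\<^esub> amap F (\<eta> M) = \<kappa> M"
    using M by (simp_all add: can_unit)
  obtain e where e: "is_equaliser X (\<eta> (omap Q ?N)) (amap Q (amap F (\<eta> M))) e"
    and Fe: "is_equaliser B (amap F (\<eta> (omap Q ?N))) (amap F (amap Q (amap F (\<eta> M)))) (amap F e)"
    using beck [OF canonical_pair(3) [OF iso coaction_obj [OF M] \<theta>']] by auto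
  have e': "e \<in> Arr X" "Cod X e = omap Q ?N"
    using F.C.is_equaliserD [OF e] N by auto
  note u = descent(1) [OF iso coaction_obj [OF M] \<theta>' e Fe]
  obtain v where v: "v \<in> Arr X" "Dom X v = M" "Cod X v = Dom X e" "e \<cdot>\<^bsub>X\<^esub> v = \<eta> M"
    by (rule F.C.equaliser_factor [OF e, of "\<eta> M"]) (use M unit_natural [of "\<eta> M"] in auto)
  \<comment> \<open>Since \<open>e \<cdot> v\<close> is \<open>\<eta> M\<close>, a triangle identity
    makes \<open>F v\<close> a section of the isomorphism supplied by
    \<open>descent\<close>.\<close>
  have "(\<epsilon> ?N \<cdot>\<^bsub>B\<^esub> amap F e) \<cdot>\<^bsub>B\<^esub> amap F v = \<one>\<^bsub>B\<^esub> ?N"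
    using M e' v(1-3) v(4) [symmetric] triangle_F [OF M] by (simp add: F.amap_comp)
  then have "iso B (amap F v)"
    using M e' v(1-3) u by (rule_tac F.D.iso_section [OF u]) simp_all
  then have "iso X v"
    using conservative v(1) by (simp add: conservative_def)
  then show ?thesis
    using F.C.equaliser_iso [OF e \<open>iso X v\<close>] v by simp
qed

text \<open>The condition \<open>beck\<close> couples existence with preservation:
  \<open>descent\<close> consumes an equaliser \<open>e\<close> in \<open>X\<close> together with
  the fact that \<open>F e\<close> is one in \<open>B\<close>.\<close>

theorem galois_imp_equivalence:
  assumes galois: "galois B F Q \<epsilon> G \<kappa>"
    and beck: "\<And>f g. coreflexive_split_pair X B F f g \<Longrightarrow>
      \<exists>e. is_equaliser X f g e \<and> is_equaliser B (amap F f) (amap F g) (amap F e)"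
    and conservative: "conservative X B F"
  shows "equivalence_of_categories X (coem_cat B G) K"
proof (rule equivalenceI [OF K_functor])
  have iso: "iso B (can N)" if "N \<in> Obj B" for N
    using galois that by (simp add: galois_def nat_iso_def nat_iso_axioms_def)
  note equaliser = unit_equaliser [OF iso beck conservative, simplified]
  fix M M' p
  assume M: "M \<in> Obj X" "M' \<in> Obj X"
    and p: "p \<in> Arr (coem_cat B G)" "Dom (coem_cat B G) p = omap K M" "Cod (coem_cat B G) p = omap K M'"
  define g where "g = und p"
  have g: "g \<in> Arr B" "Dom B g = omap F M" "Cod B g = omap F M'" "\<kappa> M' \<cdot>\<^bsub>B\<^esub> g = amap G g \<cdot>\<^bsub>B\<^esub> \<kappa> M"
    using p by (auto simp: coem_cat_simps K_simps g_def)
  \<comment> \<open>Fullness. Once \<open>can\<close> is cancelled, the comodule condition on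
    \<open>g\<close> says that \<open>F (\<eta> M') \<cdot> g\<close> is \<open>F\<close> of the
    transpose of \<open>g\<close>.\<close>
  have "can (omap F M') \<cdot>\<^bsub>B\<^esub> (amap F (\<eta> M') \<cdot>\<^bsub>B\<^esub> g) = \<kappa> M' \<cdot>\<^bsub>B\<^esub> g"
    using g(1-3) M by (simp add: F.D.comp_reduce [OF can_unit])
  also have "\<dots> = can (omap F M') \<cdot>\<^bsub>B\<^esub> amap F (amap Q g \<cdot>\<^bsub>X\<^esub> \<eta> M)"
    using can_transpose [OF M(1) g(1,2)] g(3,4) by simp
  finally have Fg: "amap F (\<eta> M') \<cdot>\<^bsub>B\<^esub> g = amap F (amap Q g \<cdot>\<^bsub>X\<^esub> \<eta> M)"
    using g(1-3) M by (rule_tac F.D.iso_cancel [OF iso [of "omap F M'"]]) simp_all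
  \<comment> \<open>By naturality of \<open>\<eta>\<close> and \<open>Fg\<close>, the transpose of
    \<open>g\<close> equalises the pair whose equaliser is \<open>\<eta> M'\<close>. Its factor
    \<open>w\<close> has the same transpose data as \<open>g\<close>, hence
    \<open>F w = g\<close>.\<close>
  have "\<eta> (omap Q (omap F M')) \<cdot>\<^bsub>X\<^esub> (amap Q g \<cdot>\<^bsub>X\<^esub> \<eta> M) = amap Q (amap F (amap Q g \<cdot>\<^bsub>X\<^esub> \<eta> M)) \<cdot>\<^bsub>X\<^esub> \<eta> M"
    using unit_natural [of "amap Q g \<cdot>\<^bsub>X\<^esub> \<eta> M"] g(1-3) M by simp
  also have "\<dots> = amap Q (amap F (\<eta> M')) \<cdot>\<^bsub>X\<^esub> (amap Q g \<cdot>\<^bsub>X\<^esub> \<eta> M)"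
    using g(1-3) M by (simp flip: Fg) (simp add: Q.amap_comp)
  finally obtain w where w: "w \<in> Arr X" "Dom X w = M" "Cod X w = M'" "\<eta> M' \<cdot>\<^bsub>X\<^esub> w = amap Q g \<cdot>\<^bsub>X\<^esub> \<eta> M"
    by (rule_tac F.C.equaliser_factor [OF equaliser [OF M(2)], of "amap Q g \<cdot>\<^bsub>X\<^esub> \<eta> M"]) (use g(1-3) M in auto)
  have "amap F w = \<epsilon> (omap F M') \<cdot>\<^bsub>B\<^esub> amap F (\<eta> M' \<cdot>\<^bsub>X\<^esub> w)"
    using w(1-3) M by (simp add: F.amap_comp triangle_F_tail)
  also have "\<dots> = g"
    using counit_transpose [OF M(1) g(1,2)] g(3) by (simp add: w(4))
  finally have "amap K w = p"
    using p w(2,3) by (simp add: K_simps g_def coem_cat_simps prod_eq_iff)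
  with w show "\<exists>w \<in> Arr X. Dom X w = M \<and> Cod X w = M' \<and> amap K w = p" by blast
next
  have iso: "iso B (can N)" if "N \<in> Obj B" for N
    using galois that by (simp add: galois_def nat_iso_def nat_iso_axioms_def)
  note equaliser = unit_equaliser [OF iso beck conservative, simplified]
  fix f g
  assume fg: "f \<in> Arr X" "g \<in> Arr X" "Dom X f = Dom X g" "Cod X f = Cod X g" "amap K f = amap K g"
  \<comment> \<open>Faithfulness: naturality turns equality under \<open>F\<close> into equality
    after \<open>\<eta>\<close>, which is monic because it is an equaliser.\<close>
  then have "amap F f = amap F g" by (simp add: K_simps)
  then have "\<eta> (Cod X f) \<cdot>\<^bsub>X\<^esub> f = \<eta> (Cod X f) \<cdot>\<^bsub>X\<^esub> g"
    using fg unit_natural [of f] unit_natural [of g] by simp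
  then show "f = g"
    using fg by (rule_tac F.C.mono_equaliser [OF equaliser [of "Cod X f"]]) simp_all
next
  have iso: "iso B (can N)" if "N \<in> Obj B" for N
    using galois that by (simp add: galois_def nat_iso_def nat_iso_axioms_def)
  fix Y assume "Y \<in> Obj (coem_cat B G)"
  then obtain N \<theta> where Y: "Y = (N, \<theta>)" and N\<theta>: "(N, \<theta>) \<in> coem_obj B G"
    by (cases Y) (simp add: coem_cat_simps)
  then have \<theta>: "N \<in> Obj B" "\<theta> \<in> Arr B" "Dom B \<theta> = N" "Cod B \<theta> = omap G N"
    by (simp_all add: coem_obj_iff)
  \<comment> \<open>Essential surjectivity. \<open>t\<close> inverts \<open>can N\<close>, and
    \<open>t \<cdot> \<theta>\<close> is the FQ-coalgebra structure that
    \<open>canonical_pair\<close> and \<open>descent\<close> call \<open>\<theta>'\<close>.\<close>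
  obtain t where t: "t \<in> Arr B" "Dom B t = omap G N" "Cod B t = omap F (omap Q N)" "can N \<cdot>\<^bsub>B\<^esub> t = \<one>\<^bsub>B\<^esub> (omap G N)"
    using iso [OF \<theta>(1)] \<theta>(1) by (auto elim: F.D.isoE)
  have \<theta>': "t \<cdot>\<^bsub>B\<^esub> \<theta> \<in> Arr B" "Dom B (t \<cdot>\<^bsub>B\<^esub> \<theta>) = N" "Cod B (t \<cdot>\<^bsub>B\<^esub> \<theta>) = omap F (omap Q N)"
    "can N \<cdot>\<^bsub>B\<^esub> (t \<cdot>\<^bsub>B\<^esub> \<theta>) = \<theta>"
    using t \<theta> by (simp_all add: F.D.comp_reduce [OF t(4)])
  obtain e where e: "is_equaliser X (\<eta> (omap Q N)) (amap Q (t \<cdot>\<^bsub>B\<^esub> \<theta>)) e"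
    and Fe: "is_equaliser B (amap F (\<eta> (omap Q N))) (amap F (amap Q (t \<cdot>\<^bsub>B\<^esub> \<theta>))) (amap F e)"
    using beck [OF canonical_pair(3) [OF iso N\<theta> \<theta>']] by auto
  have e': "e \<in> Arr X" "Cod X e = omap Q N"
    using F.C.is_equaliserD [OF e] \<theta>(1) by auto
  let ?p = "(omap K (Dom X e), \<epsilon> N \<cdot>\<^bsub>B\<^esub> amap F e, Y)"
  have "?p \<in> Arr (coem_cat B G)"
    using descent(2) [OF iso N\<theta> \<theta>' e Fe] N\<theta> e' \<theta>
    by (simp add: coem_cat_simps K_simps Y coaction_obj)
  then have "iso (coem_cat B G) ?p"
    using G.coem_isoI [of ?p] descent(1) [OF iso N\<theta> \<theta>' e Fe] by simp
  with e' show "\<exists>M \<in> Obj X. \<exists>\<beta>. iso (coem_cat B G) \<beta> \<and> Dom (coem_cat B G) \<beta> = omap K M \<and>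
      Cod (coem_cat B G) \<beta> = Y"
    by (intro bexI [of _ "Dom X e"] exI [of _ ?p]) (simp_all add: coem_cat_simps)
qed

end

section \<open>Actions and the Hopf comonad\<close>

lemma prod_cat_simps:
  "(f, g) \<in> Arr (prod_cat C D) \<longleftrightarrow> f \<in> Arr C \<and> g \<in> Arr D"
  "(X, Y) \<in> Obj (prod_cat C D) \<longleftrightarrow> X \<in> Obj C \<and> Y \<in> Obj D"
  "Dom (prod_cat C D) (f, g) = (Dom C f, Dom D g)"
  "Cod (prod_cat C D) (f, g) = (Cod C f, Cod D g)"
  "Ident (prod_cat C D) (X, Y) = (\<one>\<^bsub>C\<^esub> X, \<one>\<^bsub>D\<^esub> Y)"
  "(f', g') \<cdot>\<^bsub>prod_cat C D\<^esub> (f, g) = (f' \<cdot>\<^bsub>C\<^esub> f, g' \<cdot>\<^bsub>D\<^esub> g)"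
  by (simp_all add: prod_cat_def)

section \<open>Tensor products and actions as functors of two variables\<close>

context monoidal_category
begin

lemma tensor_obj [simp]: "X \<in> Obj V \<Longrightarrow> Y \<in> Obj V \<Longrightarrow> X \<otimes>\<^sub>o Y \<in> Obj V"
  using cat_functor.omap_obj [OF tensor_functor, of "(X, Y)"] by (simp add: prod_cat_simps)

lemma tensor_arr [simp]:
  assumes "f \<in> Arr V" "g \<in> Arr V"
  shows "f \<otimes> g \<in> Arr V" "Dom V (f \<otimes> g) = Dom V f \<otimes>\<^sub>o Dom V g" "Cod V (f \<otimes> g) = Cod V f \<otimes>\<^sub>o Cod V g"
  using cat_functor.amap_arr [OF tensor_functor, of "(f, g)"] assms by (simp_all add: prod_cat_simps)

lemma tensor_id [simp]: "X \<in> Obj V \<Longrightarrow> Y \<in> Obj V \<Longrightarrow> \<one> X \<otimes> \<one> Y = \<one> (X \<otimes>\<^sub>o Y)"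
  using cat_functor.amap_id [OF tensor_functor, of "(X, Y)"] by (simp add: prod_cat_simps)

lemma tensor_comp:
  assumes "f \<in> Arr V" "g \<in> Arr V" "f' \<in> Arr V" "g' \<in> Arr V" "Dom V f' = Cod V f" "Dom V g' = Cod V g"
  shows "(f' \<otimes> g') \<cdot> (f \<otimes> g) = (f' \<cdot> f) \<otimes> (g' \<cdot> g)"
  using cat_functor.amap_comp [OF tensor_functor, of "(f, g)" "(f', g')"] assms
  by (simp add: prod_cat_simps)

lemma tensor_comp_tail:
  assumes "f \<in> Arr V" "g \<in> Arr V" "f' \<in> Arr V" "g' \<in> Arr V" "Dom V f' = Cod V f" "Dom V g' = Cod V g"
    "x \<in> Arr V" "Cod V x = Dom V f \<otimes>\<^sub>o Dom V g"
  shows "(f' \<otimes> g') \<cdot> (f \<otimes> g) \<cdot> x = ((f' \<cdot> f) \<otimes> (g' \<cdot> g)) \<cdot> x"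
  using assms by (simp add: comp_reduce [OF tensor_comp])

lemma unit_obj [simp]: "unit_obj V \<in> Obj V"
  by (rule unit_Obj)

lemma assc_arr [simp]:
  assumes "X \<in> Obj V" "Y \<in> Obj V" "Z \<in> Obj V"
  shows "assc V X Y Z \<in> Arr V" "Dom V (assc V X Y Z) = (X \<otimes>\<^sub>o Y) \<otimes>\<^sub>o Z"
    "Cod V (assc V X Y Z) = X \<otimes>\<^sub>o (Y \<otimes>\<^sub>o Z)"
  using assc_hom [OF assms] by simp_all

lemma lunit_arr [simp]:
  assumes "X \<in> Obj V"
  shows "lunit V X \<in> Arr V" "Dom V (lunit V X) = unit_obj V \<otimes>\<^sub>o X" "Cod V (lunit V X) = X"
  using lunit_hom [OF assms] by simp_all

lemma runit_arr [simp]: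
  assumes "X \<in> Obj V"
  shows "runit V X \<in> Arr V" "Dom V (runit V X) = X \<otimes>\<^sub>o unit_obj V" "Cod V (runit V X) = X"
  using runit_hom [OF assms] by simp_all

end

context comonoid
begin

lemma co_simps [simp]:
  "co_obj C \<in> Obj V"
  "co_mult C \<in> Arr V" "Dom V (co_mult C) = co_obj C" "Cod V (co_mult C) = co_obj C \<otimes>\<^sub>o co_obj C"
  "co_unit C \<in> Arr V" "Dom V (co_unit C) = co_obj C" "Cod V (co_unit C) = unit_obj V"
  using co_Obj co_mult_hom co_unit_hom by simp_all

end

context left_category
begin

lemma act_obj [simp]: "v \<in> Obj V \<Longrightarrow> X \<in> Obj A \<Longrightarrow> v \<diamond>\<^sub>o X \<in> Obj A"
  using cat_functor.omap_obj [OF act_functor, of "(v, X)"] by (simp add: prod_cat_simps)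

lemma act_arr [simp]:
  assumes "p \<in> Arr V" "f \<in> Arr A"
  shows "p \<diamond> f \<in> Arr A" "Dom A (p \<diamond> f) = Dom V p \<diamond>\<^sub>o Dom A f" "Cod A (p \<diamond> f) = Cod V p \<diamond>\<^sub>o Cod A f"
  using cat_functor.amap_arr [OF act_functor, of "(p, f)"] assms by (simp_all add: prod_cat_simps)

lemma act_id [simp]: "v \<in> Obj V \<Longrightarrow> X \<in> Obj A \<Longrightarrow> \<one>\<^bsub>V\<^esub> v \<diamond> \<one> X = \<one> (v \<diamond>\<^sub>o X)"
  using cat_functor.amap_id [OF act_functor, of "(v, X)"] by (simp add: prod_cat_simps)

lemma act_comp:
  assumes "p \<in> Arr V" "f \<in> Arr A" "p' \<in> Arr V" "f' \<in> Arr A" "Dom V p' = Cod V p" "Dom A f' = Cod A f"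
  shows "(p' \<diamond> f') \<cdot> (p \<diamond> f) = (p' \<cdot>\<^bsub>V\<^esub> p) \<diamond> (f' \<cdot> f)"
  using cat_functor.amap_comp [OF act_functor, of "(p, f)" "(p', f')"] assms
  by (simp add: prod_cat_simps)

lemma act_comp_tail:
  assumes "p \<in> Arr V" "f \<in> Arr A" "p' \<in> Arr V" "f' \<in> Arr A" "Dom V p' = Cod V p" "Dom A f' = Cod A f"
    "x \<in> Arr A" "Cod A x = Dom V p \<diamond>\<^sub>o Dom A f"
  shows "(p' \<diamond> f') \<cdot> (p \<diamond> f) \<cdot> x = ((p' \<cdot>\<^bsub>V\<^esub> p) \<diamond> (f' \<cdot> f)) \<cdot> x"
  using assms by (simp add: A.comp_reduce [OF act_comp])

lemma act_assoc_arr [simp]: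
  assumes "v \<in> Obj V" "w \<in> Obj V" "X \<in> Obj A"
  shows "act_assoc A v w X \<in> Arr A" "Dom A (act_assoc A v w X) = (v \<otimes>\<^sub>o\<^bsub>V\<^esub> w) \<diamond>\<^sub>o X"
    "Cod A (act_assoc A v w X) = v \<diamond>\<^sub>o (w \<diamond>\<^sub>o X)"
  using act_assoc_hom [OF assms] by simp_all

lemma act_unit_arr [simp]:
  assumes "X \<in> Obj A"
  shows "act_unit A X \<in> Arr A" "Dom A (act_unit A X) = unit_obj V \<diamond>\<^sub>o X" "Cod A (act_unit A X) = X"
  using act_unit_hom [OF assms] by simp_all

lemma act_assoc_nat:
  assumes "p \<in> Arr V" "q \<in> Arr V" "f \<in> Arr A"
  shows "act_assoc A (Cod V p) (Cod V q) (Cod A f) \<cdot> ((p \<otimes>\<^bsub>V\<^esub> q) \<diamond> f)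
    = (p \<diamond> (q \<diamond> f)) \<cdot> act_assoc A (Dom V p) (Dom V q) (Dom A f)"
  by (rule act_assoc_natural) (use assms in auto)

lemma act_unit_nat:
  "f \<in> Arr A \<Longrightarrow> act_unit A (Cod A f) \<cdot> (\<one>\<^bsub>V\<^esub> (unit_obj V) \<diamond> f) = f \<cdot> act_unit A (Dom A f)"
  by (rule act_unit_natural) auto

lemma act_comonad_simps:
  "omap (act_comonad V A C) X = co_obj C \<diamond>\<^sub>o X"
  "amap (act_comonad V A C) f = \<one>\<^bsub>V\<^esub> (co_obj C) \<diamond> f"
  "comult (act_comonad V A C) X = act_assoc A (co_obj C) (co_obj C) X \<cdot> (co_mult C \<diamond> \<one> X)"
  "counit (act_comonad V A C) X = act_unit A X \<cdot> (co_unit C \<diamond> \<one> X)"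
  by (simp_all add: act_comonad_def Let_def)

lemma act_comonad_functor:
  assumes "co_obj C \<in> Obj V"
  shows "cat_functor A A (act_comonad V A C)"
  by unfold_locales (use assms in \<open>auto simp: act_comonad_simps act_comp\<close>)

text \<open>Each comonad law is a comonoid law acting on \<open>X\<close>: coassociativity passes
  through \<open>act_pentagon\<close>, the left and right counit laws through the two action
  triangles. Naturality of \<open>act_assoc\<close> slides the comonoid arrows into place.\<close>

lemma act_comonad_comonad:
  assumes "comonoid V C"
  shows "comonad A (act_comonad V A C)"
proof -
  interpret C: comonoid V C by fact
  let ?c = "co_obj C" and ?d = "co_mult C" and ?e = "co_unit C" and ?G = "act_comonad V A C"
  have G: "cat_functor A A ?G"
    by (rule act_comonad_functor) simp
  show ?thesis
  proof
    fix f Y Z assume f: "f \<in> hom A Y Z"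
    \<comment> \<open>The identity of the tensor square of \<open>?c\<close> is written as a tensor
      product of identities, so that naturality of \<open>act_assoc\<close> applies.\<close>
    have "act_assoc A ?c ?c Z \<cdot> (?d \<diamond> \<one> Z) \<cdot> (\<one>\<^bsub>V\<^esub> ?c \<diamond> f)
        = (act_assoc A ?c ?c Z \<cdot> ((\<one>\<^bsub>V\<^esub> ?c \<otimes>\<^bsub>V\<^esub> \<one>\<^bsub>V\<^esub> ?c) \<diamond> f)) \<cdot> (?d \<diamond> \<one> Y)"
      using f by (auto simp: act_comp)
    also have "\<dots> = (\<one>\<^bsub>V\<^esub> ?c \<diamond> (\<one>\<^bsub>V\<^esub> ?c \<diamond> f)) \<cdot> act_assoc A ?c ?c Y \<cdot> (?d \<diamond> \<one> Y)"
      using f act_assoc_nat [of "\<one>\<^bsub>V\<^esub> ?c" "\<one>\<^bsub>V\<^esub> ?c" f] by auto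
    finally show "comult ?G Z \<cdot> amap ?G f = amap (comp_fctr ?G ?G) f \<cdot> comult ?G Y"
      using f by (auto simp: act_comonad_simps)
    have "act_unit A Z \<cdot> (?e \<diamond> \<one> Z) \<cdot> (\<one>\<^bsub>V\<^esub> ?c \<diamond> f)
        = (act_unit A Z \<cdot> (\<one>\<^bsub>V\<^esub> (unit_obj V) \<diamond> f)) \<cdot> (?e \<diamond> \<one> Y)"
      using f by (auto simp: act_comp)
    also have "\<dots> = f \<cdot> act_unit A Y \<cdot> (?e \<diamond> \<one> Y)"
      using f act_unit_nat [of f] by auto
    finally show "counit ?G Z \<cdot> amap ?G f = amap id_fctr f \<cdot> counit ?G Y"
      using f by (auto simp: act_comonad_simps)
  next
    fix X assume X: "X \<in> Obj A"
    have "(\<one>\<^bsub>V\<^esub> ?c \<diamond> (act_assoc A ?c ?c X \<cdot> (?d \<diamond> \<one> X))) \<cdot> (act_assoc A ?c ?c X \<cdot> (?d \<diamond> \<one> X))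
        = (\<one>\<^bsub>V\<^esub> ?c \<diamond> act_assoc A ?c ?c X) \<cdot> ((\<one>\<^bsub>V\<^esub> ?c \<diamond> (?d \<diamond> \<one> X)) \<cdot> act_assoc A ?c ?c X) \<cdot> (?d \<diamond> \<one> X)"
      using X by (simp add: act_comp act_comp_tail)
    also have "(\<one>\<^bsub>V\<^esub> ?c \<diamond> (?d \<diamond> \<one> X)) \<cdot> act_assoc A ?c ?c X
        = act_assoc A ?c (?c \<otimes>\<^sub>o\<^bsub>V\<^esub> ?c) X \<cdot> ((\<one>\<^bsub>V\<^esub> ?c \<otimes>\<^bsub>V\<^esub> ?d) \<diamond> \<one> X)"
      using X act_assoc_nat [of "\<one>\<^bsub>V\<^esub> ?c" ?d "\<one> X"] by simp
    also have "(\<one>\<^bsub>V\<^esub> ?c \<diamond> act_assoc A ?c ?c X) \<cdot> \<dots> \<cdot> (?d \<diamond> \<one> X)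
        = (\<one>\<^bsub>V\<^esub> ?c \<diamond> act_assoc A ?c ?c X) \<cdot> act_assoc A ?c (?c \<otimes>\<^sub>o\<^bsub>V\<^esub> ?c) X
            \<cdot> (((\<one>\<^bsub>V\<^esub> ?c \<otimes>\<^bsub>V\<^esub> ?d) \<cdot>\<^bsub>V\<^esub> ?d) \<diamond> \<one> X)"
      using X by (simp add: act_comp act_comp_tail)
    also have "(\<one>\<^bsub>V\<^esub> ?c \<otimes>\<^bsub>V\<^esub> ?d) \<cdot>\<^bsub>V\<^esub> ?d = assc V ?c ?c ?c \<cdot>\<^bsub>V\<^esub> (?d \<otimes>\<^bsub>V\<^esub> \<one>\<^bsub>V\<^esub> ?c) \<cdot>\<^bsub>V\<^esub> ?d"
      by (rule C.co_assoc [symmetric])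
    also have "(\<one>\<^bsub>V\<^esub> ?c \<diamond> act_assoc A ?c ?c X) \<cdot> act_assoc A ?c (?c \<otimes>\<^sub>o\<^bsub>V\<^esub> ?c) X \<cdot> (\<dots> \<diamond> \<one> X)
        = ((\<one>\<^bsub>V\<^esub> ?c \<diamond> act_assoc A ?c ?c X) \<cdot> act_assoc A ?c (?c \<otimes>\<^sub>o\<^bsub>V\<^esub> ?c) X \<cdot> (assc V ?c ?c ?c \<diamond> \<one> X))
            \<cdot> (((?d \<otimes>\<^bsub>V\<^esub> \<one>\<^bsub>V\<^esub> ?c) \<cdot>\<^bsub>V\<^esub> ?d) \<diamond> \<one> X)"
      using X by (simp add: act_comp)
    also have "(\<one>\<^bsub>V\<^esub> ?c \<diamond> act_assoc A ?c ?c X) \<cdot> act_assoc A ?c (?c \<otimes>\<^sub>o\<^bsub>V\<^esub> ?c) X \<cdot> (assc V ?c ?c ?c \<diamond> \<one> X)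
        = act_assoc A ?c ?c (?c \<diamond>\<^sub>o X) \<cdot> act_assoc A (?c \<otimes>\<^sub>o\<^bsub>V\<^esub> ?c) ?c X"
      using X by (simp add: act_pentagon)
    also have "\<dots> \<cdot> (((?d \<otimes>\<^bsub>V\<^esub> \<one>\<^bsub>V\<^esub> ?c) \<cdot>\<^bsub>V\<^esub> ?d) \<diamond> \<one> X)
        = act_assoc A ?c ?c (?c \<diamond>\<^sub>o X) \<cdot> (act_assoc A (?c \<otimes>\<^sub>o\<^bsub>V\<^esub> ?c) ?c X \<cdot> ((?d \<otimes>\<^bsub>V\<^esub> \<one>\<^bsub>V\<^esub> ?c) \<diamond> \<one> X))
            \<cdot> (?d \<diamond> \<one> X)"
      using X by (simp add: act_comp)
    also have "act_assoc A (?c \<otimes>\<^sub>o\<^bsub>V\<^esub> ?c) ?c X \<cdot> ((?d \<otimes>\<^bsub>V\<^esub> \<one>\<^bsub>V\<^esub> ?c) \<diamond> \<one> X)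
        = (?d \<diamond> \<one> (?c \<diamond>\<^sub>o X)) \<cdot> act_assoc A ?c ?c X"
      using X act_assoc_nat [of ?d "\<one>\<^bsub>V\<^esub> ?c" "\<one> X"] by simp
    finally show "amap ?G (comult ?G X) \<cdot> comult ?G X = comult ?G (omap ?G X) \<cdot> comult ?G X"
      using X by (simp add: act_comonad_simps)
    have "(act_unit A (?c \<diamond>\<^sub>o X) \<cdot> (?e \<diamond> \<one> (?c \<diamond>\<^sub>o X))) \<cdot> act_assoc A ?c ?c X \<cdot> (?d \<diamond> \<one> X)
        = act_unit A (?c \<diamond>\<^sub>o X) \<cdot> ((?e \<diamond> (\<one>\<^bsub>V\<^esub> ?c \<diamond> \<one> X)) \<cdot> act_assoc A ?c ?c X) \<cdot> (?d \<diamond> \<one> X)"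
      using X by simp
    also have "(?e \<diamond> (\<one>\<^bsub>V\<^esub> ?c \<diamond> \<one> X)) \<cdot> act_assoc A ?c ?c X
        = act_assoc A (unit_obj V) ?c X \<cdot> ((?e \<otimes>\<^bsub>V\<^esub> \<one>\<^bsub>V\<^esub> ?c) \<diamond> \<one> X)"
      using X act_assoc_nat [of ?e "\<one>\<^bsub>V\<^esub> ?c" "\<one> X"] by simp
    also have "act_unit A (?c \<diamond>\<^sub>o X) \<cdot> \<dots> \<cdot> (?d \<diamond> \<one> X)
        = (act_unit A (?c \<diamond>\<^sub>o X) \<cdot> act_assoc A (unit_obj V) ?c X) \<cdot> (((?e \<otimes>\<^bsub>V\<^esub> \<one>\<^bsub>V\<^esub> ?c) \<cdot>\<^bsub>V\<^esub> ?d) \<diamond> \<one> X)"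
      using X by (simp add: act_comp)
    also have "act_unit A (?c \<diamond>\<^sub>o X) \<cdot> act_assoc A (unit_obj V) ?c X = lunit V ?c \<diamond> \<one> X"
      using X by (simp add: act_triangle_left)
    also have "\<dots> \<cdot> (((?e \<otimes>\<^bsub>V\<^esub> \<one>\<^bsub>V\<^esub> ?c) \<cdot>\<^bsub>V\<^esub> ?d) \<diamond> \<one> X) = \<one> (?c \<diamond>\<^sub>o X)"
      using X by (simp add: act_comp C.co_unit_left)
    finally show "counit ?G (omap ?G X) \<cdot> comult ?G X = \<one> (omap ?G X)"
      by (simp add: act_comonad_simps)
    have "(\<one>\<^bsub>V\<^esub> ?c \<diamond> (act_unit A X \<cdot> (?e \<diamond> \<one> X))) \<cdot> act_assoc A ?c ?c X \<cdot> (?d \<diamond> \<one> X)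
        = (\<one>\<^bsub>V\<^esub> ?c \<diamond> act_unit A X) \<cdot> ((\<one>\<^bsub>V\<^esub> ?c \<diamond> (?e \<diamond> \<one> X)) \<cdot> act_assoc A ?c ?c X) \<cdot> (?d \<diamond> \<one> X)"
      using X by (simp add: act_comp_tail)
    also have "(\<one>\<^bsub>V\<^esub> ?c \<diamond> (?e \<diamond> \<one> X)) \<cdot> act_assoc A ?c ?c X
        = act_assoc A ?c (unit_obj V) X \<cdot> ((\<one>\<^bsub>V\<^esub> ?c \<otimes>\<^bsub>V\<^esub> ?e) \<diamond> \<one> X)"
      using X act_assoc_nat [of "\<one>\<^bsub>V\<^esub> ?c" ?e "\<one> X"] by simp
    also have "(\<one>\<^bsub>V\<^esub> ?c \<diamond> act_unit A X) \<cdot> \<dots> \<cdot> (?d \<diamond> \<one> X)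
        = ((\<one>\<^bsub>V\<^esub> ?c \<diamond> act_unit A X) \<cdot> act_assoc A ?c (unit_obj V) X) \<cdot> (((\<one>\<^bsub>V\<^esub> ?c \<otimes>\<^bsub>V\<^esub> ?e) \<cdot>\<^bsub>V\<^esub> ?d) \<diamond> \<one> X)"
      using X by (simp add: act_comp)
    also have "(\<one>\<^bsub>V\<^esub> ?c \<diamond> act_unit A X) \<cdot> act_assoc A ?c (unit_obj V) X = runit V ?c \<diamond> \<one> X"
      using X by (simp add: act_triangle_right)
    also have "\<dots> \<cdot> (((\<one>\<^bsub>V\<^esub> ?c \<otimes>\<^bsub>V\<^esub> ?e) \<cdot>\<^bsub>V\<^esub> ?d) \<diamond> \<one> X) = \<one> (?c \<diamond>\<^sub>o X)"
      using X by (simp add: act_comp C.co_unit_right)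
    finally show "amap ?G (counit ?G X) \<cdot> comult ?G X = \<one> (omap ?G X)"
      by (simp add: act_comonad_simps)
  qed (use G in \<open>auto simp: act_comonad_simps act_comp\<close>)
qed

end

section \<open>Modules over a comodule-monad and the Hopf comonad\<close>

locale opmonoidal_comodule_monad =
  left_category V A + T: opmonoidal_monad V T + S: comodule_monad V T A S
  for V :: "('v, 'w, 'z) moncat_scheme" and T :: "('v, 'w, 'x) opmnd_scheme"
    and A :: "('v, 'w, 'o, 'a, 'y) actcat_scheme" (structure)
    and S :: "('v, 'o, 'a, 'u) comodmnd_scheme"

sublocale opmonoidal_comodule_monad \<subseteq> TM: monad V T
  by (rule T.T_monad)

sublocale opmonoidal_comodule_monad \<subseteq> SM: monad A S
  by (rule S.S_monad)

sublocale opmonoidal_comodule_monad \<subseteq> W: opmonoidal_functor V T "omega T" "xi T"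
  by (rule T.T_opmonoidal)

context opmonoidal_comodule_monad
begin

lemma omega_arr [simp]:
  assumes "v \<in> Obj V" "w \<in> Obj V"
  shows "omega T v w \<in> Arr V" "Dom V (omega T v w) = omap T (v \<otimes>\<^sub>o\<^bsub>V\<^esub> w)"
    "Cod V (omega T v w) = omap T v \<otimes>\<^sub>o\<^bsub>V\<^esub> omap T w"
  using W.omega_hom [OF assms] by simp_all

lemma xi_arr [simp]:
  "xi T \<in> Arr V" "Dom V (xi T) = omap T (unit_obj V)" "Cod V (xi T) = unit_obj V"
  using W.xi_hom by simp_all

lemma omega_nat:
  assumes "p \<in> Arr V" "q \<in> Arr V"
  shows "omega T (Cod V p) (Cod V q) \<cdot>\<^bsub>V\<^esub> amap T (p \<otimes>\<^bsub>V\<^esub> q)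
    = (amap T p \<otimes>\<^bsub>V\<^esub> amap T q) \<cdot>\<^bsub>V\<^esub> omega T (Dom V p) (Dom V q)"
  by (rule W.omega_natural) (use assms in auto)

lemma omega_mult:
  assumes "v \<in> Obj V" "w \<in> Obj V"
  shows "omega T v w \<cdot>\<^bsub>V\<^esub> mult T (v \<otimes>\<^sub>o\<^bsub>V\<^esub> w)
    = (mult T v \<otimes>\<^bsub>V\<^esub> mult T w) \<cdot>\<^bsub>V\<^esub> omega T (omap T v) (omap T w) \<cdot>\<^bsub>V\<^esub> amap T (omega T v w)"
  using T.mult_opmonoidal assms by (simp add: opmonoidal_nat_trans_def)

lemma xi_mult: "xi T \<cdot>\<^bsub>V\<^esub> mult T (unit_obj V) = xi T \<cdot>\<^bsub>V\<^esub> amap T (xi T)"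
  using T.mult_opmonoidal by (simp add: opmonoidal_nat_trans_def)

lemma chi_arr [simp]:
  assumes "v \<in> Obj V" "X \<in> Obj A"
  shows "chi S v X \<in> Arr A" "Dom A (chi S v X) = omap S (v \<diamond>\<^sub>o X)"
    "Cod A (chi S v X) = omap T v \<diamond>\<^sub>o omap S X"
  using S.chi_hom [OF assms] by simp_all

lemma chi_nat:
  assumes "p \<in> Arr V" "f \<in> Arr A"
  shows "chi S (Cod V p) (Cod A f) \<cdot> amap S (p \<diamond> f)
    = (amap T p \<diamond> amap S f) \<cdot> chi S (Dom V p) (Dom A f)"
  by (rule S.chi_natural) (use assms in auto)

text \<open>The comonoid in \<open>V\<close> underlying T(C), with its \<open>T\<close>-module
  structure forgotten. It induces a comonad on \<open>A\<close> itself, from which the laws of the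
  Hopf comonad are read off.\<close>

definition free_comonoid :: "('v, 'w) comon \<Rightarrow> ('v, 'w) comon" where
  "free_comonoid C = \<lparr> co_obj = omap T (co_obj C),
     co_mult = omega T (co_obj C) (co_obj C) \<cdot>\<^bsub>V\<^esub> amap T (co_mult C),
     co_unit = xi T \<cdot>\<^bsub>V\<^esub> amap T (co_unit C) \<rparr>"

text \<open>Opmonoidal functors preserve comonoids. Naturality of \<open>omega\<close> (the
  equations \<open>d1\<close> to \<open>e2\<close>) moves the images of comultiplication and counit
  past \<open>omega\<close>; the coherence axioms of \<open>omega\<close> and \<open>xi\<close> then
  expose \<open>T\<close> applied to a comonoid law of \<open>C\<close>.\<close>

lemma free_comonoid_comonoid:
  assumes "comonoid V C"
  shows "comonoid V (free_comonoid C)"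
proof -
  interpret C: comonoid V C by fact
  let ?c = "co_obj C" and ?d = "co_mult C" and ?e = "co_unit C"
  let ?\<omega> = "omega T" and ?a = "assc V (omap T ?c) (omap T ?c) (omap T ?c)"
  let ?I = "unit_obj V" and ?cc = "?c \<otimes>\<^sub>o\<^bsub>V\<^esub> ?c" and ?i = "\<one>\<^bsub>V\<^esub> (omap T ?c)"
  have d1: "(amap T ?d \<otimes>\<^bsub>V\<^esub> ?i) \<cdot>\<^bsub>V\<^esub> ?\<omega> ?c ?c = ?\<omega> ?cc ?c \<cdot>\<^bsub>V\<^esub> amap T (?d \<otimes>\<^bsub>V\<^esub> \<one>\<^bsub>V\<^esub> ?c)"
    using omega_nat [of ?d "\<one>\<^bsub>V\<^esub> ?c"] by simp
  have d2: "(?i \<otimes>\<^bsub>V\<^esub> amap T ?d) \<cdot>\<^bsub>V\<^esub> ?\<omega> ?c ?c = ?\<omega> ?c ?cc \<cdot>\<^bsub>V\<^esub> amap T (\<one>\<^bsub>V\<^esub> ?c \<otimes>\<^bsub>V\<^esub> ?d)"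
    using omega_nat [of "\<one>\<^bsub>V\<^esub> ?c" ?d] by simp
  have e1: "(amap T ?e \<otimes>\<^bsub>V\<^esub> ?i) \<cdot>\<^bsub>V\<^esub> ?\<omega> ?c ?c = ?\<omega> ?I ?c \<cdot>\<^bsub>V\<^esub> amap T (?e \<otimes>\<^bsub>V\<^esub> \<one>\<^bsub>V\<^esub> ?c)"
    using omega_nat [of ?e "\<one>\<^bsub>V\<^esub> ?c"] by simp
  have e2: "(?i \<otimes>\<^bsub>V\<^esub> amap T ?e) \<cdot>\<^bsub>V\<^esub> ?\<omega> ?c ?c = ?\<omega> ?c ?I \<cdot>\<^bsub>V\<^esub> amap T (\<one>\<^bsub>V\<^esub> ?c \<otimes>\<^bsub>V\<^esub> ?e)"
    using omega_nat [of "\<one>\<^bsub>V\<^esub> ?c" ?e] by simp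
  have "?a \<cdot>\<^bsub>V\<^esub> ((?\<omega> ?c ?c \<cdot>\<^bsub>V\<^esub> amap T ?d) \<otimes>\<^bsub>V\<^esub> ?i) \<cdot>\<^bsub>V\<^esub> (?\<omega> ?c ?c \<cdot>\<^bsub>V\<^esub> amap T ?d)
      = ?a \<cdot>\<^bsub>V\<^esub> (?\<omega> ?c ?c \<otimes>\<^bsub>V\<^esub> ?i) \<cdot>\<^bsub>V\<^esub> ((amap T ?d \<otimes>\<^bsub>V\<^esub> ?i) \<cdot>\<^bsub>V\<^esub> ?\<omega> ?c ?c) \<cdot>\<^bsub>V\<^esub> amap T ?d"
    by (simp add: V.tensor_comp_tail)
  also have "\<dots> = (?a \<cdot>\<^bsub>V\<^esub> (?\<omega> ?c ?c \<otimes>\<^bsub>V\<^esub> ?i) \<cdot>\<^bsub>V\<^esub> ?\<omega> ?cc ?c) \<cdot>\<^bsub>V\<^esub> amap T ((?d \<otimes>\<^bsub>V\<^esub> \<one>\<^bsub>V\<^esub> ?c) \<cdot>\<^bsub>V\<^esub> ?d)"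
    unfolding d1 by (simp add: TM.T.amap_comp)
  also have "?a \<cdot>\<^bsub>V\<^esub> (?\<omega> ?c ?c \<otimes>\<^bsub>V\<^esub> ?i) \<cdot>\<^bsub>V\<^esub> ?\<omega> ?cc ?c
      = (?i \<otimes>\<^bsub>V\<^esub> ?\<omega> ?c ?c) \<cdot>\<^bsub>V\<^esub> ?\<omega> ?c ?cc \<cdot>\<^bsub>V\<^esub> amap T (assc V ?c ?c ?c)"
    by (simp add: W.omega_coassoc)
  also have "\<dots> \<cdot>\<^bsub>V\<^esub> amap T ((?d \<otimes>\<^bsub>V\<^esub> \<one>\<^bsub>V\<^esub> ?c) \<cdot>\<^bsub>V\<^esub> ?d)
      = (?i \<otimes>\<^bsub>V\<^esub> ?\<omega> ?c ?c) \<cdot>\<^bsub>V\<^esub> ?\<omega> ?c ?cc \<cdot>\<^bsub>V\<^esub> amap T (assc V ?c ?c ?c \<cdot>\<^bsub>V\<^esub> (?d \<otimes>\<^bsub>V\<^esub> \<one>\<^bsub>V\<^esub> ?c) \<cdot>\<^bsub>V\<^esub> ?d)"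
    by (simp add: TM.T.amap_comp)
  also have "\<dots> = (?i \<otimes>\<^bsub>V\<^esub> ?\<omega> ?c ?c) \<cdot>\<^bsub>V\<^esub> ((?i \<otimes>\<^bsub>V\<^esub> amap T ?d) \<cdot>\<^bsub>V\<^esub> ?\<omega> ?c ?c) \<cdot>\<^bsub>V\<^esub> amap T ?d"
    unfolding d2 C.co_assoc by (simp add: TM.T.amap_comp)
  also have "\<dots> = (?i \<otimes>\<^bsub>V\<^esub> (?\<omega> ?c ?c \<cdot>\<^bsub>V\<^esub> amap T ?d)) \<cdot>\<^bsub>V\<^esub> (?\<omega> ?c ?c \<cdot>\<^bsub>V\<^esub> amap T ?d)"
    by (simp add: V.tensor_comp_tail)
  finally have assoc: "?a \<cdot>\<^bsub>V\<^esub> ((?\<omega> ?c ?c \<cdot>\<^bsub>V\<^esub> amap T ?d) \<otimes>\<^bsub>V\<^esub> ?i) \<cdot>\<^bsub>V\<^esub> (?\<omega> ?c ?c \<cdot>\<^bsub>V\<^esub> amap T ?d)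
      = (?i \<otimes>\<^bsub>V\<^esub> (?\<omega> ?c ?c \<cdot>\<^bsub>V\<^esub> amap T ?d)) \<cdot>\<^bsub>V\<^esub> (?\<omega> ?c ?c \<cdot>\<^bsub>V\<^esub> amap T ?d)" .
  have "lunit V (omap T ?c) \<cdot>\<^bsub>V\<^esub> ((xi T \<cdot>\<^bsub>V\<^esub> amap T ?e) \<otimes>\<^bsub>V\<^esub> ?i) \<cdot>\<^bsub>V\<^esub> (?\<omega> ?c ?c \<cdot>\<^bsub>V\<^esub> amap T ?d)
      = lunit V (omap T ?c) \<cdot>\<^bsub>V\<^esub> (xi T \<otimes>\<^bsub>V\<^esub> ?i) \<cdot>\<^bsub>V\<^esub> ((amap T ?e \<otimes>\<^bsub>V\<^esub> ?i) \<cdot>\<^bsub>V\<^esub> ?\<omega> ?c ?c) \<cdot>\<^bsub>V\<^esub> amap T ?d"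
    by (simp add: V.tensor_comp_tail)
  also have "\<dots> = (lunit V (omap T ?c) \<cdot>\<^bsub>V\<^esub> (xi T \<otimes>\<^bsub>V\<^esub> ?i) \<cdot>\<^bsub>V\<^esub> ?\<omega> ?I ?c)
      \<cdot>\<^bsub>V\<^esub> amap T ((?e \<otimes>\<^bsub>V\<^esub> \<one>\<^bsub>V\<^esub> ?c) \<cdot>\<^bsub>V\<^esub> ?d)"
    unfolding e1 by (simp add: TM.T.amap_comp)
  also have "\<dots> = amap T (lunit V ?c \<cdot>\<^bsub>V\<^esub> (?e \<otimes>\<^bsub>V\<^esub> \<one>\<^bsub>V\<^esub> ?c) \<cdot>\<^bsub>V\<^esub> ?d)"
    by (simp add: W.omega_counit_left TM.T.amap_comp del: V.comp_assoc)
  also have "\<dots> = ?i"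
    by (simp add: C.co_unit_left)
  finally have left: "lunit V (omap T ?c) \<cdot>\<^bsub>V\<^esub> ((xi T \<cdot>\<^bsub>V\<^esub> amap T ?e) \<otimes>\<^bsub>V\<^esub> ?i)
      \<cdot>\<^bsub>V\<^esub> (?\<omega> ?c ?c \<cdot>\<^bsub>V\<^esub> amap T ?d) = ?i" .
  have "runit V (omap T ?c) \<cdot>\<^bsub>V\<^esub> (?i \<otimes>\<^bsub>V\<^esub> (xi T \<cdot>\<^bsub>V\<^esub> amap T ?e)) \<cdot>\<^bsub>V\<^esub> (?\<omega> ?c ?c \<cdot>\<^bsub>V\<^esub> amap T ?d)
      = runit V (omap T ?c) \<cdot>\<^bsub>V\<^esub> (?i \<otimes>\<^bsub>V\<^esub> xi T) \<cdot>\<^bsub>V\<^esub> ((?i \<otimes>\<^bsub>V\<^esub> amap T ?e) \<cdot>\<^bsub>V\<^esub> ?\<omega> ?c ?c) \<cdot>\<^bsub>V\<^esub> amap T ?d"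
    by (simp add: V.tensor_comp_tail)
  also have "\<dots> = (runit V (omap T ?c) \<cdot>\<^bsub>V\<^esub> (?i \<otimes>\<^bsub>V\<^esub> xi T) \<cdot>\<^bsub>V\<^esub> ?\<omega> ?c ?I)
      \<cdot>\<^bsub>V\<^esub> amap T ((\<one>\<^bsub>V\<^esub> ?c \<otimes>\<^bsub>V\<^esub> ?e) \<cdot>\<^bsub>V\<^esub> ?d)"
    unfolding e2 by (simp add: TM.T.amap_comp)
  also have "\<dots> = amap T (runit V ?c \<cdot>\<^bsub>V\<^esub> (\<one>\<^bsub>V\<^esub> ?c \<otimes>\<^bsub>V\<^esub> ?e) \<cdot>\<^bsub>V\<^esub> ?d)"
    by (simp add: W.omega_counit_right TM.T.amap_comp del: V.comp_assoc)
  also have "\<dots> = ?i"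
    by (simp add: C.co_unit_right)
  finally have right: "runit V (omap T ?c) \<cdot>\<^bsub>V\<^esub> (?i \<otimes>\<^bsub>V\<^esub> (xi T \<cdot>\<^bsub>V\<^esub> amap T ?e))
      \<cdot>\<^bsub>V\<^esub> (?\<omega> ?c ?c \<cdot>\<^bsub>V\<^esub> amap T ?d) = ?i" .
  show ?thesis
    by unfold_locales (use assoc left right in \<open>auto simp: free_comonoid_def\<close>)
qed

lemma em_act_obj_simps [simp]:
  "fst (em_act_obj A S M N) = fst M \<diamond>\<^sub>o fst N"
  "snd (em_act_obj A S M N) = (snd M \<diamond> snd N) \<cdot> chi S (fst M) (fst N)"
  by (simp_all add: em_act_obj_def)

text \<open>Associativity of the diagonal action combines the associativity of both factors with
  naturality of \<open>chi\<close> and \<open>chi_mult\<close>; the unit law is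
  \<open>chi_ret\<close> followed by the unit laws of both factors.\<close>

lemma act_module:
  assumes M: "M \<in> em_obj V T" and N: "N \<in> em_obj A S"
  shows "em_act_obj A S M N \<in> em_obj A S"
proof -
  obtain v s where Ms: "M = (v, s)" by (cases M)
  obtain Y h where Nh: "N = (Y, h)" by (cases N)
  have s: "v \<in> Obj V" "s \<in> Arr V" "Dom V s = omap T v" "Cod V s = v"
    "s \<cdot>\<^bsub>V\<^esub> amap T s = s \<cdot>\<^bsub>V\<^esub> mult T v" "s \<cdot>\<^bsub>V\<^esub> ret T v = \<one>\<^bsub>V\<^esub> v"
    using M by (auto simp: em_obj_iff Ms)
  have h: "Y \<in> Obj A" "h \<in> Arr A" "Dom A h = omap S Y" "Cod A h = Y"
    "h \<cdot> amap S h = h \<cdot> mult S Y" "h \<cdot> ret S Y = \<one> Y"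
    using N by (auto simp: em_obj_iff Nh)
  have "((s \<diamond> h) \<cdot> chi S v Y) \<cdot> amap S ((s \<diamond> h) \<cdot> chi S v Y)
      = (s \<diamond> h) \<cdot> (chi S v Y \<cdot> amap S (s \<diamond> h)) \<cdot> amap S (chi S v Y)"
    using s(1-4) h(1-4) by (simp add: SM.T.amap_comp)
  also have "chi S v Y \<cdot> amap S (s \<diamond> h) = (amap T s \<diamond> amap S h) \<cdot> chi S (omap T v) (omap S Y)"
    using chi_nat [of s h] s(1-4) h(1-4) by simp
  also have "(s \<diamond> h) \<cdot> \<dots> \<cdot> amap S (chi S v Y)
      = ((s \<cdot>\<^bsub>V\<^esub> amap T s) \<diamond> (h \<cdot> amap S h)) \<cdot> chi S (omap T v) (omap S Y) \<cdot> amap S (chi S v Y)"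
    using s(1-4) h(1-4) by (simp add: act_comp_tail)
  also have "\<dots> = (s \<diamond> h) \<cdot> ((mult T v \<diamond> mult S Y) \<cdot> chi S (omap T v) (omap S Y) \<cdot> amap S (chi S v Y))"
    using s h by (simp add: act_comp_tail)
  also have "\<dots> = ((s \<diamond> h) \<cdot> chi S v Y) \<cdot> mult S (v \<diamond>\<^sub>o Y)"
    using s(1-4) h(1-4) by (simp flip: S.chi_mult)
  finally have assoc: "((s \<diamond> h) \<cdot> chi S v Y) \<cdot> amap S ((s \<diamond> h) \<cdot> chi S v Y)
      = ((s \<diamond> h) \<cdot> chi S v Y) \<cdot> mult S (v \<diamond>\<^sub>o Y)" .
  have "((s \<diamond> h) \<cdot> chi S v Y) \<cdot> ret S (v \<diamond>\<^sub>o Y) = (s \<diamond> h) \<cdot> (ret T v \<diamond> ret S Y)"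
    using s(1-4) h(1-4) by (simp add: S.chi_ret)
  also have "\<dots> = \<one> (v \<diamond>\<^sub>o Y)"
    using s h by (simp add: act_comp)
  finally have "((s \<diamond> h) \<cdot> chi S v Y) \<cdot> ret S (v \<diamond>\<^sub>o Y) = \<one> (v \<diamond>\<^sub>o Y)" .
  with assoc s h show ?thesis
    unfolding em_obj_iff by (simp add: Ms Nh)
qed

text \<open>Every structure arrow of the Hopf comonad \<open>G\<close> has the corresponding arrow
  of \<open>H\<close> as its underlying arrow. Equations between module morphisms thereby reduce to
  equations for \<open>H\<close> in \<open>A\<close>.\<close>

lemma hopf_comonad_simps:
  fixes C :: "('v, 'w) comon"
  defines "G \<equiv> hopf_comonad V T A S (free_module_comonoid V T C)"
    and "H \<equiv> act_comonad V A (free_comonoid C)"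
    and "Z \<equiv> (omap T (co_obj C), mult T (co_obj C))"
  shows "omap G N = em_act_obj A S Z N"
    "amap G p = (em_act_obj A S Z (fst p), amap H (und p), em_act_obj A S Z (snd (snd p)))"
    "comult G N = (em_act_obj A S Z N, comult H (fst N), em_act_obj A S Z (em_act_obj A S Z N))"
    "counit G N = (em_act_obj A S Z N, counit H (fst N), N)"
  by (simp_all add: G_def H_def Z_def hopf_comonad_def act_comonad_def free_module_comonoid_def Let_def
      free_comonoid_def em_actcat_def em_moncat_def cat.extend_def actcat.fields_def moncat.fields_def
      em_cat_def)

text \<open>The comonad laws hold on underlying arrows because \<open>?H\<close> is a comonad. The
  work lies in the facts \<open>amap\<close>, \<open>comult\<close> and \<open>counit\<close>: the
  arrows concerned are compatible with the \<open>S\<close>-module structures.\<close>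

lemma hopf_comonad_comonad:
  assumes "comonoid V C"
  shows "comonad (em_cat A S) (hopf_comonad V T A S (free_module_comonoid V T C))" (is "comonad ?B ?G")
proof -
  interpret C: comonoid V C by fact
  interpret Z: comonoid V "free_comonoid C" by (rule free_comonoid_comonoid) fact
  interpret H: comonad A "act_comonad V A (free_comonoid C)"
    by (rule act_comonad_comonad) (rule Z.comonoid_axioms)
  interpret B: category ?B by (rule SM.em_category)
  let ?c = "co_obj C" let ?Tc = "omap T ?c" and ?m = "mult T ?c" and ?I = "unit_obj V" and ?\<omega> = "omega T"
  let ?d = "?\<omega> ?c ?c \<cdot>\<^bsub>V\<^esub> amap T (co_mult C)" and ?e = "xi T \<cdot>\<^bsub>V\<^esub> amap T (co_unit C)"
  let ?Z = "(?Tc, ?m)" and ?H = "act_comonad V A (free_comonoid C)"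
  have Z: "?Z \<in> em_obj V T"
    by (rule TM.free_obj) simp
  note ob = act_module [OF Z]
  note Hs = act_comonad_simps [where C = "free_comonoid C"]
  have und: "co_obj (free_comonoid C) = ?Tc" "co_mult (free_comonoid C) = ?d"
    "co_unit (free_comonoid C) = ?e"
    by (simp_all add: free_comonoid_def)
  \<comment> \<open>The comultiplication of T(C), and below it the counit, is a morphism of
    \<open>T\<close>-modules: naturality of \<open>mult T\<close> followed by its being an
    opmonoidal transformation.\<close>
  have "?d \<cdot>\<^bsub>V\<^esub> ?m = ?\<omega> ?c ?c \<cdot>\<^bsub>V\<^esub> (amap T (co_mult C) \<cdot>\<^bsub>V\<^esub> ?m)"
    by simp
  also have "\<dots> = (?\<omega> ?c ?c \<cdot>\<^bsub>V\<^esub> mult T (?c \<otimes>\<^sub>o\<^bsub>V\<^esub> ?c)) \<cdot>\<^bsub>V\<^esub> amap T (amap T (co_mult C))"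
    using TM.mult_natural [of "co_mult C"] by simp
  also have "\<dots> = (?m \<otimes>\<^bsub>V\<^esub> ?m) \<cdot>\<^bsub>V\<^esub> ?\<omega> ?Tc ?Tc \<cdot>\<^bsub>V\<^esub> amap T ?d"
    by (simp add: omega_mult TM.T.amap_comp)
  finally have dm: "?d \<cdot>\<^bsub>V\<^esub> ?m = (?m \<otimes>\<^bsub>V\<^esub> ?m) \<cdot>\<^bsub>V\<^esub> ?\<omega> ?Tc ?Tc \<cdot>\<^bsub>V\<^esub> amap T ?d" .
  have "?e \<cdot>\<^bsub>V\<^esub> ?m = xi T \<cdot>\<^bsub>V\<^esub> (amap T (co_unit C) \<cdot>\<^bsub>V\<^esub> ?m)"
    by simp
  also have "\<dots> = (xi T \<cdot>\<^bsub>V\<^esub> mult T ?I) \<cdot>\<^bsub>V\<^esub> amap T (amap T (co_unit C))"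
    using TM.mult_natural [of "co_unit C"] by simp
  also have "\<dots> = xi T \<cdot>\<^bsub>V\<^esub> amap T ?e"
    by (simp add: xi_mult TM.T.amap_comp)
  finally have em: "?e \<cdot>\<^bsub>V\<^esub> ?m = xi T \<cdot>\<^bsub>V\<^esub> amap T ?e" .
  have d: "?d \<in> Arr V" "Dom V ?d = ?Tc" "Cod V ?d = ?Tc \<otimes>\<^sub>o\<^bsub>V\<^esub> ?Tc"
    and e: "?e \<in> Arr V" "Dom V ?e = ?Tc" "Cod V ?e = ?I"
    by simp_all
  have amap: "amap ?G p \<in> Arr ?B" if "p \<in> Arr ?B" for p
  proof -
    obtain X h f Y k where p: "p = ((X, h), f, (Y, k))" by (metis prod.collapse)
    have ob': "(X, h) \<in> em_obj A S" "(Y, k) \<in> em_obj A S"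
      and f: "X \<in> Obj A" "Y \<in> Obj A" "h \<in> Arr A" "k \<in> Arr A" "f \<in> Arr A" "Dom A h = omap S X" "Cod A h = X"
        "Dom A k = omap S Y" "Cod A k = Y" "Dom A f = X" "Cod A f = Y" and fh: "f \<cdot> h = k \<cdot> amap S f"
      using that by (auto simp: p em_cat_simps em_obj_iff)
    have "(\<one>\<^bsub>V\<^esub> ?Tc \<diamond> f) \<cdot> (?m \<diamond> h) \<cdot> chi S ?Tc X = (?m \<diamond> (k \<cdot> amap S f)) \<cdot> chi S ?Tc X"
      using f by (simp add: act_comp_tail fh)
    also have "\<dots> = (?m \<diamond> k) \<cdot> ((amap T (\<one>\<^bsub>V\<^esub> ?Tc) \<diamond> amap S f) \<cdot> chi S ?Tc X)"
      using f by (simp add: act_comp_tail)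
    also have "\<dots> = (?m \<diamond> k) \<cdot> (chi S ?Tc Y \<cdot> amap S (\<one>\<^bsub>V\<^esub> ?Tc \<diamond> f))"
      using chi_nat [of "\<one>\<^bsub>V\<^esub> ?Tc" f] f by simp
    finally show ?thesis
      using f ob [OF ob'(1)] ob [OF ob'(2)] by (simp add: em_cat_simps p hopf_comonad_simps Hs und)
  qed
  have comult: "comult ?G N \<in> Arr ?B" if "N \<in> Obj ?B" for N
  proof -
    obtain Y h where N: "N = (Y, h)" by (cases N)
    have ob': "(Y, h) \<in> em_obj A S"
      and h: "Y \<in> Obj A" "h \<in> Arr A" "Dom A h = omap S Y" "Cod A h = Y"
      using that by (auto simp: N em_cat_simps em_obj_iff)
    let ?\<alpha> = "act_assoc A ?Tc ?Tc"
    \<comment> \<open>After \<open>dm\<close> doubles the module structure of T(C), naturality of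
      \<open>act_assoc\<close> distributes the two copies over the iterated action, and
      \<open>chi_assoc\<close> trades \<open>omega\<close> for two uses of \<open>chi\<close>, as in
      the structure of the twofold action.\<close>
    have "(?\<alpha> Y \<cdot> (?d \<diamond> \<one> Y)) \<cdot> ((?m \<diamond> h) \<cdot> chi S ?Tc Y) = ?\<alpha> Y \<cdot> ((?d \<cdot>\<^bsub>V\<^esub> ?m) \<diamond> h) \<cdot> chi S ?Tc Y"
      using h d by (simp add: act_comp_tail)
    also have "\<dots> = (?\<alpha> Y \<cdot> ((?m \<otimes>\<^bsub>V\<^esub> ?m) \<diamond> h)) \<cdot> (?\<omega> ?Tc ?Tc \<diamond> \<one> (omap S Y))
        \<cdot> ((amap T ?d \<diamond> amap S (\<one> Y)) \<cdot> chi S ?Tc Y)"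
      unfolding dm using h d by (simp add: act_comp_tail)
    also have "?\<alpha> Y \<cdot> ((?m \<otimes>\<^bsub>V\<^esub> ?m) \<diamond> h) = (?m \<diamond> (?m \<diamond> h)) \<cdot> act_assoc A (omap T ?Tc) (omap T ?Tc) (omap S Y)"
      using h act_assoc_nat [of ?m ?m h] by simp
    also have "(amap T ?d \<diamond> amap S (\<one> Y)) \<cdot> chi S ?Tc Y = chi S (?Tc \<otimes>\<^sub>o\<^bsub>V\<^esub> ?Tc) Y \<cdot> amap S (?d \<diamond> \<one> Y)"
      using h d chi_nat [of ?d "\<one> Y"] by simp
    also have "((?m \<diamond> (?m \<diamond> h)) \<cdot> act_assoc A (omap T ?Tc) (omap T ?Tc) (omap S Y)) \<cdot> (?\<omega> ?Tc ?Tc \<diamond> \<one> (omap S Y)) \<cdot> \<dots>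
        = (?m \<diamond> (?m \<diamond> h)) \<cdot> (act_assoc A (omap T ?Tc) (omap T ?Tc) (omap S Y) \<cdot> (?\<omega> ?Tc ?Tc \<diamond> \<one> (omap S Y))
          \<cdot> chi S (?Tc \<otimes>\<^sub>o\<^bsub>V\<^esub> ?Tc) Y) \<cdot> amap S (?d \<diamond> \<one> Y)"
      using h d by simp
    also have "act_assoc A (omap T ?Tc) (omap T ?Tc) (omap S Y) \<cdot> (?\<omega> ?Tc ?Tc \<diamond> \<one> (omap S Y)) \<cdot> chi S (?Tc \<otimes>\<^sub>o\<^bsub>V\<^esub> ?Tc) Y
        = (\<one>\<^bsub>V\<^esub> (omap T ?Tc) \<diamond> chi S ?Tc Y) \<cdot> chi S ?Tc (?Tc \<diamond>\<^sub>o Y) \<cdot> amap S (?\<alpha> Y)"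
      using h by (simp add: S.chi_assoc)
    also have "(?m \<diamond> (?m \<diamond> h)) \<cdot> \<dots> \<cdot> amap S (?d \<diamond> \<one> Y)
        = ((?m \<diamond> ((?m \<diamond> h) \<cdot> chi S ?Tc Y)) \<cdot> chi S ?Tc (?Tc \<diamond>\<^sub>o Y)) \<cdot> amap S (?\<alpha> Y \<cdot> (?d \<diamond> \<one> Y))"
      using h d by (simp add: act_comp_tail SM.T.amap_comp)
    finally show ?thesis
      using h d ob [OF ob'] ob [OF ob [OF ob']]
      by (simp add: em_cat_simps N hopf_comonad_simps Hs und)
  qed
  have counit: "counit ?G N \<in> Arr ?B" if "N \<in> Obj ?B" for N
  proof -
    obtain Y h where N: "N = (Y, h)" by (cases N)
    have ob': "(Y, h) \<in> em_obj A S"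
      and h: "Y \<in> Obj A" "h \<in> Arr A" "Dom A h = omap S Y" "Cod A h = Y"
      using that by (auto simp: N em_cat_simps em_obj_iff)
    \<comment> \<open>The same pattern for the counit, with \<open>em\<close>, naturality of
      \<open>act_unit\<close> at \<open>h\<close>, and \<open>chi_unit\<close>.\<close>
    have "(act_unit A Y \<cdot> (?e \<diamond> \<one> Y)) \<cdot> ((?m \<diamond> h) \<cdot> chi S ?Tc Y) = act_unit A Y \<cdot> ((?e \<cdot>\<^bsub>V\<^esub> ?m) \<diamond> h) \<cdot> chi S ?Tc Y"
      using h e by (simp add: act_comp_tail)
    also have "\<dots> = (act_unit A Y \<cdot> (\<one>\<^bsub>V\<^esub> ?I \<diamond> h)) \<cdot> (xi T \<diamond> \<one> (omap S Y))
        \<cdot> ((amap T ?e \<diamond> amap S (\<one> Y)) \<cdot> chi S ?Tc Y)"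
      unfolding em using h e by (simp add: act_comp_tail)
    also have "act_unit A Y \<cdot> (\<one>\<^bsub>V\<^esub> ?I \<diamond> h) = h \<cdot> act_unit A (omap S Y)"
      using h act_unit_nat [of h] by simp
    also have "(amap T ?e \<diamond> amap S (\<one> Y)) \<cdot> chi S ?Tc Y = chi S ?I Y \<cdot> amap S (?e \<diamond> \<one> Y)"
      using h e chi_nat [of ?e "\<one> Y"] by simp
    also have "(h \<cdot> act_unit A (omap S Y)) \<cdot> (xi T \<diamond> \<one> (omap S Y)) \<cdot> \<dots>
        = h \<cdot> (act_unit A (omap S Y) \<cdot> (xi T \<diamond> \<one> (omap S Y)) \<cdot> chi S ?I Y) \<cdot> amap S (?e \<diamond> \<one> Y)"
      using h e by simp
    also have "act_unit A (omap S Y) \<cdot> (xi T \<diamond> \<one> (omap S Y)) \<cdot> chi S ?I Y = amap S (act_unit A Y)"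
      using h by (simp add: S.chi_unit)
    also have "h \<cdot> \<dots> \<cdot> amap S (?e \<diamond> \<one> Y) = h \<cdot> amap S (act_unit A Y \<cdot> (?e \<diamond> \<one> Y))"
      using h e by (simp add: SM.T.amap_comp)
    finally show ?thesis
      using h e ob [OF ob'] ob' by (simp add: em_cat_simps N hopf_comonad_simps Hs und)
  qed
  have obA: "fst N \<in> Obj A" if "N \<in> em_obj A S" for N
    using that by (simp add: em_obj_iff)
  have G: "cat_functor ?B ?B ?G"
  proof
    fix X assume "X \<in> Obj ?B"
    then show "omap ?G X \<in> Obj ?B"
      using ob by (simp add: em_cat_simps hopf_comonad_simps)
  next
    fix p X Y assume "p \<in> hom ?B X Y"
    then show "amap ?G p \<in> hom ?B (omap ?G X) (omap ?G Y)"
      using amap [of p] by (auto simp: em_cat_simps(2,3) hopf_comonad_simps)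
  qed (auto simp: em_cat_simps hopf_comonad_simps act_comp obA Hs und)
  have "nat_trans ?B ?B ?G (comp_fctr ?G ?G) (comult ?G)"
  proof (rule nat_transI [OF G comp_cat_functor [OF G G]])
    fix N assume "N \<in> Obj ?B"
    then show "comult ?G N \<in> hom ?B (omap ?G N) (omap (comp_fctr ?G ?G) N)"
      using comult [of N] by (auto simp: em_cat_simps(2,3) hopf_comonad_simps)
  next
    fix p assume "p \<in> Arr ?B"
    then show "comult ?G (Cod ?B p) \<cdot>\<^bsub>?B\<^esub> amap ?G p
        = amap (comp_fctr ?G ?G) p \<cdot>\<^bsub>?B\<^esub> comult ?G (Dom ?B p)"
      using H.comult_natural [of "und p"] by (auto simp: em_cat_simps hopf_comonad_simps)
  qed
  moreover have "nat_trans ?B ?B ?G id_fctr (counit ?G)"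
  proof (rule nat_transI [OF G B.id_cat_functor])
    fix N assume "N \<in> Obj ?B"
    then show "counit ?G N \<in> hom ?B (omap ?G N) (omap id_fctr N)"
      using counit [of N] by (auto simp: em_cat_simps(2,3) hopf_comonad_simps)
  next
    fix p assume "p \<in> Arr ?B"
    then show "counit ?G (Cod ?B p) \<cdot>\<^bsub>?B\<^esub> amap ?G p = amap id_fctr p \<cdot>\<^bsub>?B\<^esub> counit ?G (Dom ?B p)"
      using H.counit_natural [of "und p"] by (auto simp: em_cat_simps hopf_comonad_simps)
  qed
  \<comment> \<open>Both sides have the same end modules, so only their underlying arrows have to
    agree; these are the laws of \<open>?H\<close> at the carrier of \<open>N\<close>.\<close>
  moreover have "amap ?G (comult ?G N) \<cdot>\<^bsub>?B\<^esub> comult ?G N = comult ?G (omap ?G N) \<cdot>\<^bsub>?B\<^esub> comult ?G N"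
    "counit ?G (omap ?G N) \<cdot>\<^bsub>?B\<^esub> comult ?G N = Ident ?B (omap ?G N)"
    "amap ?G (counit ?G N) \<cdot>\<^bsub>?B\<^esub> comult ?G N = Ident ?B (omap ?G N)" if "N \<in> Obj ?B" for N
  proof -
    have "fst N \<in> Obj A" using that by (simp add: em_cat_simps obA)
    then show "amap ?G (comult ?G N) \<cdot>\<^bsub>?B\<^esub> comult ?G N = comult ?G (omap ?G N) \<cdot>\<^bsub>?B\<^esub> comult ?G N"
      "counit ?G (omap ?G N) \<cdot>\<^bsub>?B\<^esub> comult ?G N = Ident ?B (omap ?G N)"
      "amap ?G (counit ?G N) \<cdot>\<^bsub>?B\<^esub> comult ?G N = Ident ?B (omap ?G N)"
      using H.comult_coassoc [of "fst N"] H.counit_comult_left [of "fst N"] H.counit_comult_right [of "fst N"]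
      by (simp_all add: em_cat_simps hopf_comonad_simps act_comonad_simps(1) und)
  qed
  ultimately show ?thesis
    using G by (intro comonad.intro)
qed

end

section \<open>Free modules on comodules\<close>

text \<open>The adjunction between comodules and modules, and the lifting of equalisers, are
  developed for any monad and comonad on the same category; \<open>chi\<close> returns only with the
  coaction.\<close>

locale monad_comonad = S: monad A S + D: comonad A D
  for A :: "('o, 'a, 'z) cat_scheme" (structure)
    and S :: "('o, 'a, 'x) mnd_scheme" and D :: "('o, 'a, 'y) comnd_scheme"
begin

abbreviation "X \<equiv> coem_cat A D"
abbreviation "B \<equiv> em_cat A S"

lemma free_comod_simps:
  "omap (free_comod A S) M = (omap S (fst M), mult S (fst M))"
  "amap (free_comod A S) p = ((omap S (Dom A (und p)), mult S (Dom A (und p))), amap S (und p),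
     (omap S (Cod A (und p)), mult S (Cod A (und p))))"
  by (simp_all add: free_comod_def coem_forget_def em_free_def)

lemma cofree_mod_simps:
  "omap (cofree_mod A D) N = (omap D (fst N), comult D (fst N))"
  "amap (cofree_mod A D) q = ((omap D (Dom A (und q)), comult D (Dom A (und q))), amap D (und q),
     (omap D (Cod A (und q)), comult D (Cod A (und q))))"
  by (simp_all add: cofree_mod_def em_forget_def coem_cofree_def)

lemma free_comod_counit_simps:
  "N \<in> em_obj A S \<Longrightarrow> free_comod_counit A S D N =
    ((omap S (omap D (fst N)), mult S (omap D (fst N))), snd N \<cdot> amap S (counit D (fst N)), N)"
  by (simp add: free_comod_counit_def em_counit_def em_free_def em_forget_def em_cat_simps em_obj_iff)

text \<open>Unit of the composite adjunction: the coaction, which is the unit of the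
  forgetful-cofree adjunction, followed by the cofree image of \<open>ret\<close>.\<close>

definition unit :: "('o, 'a) em_obj \<Rightarrow> ('o, 'a) em_arr" where
  "unit M = (M, amap D (ret S (fst M)) \<cdot> snd M, (omap D (omap S (fst M)), comult D (omap S (fst M))))"

lemma free_comod_functor: "cat_functor X B (free_comod A S)"
  unfolding free_comod_def
  by (rule comp_cat_functor [OF D.coem_forget_functor S.em_free_functor])

lemma cofree_mod_functor: "cat_functor B X (cofree_mod A D)"
  unfolding cofree_mod_def
  by (rule comp_cat_functor [OF S.em_forget_functor D.coem_cofree_functor])

lemma unit_nat_trans: "nat_trans X X id_fctr (comp_fctr (cofree_mod A D) (free_comod A S)) unit"
proof (rule nat_transI)
  show "cat_functor X X id_fctr"
    by (rule category.id_cat_functor [OF D.coem_category])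
  show "cat_functor X X (comp_fctr (cofree_mod A D) (free_comod A S))"
    by (rule comp_cat_functor [OF free_comod_functor cofree_mod_functor])
next
  fix M assume "M \<in> Obj X"
  then obtain Y \<theta> where M: "M = (Y, \<theta>)" and M': "(Y, \<theta>) \<in> coem_obj A D"
    by (cases M) (simp add: coem_cat_simps)
  have \<theta>: "Y \<in> Obj A" "\<theta> \<in> Arr A" "Dom A \<theta> = Y" "Cod A \<theta> = omap D Y"
    and coassoc: "amap D \<theta> \<cdot> \<theta> = comult D Y \<cdot> \<theta>"
    using M' by (auto simp: coem_obj_iff)
  have "comult D (omap S Y) \<cdot> (amap D (ret S Y) \<cdot> \<theta>) = (comult D (omap S Y) \<cdot> amap D (ret S Y)) \<cdot> \<theta>"
    using \<theta> by simp
  also have "\<dots> = amap D (amap D (ret S Y)) \<cdot> (comult D Y \<cdot> \<theta>)"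
    using \<theta> D.comult_natural [of "ret S Y"] by simp
  also have "\<dots> = amap D (amap D (ret S Y) \<cdot> \<theta>) \<cdot> \<theta>"
    using \<theta> by (simp flip: coassoc) (simp add: D.G.amap_comp)
  finally show "unit M \<in> hom X (omap id_fctr M) (omap (comp_fctr (cofree_mod A D) (free_comod A S)) M)"
    using \<theta> M' D.cofree_obj [of "omap S Y"]
    by (simp add: M unit_def coem_cat_simps free_comod_simps cofree_mod_simps)
next
  fix p assume p: "p \<in> Arr X"
  then obtain Y \<theta> f Y' \<theta>' where p': "p = ((Y, \<theta>), f, (Y', \<theta>'))" by (metis prod.collapse)
  have f: "Y \<in> Obj A" "Y' \<in> Obj A" "f \<in> Arr A" "Dom A f = Y" "Cod A f = Y'" "\<theta> \<in> Arr A" "\<theta>' \<in> Arr A"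
    "Dom A \<theta> = Y" "Cod A \<theta> = omap D Y" "Dom A \<theta>' = Y'" "Cod A \<theta>' = omap D Y'"
    and eq: "\<theta>' \<cdot> f = amap D f \<cdot> \<theta>"
    using p by (auto simp: p' coem_cat_simps coem_obj_iff)
  have "(amap D (ret S Y') \<cdot> \<theta>') \<cdot> f = amap D (ret S Y' \<cdot> f) \<cdot> \<theta>"
    using f by (simp add: eq D.G.amap_comp)
  also have "\<dots> = amap D (amap S f) \<cdot> (amap D (ret S Y) \<cdot> \<theta>)"
    using f S.ret_natural [of f] by (simp add: D.G.amap_comp)
  finally show "unit (Cod X p) \<cdot>\<^bsub>X\<^esub> amap id_fctr p
      = amap (comp_fctr (cofree_mod A D) (free_comod A S)) p \<cdot>\<^bsub>X\<^esub> unit (Dom X p)"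
    using f by (simp add: p' unit_def coem_cat_simps free_comod_simps cofree_mod_simps)
qed

lemma counit_nat_trans:
  "nat_trans B B (comp_fctr (free_comod A S) (cofree_mod A D)) id_fctr (free_comod_counit A S D)"
proof (rule nat_transI)
  show "cat_functor B B id_fctr"
    by (rule category.id_cat_functor [OF S.em_category])
  show "cat_functor B B (comp_fctr (free_comod A S) (cofree_mod A D))"
    by (rule comp_cat_functor [OF cofree_mod_functor free_comod_functor])
next
  fix N assume "N \<in> Obj B"
  then obtain Y h where N: "N = (Y, h)" and N': "(Y, h) \<in> em_obj A S"
    by (cases N) (simp add: em_cat_simps)
  have h: "Y \<in> Obj A" "h \<in> Arr A" "Dom A h = omap S Y" "Cod A h = Y"
    and assoc: "h \<cdot> amap S h = h \<cdot> mult S Y"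
    using N' by (auto simp: em_obj_iff)
  have "(h \<cdot> amap S (counit D Y)) \<cdot> mult S (omap D Y) = (h \<cdot> mult S Y) \<cdot> amap S (amap S (counit D Y))"
    using h S.mult_natural [of "counit D Y"] by simp
  also have "\<dots> = h \<cdot> amap S (h \<cdot> amap S (counit D Y))"
    using h by (simp flip: assoc) (simp add: S.T.amap_comp)
  finally show "free_comod_counit A S D N
      \<in> hom B (omap (comp_fctr (free_comod A S) (cofree_mod A D)) N) (omap id_fctr N)"
    using h N' S.free_obj [of "omap D Y"]
    by (simp add: N free_comod_counit_simps em_cat_simps free_comod_simps cofree_mod_simps)
next
  fix p assume p: "p \<in> Arr B"
  then obtain Y h f Y' h' where p': "p = ((Y, h), f, (Y', h'))" by (metis prod.collapse)
  have f: "Y \<in> Obj A" "Y' \<in> Obj A" "f \<in> Arr A" "Dom A f = Y" "Cod A f = Y'" "h \<in> Arr A" "h' \<in> Arr A"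
    "Cod A h = Y" "Dom A h = omap S Y" "Cod A h' = Y'" "Dom A h' = omap S Y'"
    and eq: "f \<cdot> h = h' \<cdot> amap S f"
    and ob: "(Y, h) \<in> em_obj A S" "(Y', h') \<in> em_obj A S"
    using p by (auto simp: p' em_cat_simps em_obj_iff)
  have "(h' \<cdot> amap S (counit D Y')) \<cdot> amap S (amap D f) = h' \<cdot> amap S (counit D Y' \<cdot> amap D f)"
    using f by (simp add: S.T.amap_comp)
  also have "\<dots> = (h' \<cdot> amap S f) \<cdot> amap S (counit D Y)"
    using f D.counit_natural [of f] by (simp add: S.T.amap_comp)
  also have "\<dots> = f \<cdot> (h \<cdot> amap S (counit D Y))"
    using f by (simp flip: eq)
  finally show "free_comod_counit A S D (Cod B p) \<cdot>\<^bsub>B\<^esub> amap (comp_fctr (free_comod A S) (cofree_mod A D)) p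
      = amap id_fctr p \<cdot>\<^bsub>B\<^esub> free_comod_counit A S D (Dom B p)"
    using f ob by (simp add: p' free_comod_counit_simps em_cat_simps free_comod_simps cofree_mod_simps)
qed

text \<open>The counit law of the comodule cancels the cofree half and the unit law of the monad the
  free half.\<close>

lemma triangle_free:
  assumes "M \<in> Obj X"
  shows "free_comod_counit A S D (omap (free_comod A S) M) \<cdot>\<^bsub>B\<^esub> amap (free_comod A S) (unit M)
    = Ident B (omap (free_comod A S) M)"
proof -
  obtain Y \<theta> where M: "M = (Y, \<theta>)" and M': "(Y, \<theta>) \<in> coem_obj A D"
    using assms by (cases M) (simp add: coem_cat_simps)
  have \<theta>: "Y \<in> Obj A" "\<theta> \<in> Arr A" "Dom A \<theta> = Y" "Cod A \<theta> = omap D Y"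
    and counital: "counit D Y \<cdot> \<theta> = \<one> Y"
    using M' by (auto simp: coem_obj_iff)
  have "(mult S Y \<cdot> amap S (counit D (omap S Y))) \<cdot> amap S (amap D (ret S Y) \<cdot> \<theta>)
      = mult S Y \<cdot> amap S ((counit D (omap S Y) \<cdot> amap D (ret S Y)) \<cdot> \<theta>)"
    using \<theta> by (simp add: S.T.amap_comp)
  also have "\<dots> = mult S Y \<cdot> amap S (ret S Y \<cdot> (counit D Y \<cdot> \<theta>))"
    using \<theta> D.counit_natural [of "ret S Y"] by simp
  also have "\<dots> = \<one> (omap S Y)"
    using \<theta>(1) by (simp add: counital S.mult_ret_right)
  finally show ?thesis
    using \<theta> S.free_obj [of Y] by (simp add: M unit_def free_comod_simps free_comod_counit_simps em_cat_simps)
qed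

text \<open>Here the unit law of the module and the counit law of the comonad do the
  cancelling.\<close>

lemma triangle_cofree:
  assumes "N \<in> Obj B"
  shows "amap (cofree_mod A D) (free_comod_counit A S D N) \<cdot>\<^bsub>X\<^esub> unit (omap (cofree_mod A D) N)
    = Ident X (omap (cofree_mod A D) N)"
proof -
  obtain Y h where N: "N = (Y, h)" and N': "(Y, h) \<in> em_obj A S"
    using assms by (cases N) (simp add: em_cat_simps)
  have h: "Y \<in> Obj A" "h \<in> Arr A" "Dom A h = omap S Y" "Cod A h = Y"
    and unital: "h \<cdot> ret S Y = \<one> Y"
    using N' by (auto simp: em_obj_iff)
  have "amap D (h \<cdot> amap S (counit D Y)) \<cdot> (amap D (ret S (omap D Y)) \<cdot> comult D Y)
      = amap D (h \<cdot> (amap S (counit D Y) \<cdot> ret S (omap D Y))) \<cdot> comult D Y"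
    using h by (simp add: D.G.amap_comp)
  also have "\<dots> = amap D ((h \<cdot> ret S Y) \<cdot> counit D Y) \<cdot> comult D Y"
    using h S.ret_natural [of "counit D Y"] by simp
  also have "\<dots> = \<one> (omap D Y)"
    using h(1) by (simp add: unital D.counit_comult_right)
  finally show ?thesis
    using h N' by (simp add: N unit_def cofree_mod_simps free_comod_counit_simps coem_cat_simps)
qed

text \<open>Equalisers of modules are computed on carriers: a factor \<open>u\<close> through
  \<open>S e\<close> in \<open>A\<close> is a module morphism because \<open>S e\<close> is
  monic.\<close>

lemma em_free_equaliser:
  assumes e: "is_equaliser A f g e" and Se: "is_equaliser A (amap S f) (amap S g) (amap S e)"
  shows "is_equaliser B (amap (em_free A S) f) (amap (em_free A S) g) (amap (em_free A S) e)"
proof -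
  interpret B: category B by (rule S.em_category)
  interpret \<phi>: cat_functor A B "em_free A S" by (rule S.em_free_functor)
  note e' = S.is_equaliserD [OF e]
  note Se' = S.is_equaliserD [OF Se]
  have \<phi>: "amap (em_free A S) f = ((omap S (Dom A f), mult S (Dom A f)), amap S f, (omap S (Cod A f), mult S (Cod A f)))"
    for f by (simp add: em_free_def)
  show ?thesis
  proof (rule B.is_equaliserI)
    show "amap (em_free A S) f \<cdot>\<^bsub>B\<^esub> amap (em_free A S) e = amap (em_free A S) g \<cdot>\<^bsub>B\<^esub> amap (em_free A S) e"
      using e' Se' by (simp add: \<phi> em_cat_simps)
  next
    fix p assume p: "p \<in> Arr B" "Cod B p = Dom B (amap (em_free A S) f)"
      "amap (em_free A S) f \<cdot>\<^bsub>B\<^esub> p = amap (em_free A S) g \<cdot>\<^bsub>B\<^esub> p"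
    obtain Y h k Y' h' where p': "p = ((Y, h), k, (Y', h'))" by (metis prod.collapse)
    have Y': "Y' = omap S (Dom A f)" "h' = mult S (Dom A f)"
      using p(2) by (simp_all add: p' \<phi> em_cat_simps)
    have k: "Y \<in> Obj A" "k \<in> Arr A" "Dom A k = Y" "Cod A k = omap S (Dom A f)" "h \<in> Arr A"
      "Dom A h = omap S Y" "Cod A h = Y"
      and kh: "k \<cdot> h = mult S (Dom A f) \<cdot> amap S k"
      and ob: "(Y, h) \<in> em_obj A S"
      and fk: "amap S f \<cdot> k = amap S g \<cdot> k"
      using p by (auto simp: p' Y' \<phi> em_cat_simps em_obj_iff)
    obtain u where u: "u \<in> Arr A" "Dom A u = Y" "Cod A u = omap S (Dom A e)" "amap S e \<cdot> u = k"
      by (rule S.equaliser_factor [OF Se k(2)]) (use k fk e' in auto)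
    \<comment> \<open>Linearity of \<open>u\<close> is tested after the monic \<open>S e\<close>,
      where it becomes linearity of \<open>k\<close> and naturality of \<open>mult\<close>.\<close>
    have "amap S e \<cdot> (u \<cdot> h) = k \<cdot> h"
      using u(1-3) k e'(1) by (simp add: S.comp_reduce [OF u(4)])
    also have "\<dots> = mult S (Dom A f) \<cdot> amap S (amap S e \<cdot> u)"
      by (simp only: kh u(4))
    also have "\<dots> = (mult S (Cod A e) \<cdot> amap S (amap S e)) \<cdot> amap S u"
      using u(1-3) e'(1,2,4) by (simp add: S.T.amap_comp)
    also have "\<dots> = amap S e \<cdot> (mult S (Dom A e) \<cdot> amap S u)"
      using S.mult_natural [OF e'(1)] u(1-3) e'(1) by simp
    finally have uh: "u \<cdot> h = mult S (Dom A e) \<cdot> amap S u"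
      using u(1-3) k e'(1) by (rule_tac S.mono_equaliser [OF Se]) simp_all
    show "\<exists>u \<in> Arr B. Dom B u = Dom B p \<and> Cod B u = Dom B (amap (em_free A S) e)
        \<and> amap (em_free A S) e \<cdot>\<^bsub>B\<^esub> u = p"
      using u uh k ob e'(1,2,4) S.free_obj [of "Dom A e"]
      by (intro bexI [of _ "((Y, h), u, (omap S (Dom A e), mult S (Dom A e)))"])
        (simp_all add: p' Y' \<phi> em_cat_simps)
  next
    fix p q
    assume "p \<in> Arr B" "q \<in> Arr B" "Dom B p = Dom B q" "Cod B p = Dom B (amap (em_free A S) e)"
      "Cod B q = Dom B (amap (em_free A S) e)"
      "amap (em_free A S) e \<cdot>\<^bsub>B\<^esub> p = amap (em_free A S) e \<cdot>\<^bsub>B\<^esub> q"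
    note pq = this [unfolded em_cat_simps \<phi>, simplified]
    have "und p = und q"
      by (rule S.mono_equaliser [OF Se]) (use pq e'(1) in auto)
    with pq show "p = q" by (simp add: prod_eq_iff)
  qed (use e' in simp_all)
qed

text \<open>A limit in comodules is created only as far as the comonad preserves it. The three
  levels have separate tasks: that \<open>D e\<close> is an equaliser yields the coaction on the
  domain of \<open>e\<close>, while \<open>e\<close> and \<open>D D e\<close> being monic give its
  counit law and coassociativity.\<close>

lemma coem_equaliser:
  assumes p: "p \<in> Arr X" and q: "q \<in> Arr X" "Dom X q = Dom X p" "Cod X q = Cod X p"
    and e: "is_equaliser A (und p) (und q) e"
    and De: "is_equaliser A (amap D (und p)) (amap D (und q)) (amap D e)"
    and DDe: "is_equaliser A (amap D (amap D (und p))) (amap D (amap D (und q))) (amap D (amap D e))"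
  obtains r where "is_equaliser X p q r" "und r = e"
proof -
  interpret X: category X by (rule D.coem_category)
  obtain Y \<theta> f Y' \<theta>' where p': "p = ((Y, \<theta>), f, (Y', \<theta>'))" by (metis prod.collapse)
  obtain g where q': "q = ((Y, \<theta>), g, (Y', \<theta>'))"
    using q by (metis p' prod.collapse coem_cat_simps(2,3) fst_conv snd_conv)
  have ob: "(Y, \<theta>) \<in> coem_obj A D" "(Y', \<theta>') \<in> coem_obj A D"
    using p by (simp_all add: p' coem_cat_simps)
  have \<theta>: "Y \<in> Obj A" "\<theta> \<in> Arr A" "Dom A \<theta> = Y" "Cod A \<theta> = omap D Y"
    and coassoc: "amap D \<theta> \<cdot> \<theta> = comult D Y \<cdot> \<theta>" and counital: "counit D Y \<cdot> \<theta> = \<one> Y"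
    and \<theta>': "Y' \<in> Obj A" "\<theta>' \<in> Arr A" "Dom A \<theta>' = Y'" "Cod A \<theta>' = omap D Y'"
    using ob by (auto simp: coem_obj_iff)
  have f: "f \<in> Arr A" "Dom A f = Y" "Cod A f = Y'" and f\<theta>: "\<theta>' \<cdot> f = amap D f \<cdot> \<theta>"
    using p by (simp_all add: p' coem_cat_simps)
  have g: "g \<in> Arr A" "Dom A g = Y" "Cod A g = Y'" and g\<theta>: "\<theta>' \<cdot> g = amap D g \<cdot> \<theta>"
    using q(1) by (simp_all add: q' coem_cat_simps)
  note e = e [unfolded p' q', simplified] and De = De [unfolded p' q', simplified]
    and DDe = DDe [unfolded p' q', simplified]
  have e': "e \<in> Arr A" "Cod A e = Y" "f \<cdot> e = g \<cdot> e"
    using S.is_equaliserD [OF e] f by auto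
  define E where "E = Dom A e"
  have E: "E \<in> Obj A" "Dom A e = E" using e' by (simp_all add: E_def)
  \<comment> \<open>\<open>\<theta> \<cdot> e\<close> equalises \<open>D f\<close> and
    \<open>D g\<close>, as both arrows are comodule morphisms; its factor through \<open>D e\<close>
    is the coaction \<open>\<zeta>\<close>.\<close>
  have "amap D f \<cdot> (\<theta> \<cdot> e) = (amap D f \<cdot> \<theta>) \<cdot> e"
    using f \<theta> e'(1,2) by simp
  also have "\<dots> = \<theta>' \<cdot> (f \<cdot> e)"
    using f \<theta>' e'(1,2) by (simp flip: f\<theta>)
  also have "\<dots> = (amap D g \<cdot> \<theta>) \<cdot> e"
    using g \<theta>' e'(1,2) by (simp add: e'(3) flip: g\<theta>)
  also have "\<dots> = amap D g \<cdot> (\<theta> \<cdot> e)"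
    using g \<theta> e'(1,2) by simp
  finally obtain \<zeta> where \<zeta>: "\<zeta> \<in> Arr A" "Dom A \<zeta> = E" "Cod A \<zeta> = omap D E" "amap D e \<cdot> \<zeta> = \<theta> \<cdot> e"
    by (rule_tac S.equaliser_factor [OF De, of "\<theta> \<cdot> e"]) (use f \<theta> e' E in auto)
  have "e \<cdot> (counit D E \<cdot> \<zeta>) = (e \<cdot> counit D E) \<cdot> \<zeta>"
    using e'(1) E \<zeta>(1-3) by simp
  also have "\<dots> = counit D Y \<cdot> (amap D e \<cdot> \<zeta>)"
    using e'(1,2) E \<theta>(1) \<zeta>(1-3) D.counit_natural [of e, symmetric] by simp
  also have "\<dots> = e \<cdot> \<one> E"
    using e'(1,2) E \<theta> by (simp add: \<zeta>(4) S.comp_reduce [OF counital])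
  finally have counital': "counit D E \<cdot> \<zeta> = \<one> E"
    using e'(1,2) E \<zeta>(1-3) by (rule_tac S.mono_equaliser [OF e]) simp_all
  \<comment> \<open>Coassociativity of \<open>\<zeta>\<close> is inherited from
    \<open>\<theta>\<close> after the monic \<open>D D e\<close>.\<close>
  have "amap D (amap D e) \<cdot> (amap D \<zeta> \<cdot> \<zeta>) = amap D (amap D e \<cdot> \<zeta>) \<cdot> \<zeta>"
    using e'(1,2) E \<zeta>(1-3) by (simp add: D.G.amap_comp)
  also have "\<dots> = amap D \<theta> \<cdot> (amap D e \<cdot> \<zeta>)"
    unfolding \<zeta>(4) using e'(1,2) E \<theta> \<zeta> by (simp add: D.G.amap_comp)
  also have "\<dots> = (amap D \<theta> \<cdot> \<theta>) \<cdot> e"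
    unfolding \<zeta>(4) using e'(1,2) E \<theta> by simp
  also have "\<dots> = comult D Y \<cdot> (amap D e \<cdot> \<zeta>)"
    unfolding \<zeta>(4) coassoc using e'(1,2) E \<theta> by simp
  also have "\<dots> = amap D (amap D e) \<cdot> (comult D E \<cdot> \<zeta>)"
    using e'(1,2) E \<theta>(1) \<zeta>(1-3) D.comult_natural [of e] S.comp_reduce [of "comult D Y" "amap D e"]
    by simp
  finally have coassoc': "amap D \<zeta> \<cdot> \<zeta> = comult D E \<cdot> \<zeta>"
    using e'(1,2) E \<zeta>(1-3) by (rule_tac S.mono_equaliser [OF DDe]) simp_all
  have E_ob: "(E, \<zeta>) \<in> coem_obj A D"
    using E \<zeta>(1-3) counital' coassoc' by (simp add: coem_obj_iff)
  have "is_equaliser X p q ((E, \<zeta>), e, (Y, \<theta>))"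
  proof (rule X.is_equaliserI)
    show "((E, \<zeta>), e, (Y, \<theta>)) \<in> Arr X"
      using E_ob ob e' E \<zeta> by (simp add: coem_cat_simps)
  next
    fix r assume r: "r \<in> Arr X" "Cod X r = Dom X p" "p \<cdot>\<^bsub>X\<^esub> r = q \<cdot>\<^bsub>X\<^esub> r"
    obtain W \<omega> k where r': "r = ((W, \<omega>), k, (Y, \<theta>))"
      using r(2) by (metis p' prod.collapse coem_cat_simps(2,3) fst_conv)
    have k: "W \<in> Obj A" "k \<in> Arr A" "Dom A k = W" "Cod A k = Y" "\<omega> \<in> Arr A" "Dom A \<omega> = W"
      "Cod A \<omega> = omap D W"
      and ok: "\<theta> \<cdot> k = amap D k \<cdot> \<omega>" and Wob: "(W, \<omega>) \<in> coem_obj A D" and fk: "f \<cdot> k = g \<cdot> k"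
      using r by (auto simp: r' p' q' coem_cat_simps coem_obj_iff)
    obtain u where u: "u \<in> Arr A" "Dom A u = W" "Cod A u = E" "e \<cdot> u = k"
      by (rule S.equaliser_factor [OF e k(2)]) (use k fk f E in auto)
    \<comment> \<open>The factor \<open>u\<close> found in \<open>A\<close> respects the coactions,
      again by cancelling the monic \<open>D e\<close>.\<close>
    have "amap D e \<cdot> (\<zeta> \<cdot> u) = \<theta> \<cdot> (e \<cdot> u)"
      using u(1-3) e'(1,2) E \<zeta>(1-3) \<theta> by (simp add: S.comp_reduce [OF \<zeta>(4)])
    also have "\<dots> = amap D (e \<cdot> u) \<cdot> \<omega>"
      by (simp only: u(4) ok)
    also have "\<dots> = amap D e \<cdot> (amap D u \<cdot> \<omega>)"
      using u(1-3) e'(1,2) E k by (simp add: D.G.amap_comp)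
    finally have "\<zeta> \<cdot> u = amap D u \<cdot> \<omega>"
      using u(1-3) e'(1,2) E k \<zeta>(1-3) by (rule_tac S.mono_equaliser [OF De]) simp_all
    then show "\<exists>u \<in> Arr X. Dom X u = Dom X r \<and> Cod X u = Dom X ((E, \<zeta>), e, (Y, \<theta>))
        \<and> ((E, \<zeta>), e, (Y, \<theta>)) \<cdot>\<^bsub>X\<^esub> u = r"
      using u Wob E_ob by (intro bexI [of _ "((W, \<omega>), u, (E, \<zeta>))"]) (simp_all add: r' coem_cat_simps)
  next
    fix r s
    assume "r \<in> Arr X" "s \<in> Arr X" "Dom X r = Dom X s" "Cod X r = Dom X ((E, \<zeta>), e, (Y, \<theta>))"
      "Cod X s = Dom X ((E, \<zeta>), e, (Y, \<theta>))"
      "((E, \<zeta>), e, (Y, \<theta>)) \<cdot>\<^bsub>X\<^esub> r = ((E, \<zeta>), e, (Y, \<theta>)) \<cdot>\<^bsub>X\<^esub> s"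
    note rs = this [unfolded coem_cat_simps, simplified]
    have "und r = und s"
      by (rule S.mono_equaliser [OF e]) (use rs E in auto)
    with rs show "r = s" by (simp add: prod_eq_iff)
  qed (use p q e' in \<open>auto simp: p' q' coem_cat_simps\<close>)
  then show thesis by (rule that) simp
qed

text \<open>The underlying pair in \<open>A\<close> satisfies the hypotheses: its common retraction
  is the underlying arrow of \<open>s\<close>, and it is split by \<open>em_free\<close> because
  \<open>free_comod\<close> is \<open>em_free\<close> on underlying arrows.\<close>

lemma free_comod_equalisers:
  assumes ex: "\<And>f g. coreflexive_split_pair A B (em_free A S) f g \<Longrightarrow> \<exists>e. is_equaliser A f g e"
    and pres: "preserves_equalisers_of A A (coreflexive_split_pair A B (em_free A S)) S"
      "preserves_equalisers_of A A (coreflexive_split_pair A B (em_free A S)) D"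
      "preserves_equalisers_of A A (coreflexive_split_pair A B (em_free A S)) (comp_fctr D D)"
    and pq: "coreflexive_split_pair X B (free_comod A S) p q"
  shows "\<exists>r. is_equaliser X p q r
    \<and> is_equaliser B (amap (free_comod A S) p) (amap (free_comod A S) q) (amap (free_comod A S) r)"
proof -
  have F: "amap (free_comod A S) p = amap (em_free A S) (und p)" for p
    by (simp add: free_comod_def coem_forget_def)
  have pq': "p \<in> Arr X" "q \<in> Arr X" "Dom X q = Dom X p" "Cod X q = Cod X p"
    using pq by (auto simp: coreflexive_split_pair_def coreflexive_pair_def parallel_pair_def)
  obtain s where s: "s \<in> Arr X" "Dom X s = Cod X p" "Cod X s = Dom X p"
    "s \<cdot>\<^bsub>X\<^esub> p = Ident X (Dom X p)" "s \<cdot>\<^bsub>X\<^esub> q = Ident X (Dom X p)"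
    using pq by (auto simp: coreflexive_split_pair_def coreflexive_pair_def)
  have und: "und p \<in> Arr A" "und q \<in> Arr A" "Dom A (und q) = Dom A (und p)" "Cod A (und q) = Cod A (und p)"
    "und s \<in> Arr A" "Dom A (und s) = Cod A (und p)" "Cod A (und s) = Dom A (und p)"
    "und s \<cdot> und p = \<one> (Dom A (und p))" "und s \<cdot> und q = \<one> (Dom A (und p))"
    using pq' s by (auto simp: coem_cat_simps)
  have "coreflexive_split_pair A B (em_free A S) (und p) (und q)"
    using pq und by (auto simp: coreflexive_split_pair_def coreflexive_pair_def parallel_pair_def F
        intro!: bexI [of _ "und s"])
  moreover from ex [OF this] obtain e where e: "is_equaliser A (und p) (und q) e" by blast
  ultimately have Se: "is_equaliser A (amap S (und p)) (amap S (und q)) (amap S e)"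
    and De: "is_equaliser A (amap D (und p)) (amap D (und q)) (amap D e)"
    and DDe: "is_equaliser A (amap D (amap D (und p))) (amap D (amap D (und q))) (amap D (amap D e))"
    using pres unfolding preserves_equalisers_of_def comp_fctr_simps by blast+
  obtain r where "is_equaliser X p q r" "und r = e"
    by (rule coem_equaliser [OF pq' e De DDe])
  with em_free_equaliser [OF e Se] show ?thesis
    by (intro exI [of _ r]) (simp add: F)
qed

text \<open>Forgetting the module structure of the image leaves \<open>S\<close> applied to
  \<open>und p\<close>; conservativity of \<open>S\<close> and then \<open>coem_isoI\<close> lift
  invertibility back to \<open>p\<close>.\<close>

lemma free_comod_conservative:
  assumes "conservative A A S"
  shows "conservative X B (free_comod A S)"
  unfolding conservative_def
proof (intro ballI impI)
  fix p assume p: "p \<in> Arr X" and "iso B (amap (free_comod A S) p)"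
  then have "iso A (amap em_forget (amap (free_comod A S) p))"
    by (rule_tac cat_functor.preserves_iso [OF S.em_forget_functor])
  then have "iso A (und p)"
    using assms p by (simp add: conservative_def em_forget_def free_comod_simps coem_cat_simps)
  with p show "iso X p" by (rule D.coem_isoI)
qed

end

section \<open>The Hopf coaction on free modules\<close>

context opmonoidal_comodule_monad
begin

lemma hopf_coaction_simps:
  "hopf_coaction T A S C M = ((omap S (fst M), mult S (fst M)), chi S (co_obj C) (fst M) \<cdot> amap S (snd M),
    em_act_obj A S (omap T (co_obj C), mult T (co_obj C)) (omap S (fst M), mult S (fst M)))"
  by (simp add: hopf_coaction_def Let_def em_free_def)

text \<open>The axioms of \<open>chi\<close> match the requirements: \<open>chi_mult\<close> makes
  the coaction a module morphism, while \<open>chi_assoc\<close> and \<open>chi_unit\<close> carry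
  the coassociativity and counit law of the given \<open>C\<close>-comodule over to T(C).\<close>

lemma hopf_coaction_obj:
  assumes "comonoid V C" and M: "M \<in> coem_obj A (act_comonad V A C)"
  shows "(omap (free_comod A S) M, hopf_coaction T A S C M)
    \<in> coem_obj (em_cat A S) (hopf_comonad V T A S (free_module_comonoid V T C))"
proof -
  interpret C: comonoid V C by fact
  let ?c = "co_obj C" and ?d = "co_mult C" and ?e = "co_unit C"
  let ?Tc = "omap T ?c" and ?I = "unit_obj V" and ?\<omega> = "omega T ?c ?c"
  obtain X \<theta> where M': "M = (X, \<theta>)" by (cases M)
  have \<theta>: "X \<in> Obj A" "\<theta> \<in> Arr A" "Dom A \<theta> = X" "Cod A \<theta> = ?c \<diamond>\<^sub>o X"
    and coassoc: "(\<one>\<^bsub>V\<^esub> ?c \<diamond> \<theta>) \<cdot> \<theta> = (act_assoc A ?c ?c X \<cdot> (?d \<diamond> \<one> X)) \<cdot> \<theta>"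
    and counital: "(act_unit A X \<cdot> (?e \<diamond> \<one> X)) \<cdot> \<theta> = \<one> X"
    using M by (auto simp: M' coem_obj_iff act_comonad_simps)
  let ?k = "chi S ?c X \<cdot> amap S \<theta>"
  have k: "?k \<in> Arr A" "Dom A ?k = omap S X" "Cod A ?k = ?Tc \<diamond>\<^sub>o omap S X"
    using \<theta> by simp_all
  have Z: "(?Tc, mult T ?c) \<in> em_obj V T"
    by (rule TM.free_obj) simp
  have free: "(omap S X, mult S X) \<in> em_obj A S"
    using \<theta>(1) by (rule SM.free_obj)
  have "?k \<cdot> mult S X = chi S ?c X \<cdot> (amap S \<theta> \<cdot> mult S X)"
    using \<theta> by simp
  also have "\<dots> = (chi S ?c X \<cdot> mult S (?c \<diamond>\<^sub>o X)) \<cdot> amap S (amap S \<theta>)"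
    using \<theta> SM.mult_natural [of \<theta>] by simp
  also have "\<dots> = ((mult T ?c \<diamond> mult S X) \<cdot> chi S ?Tc (omap S X)) \<cdot> amap S ?k"
    using \<theta> by (simp add: S.chi_mult SM.T.amap_comp)
  finally have module: "?k \<cdot> mult S X = ((mult T ?c \<diamond> mult S X) \<cdot> chi S ?Tc (omap S X)) \<cdot> amap S ?k" .
  \<comment> \<open>Naturality of \<open>chi\<close> brings the two copies of
    \<open>S \<theta>\<close> together, so that coassociativity of \<open>\<theta>\<close> applies
    inside \<open>S\<close> before \<open>chi_assoc\<close> converts the result.\<close>
  have "(\<one>\<^bsub>V\<^esub> ?Tc \<diamond> ?k) \<cdot> ?k = (\<one>\<^bsub>V\<^esub> ?Tc \<diamond> chi S ?c X) \<cdot> ((amap T (\<one>\<^bsub>V\<^esub> ?c) \<diamond> amap S \<theta>) \<cdot> chi S ?c X) \<cdot> amap S \<theta>"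
    using \<theta> by (simp add: act_comp_tail)
  also have "(amap T (\<one>\<^bsub>V\<^esub> ?c) \<diamond> amap S \<theta>) \<cdot> chi S ?c X = chi S ?c (?c \<diamond>\<^sub>o X) \<cdot> amap S (\<one>\<^bsub>V\<^esub> ?c \<diamond> \<theta>)"
    using \<theta> chi_nat [of "\<one>\<^bsub>V\<^esub> ?c" \<theta>] by simp
  also have "(\<one>\<^bsub>V\<^esub> ?Tc \<diamond> chi S ?c X) \<cdot> \<dots> \<cdot> amap S \<theta>
      = (\<one>\<^bsub>V\<^esub> ?Tc \<diamond> chi S ?c X) \<cdot> chi S ?c (?c \<diamond>\<^sub>o X) \<cdot> amap S ((\<one>\<^bsub>V\<^esub> ?c \<diamond> \<theta>) \<cdot> \<theta>)"
    using \<theta> by (simp add: SM.T.amap_comp)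
  also have "\<dots> = ((\<one>\<^bsub>V\<^esub> ?Tc \<diamond> chi S ?c X) \<cdot> chi S ?c (?c \<diamond>\<^sub>o X) \<cdot> amap S (act_assoc A ?c ?c X))
      \<cdot> amap S ((?d \<diamond> \<one> X) \<cdot> \<theta>)"
    unfolding coassoc using \<theta> by (simp add: SM.T.amap_comp)
  also have "(\<one>\<^bsub>V\<^esub> ?Tc \<diamond> chi S ?c X) \<cdot> chi S ?c (?c \<diamond>\<^sub>o X) \<cdot> amap S (act_assoc A ?c ?c X)
      = act_assoc A ?Tc ?Tc (omap S X) \<cdot> (?\<omega> \<diamond> \<one> (omap S X)) \<cdot> chi S (?c \<otimes>\<^sub>o\<^bsub>V\<^esub> ?c) X"
    using \<theta> by (simp add: S.chi_assoc)
  also have "\<dots> \<cdot> amap S ((?d \<diamond> \<one> X) \<cdot> \<theta>)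
      = act_assoc A ?Tc ?Tc (omap S X) \<cdot> (?\<omega> \<diamond> \<one> (omap S X))
        \<cdot> (chi S (?c \<otimes>\<^sub>o\<^bsub>V\<^esub> ?c) X \<cdot> amap S (?d \<diamond> \<one> X)) \<cdot> amap S \<theta>"
    using \<theta> by (simp add: SM.T.amap_comp)
  also have "chi S (?c \<otimes>\<^sub>o\<^bsub>V\<^esub> ?c) X \<cdot> amap S (?d \<diamond> \<one> X) = (amap T ?d \<diamond> \<one> (omap S X)) \<cdot> chi S ?c X"
    using \<theta> chi_nat [of ?d "\<one> X"] by simp
  also have "act_assoc A ?Tc ?Tc (omap S X) \<cdot> (?\<omega> \<diamond> \<one> (omap S X)) \<cdot> \<dots> \<cdot> amap S \<theta>
      = (act_assoc A ?Tc ?Tc (omap S X) \<cdot> ((?\<omega> \<cdot>\<^bsub>V\<^esub> amap T ?d) \<diamond> \<one> (omap S X))) \<cdot> ?k"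
    using \<theta> by (simp add: act_comp_tail)
  finally have comodule: "(\<one>\<^bsub>V\<^esub> ?Tc \<diamond> ?k) \<cdot> ?k
      = (act_assoc A ?Tc ?Tc (omap S X) \<cdot> ((?\<omega> \<cdot>\<^bsub>V\<^esub> amap T ?d) \<diamond> \<one> (omap S X))) \<cdot> ?k" .
  have "(act_unit A (omap S X) \<cdot> ((xi T \<cdot>\<^bsub>V\<^esub> amap T ?e) \<diamond> \<one> (omap S X))) \<cdot> ?k
      = act_unit A (omap S X) \<cdot> (xi T \<diamond> \<one> (omap S X))
        \<cdot> ((amap T ?e \<diamond> amap S (\<one> X)) \<cdot> chi S ?c X) \<cdot> amap S \<theta>"
    using \<theta> by (simp add: act_comp_tail)
  also have "(amap T ?e \<diamond> amap S (\<one> X)) \<cdot> chi S ?c X = chi S ?I X \<cdot> amap S (?e \<diamond> \<one> X)"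
    using \<theta> chi_nat [of ?e "\<one> X"] by simp
  also have "act_unit A (omap S X) \<cdot> (xi T \<diamond> \<one> (omap S X)) \<cdot> \<dots> \<cdot> amap S \<theta>
      = (act_unit A (omap S X) \<cdot> (xi T \<diamond> \<one> (omap S X)) \<cdot> chi S ?I X) \<cdot> amap S ((?e \<diamond> \<one> X) \<cdot> \<theta>)"
    using \<theta> by (simp add: SM.T.amap_comp)
  also have "act_unit A (omap S X) \<cdot> (xi T \<diamond> \<one> (omap S X)) \<cdot> chi S ?I X = amap S (act_unit A X)"
    using \<theta> by (simp add: S.chi_unit)
  also have "\<dots> \<cdot> amap S ((?e \<diamond> \<one> X) \<cdot> \<theta>) = amap S ((act_unit A X \<cdot> (?e \<diamond> \<one> X)) \<cdot> \<theta>)"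
    using \<theta> by (simp add: SM.T.amap_comp)
  also have "\<dots> = \<one> (omap S X)"
    unfolding counital using \<theta> by simp
  finally have counit: "(act_unit A (omap S X) \<cdot> ((xi T \<cdot>\<^bsub>V\<^esub> amap T ?e) \<diamond> \<one> (omap S X))) \<cdot> ?k = \<one> (omap S X)" .
  have "hopf_coaction T A S C M \<in> Arr (em_cat A S)"
    using k module free act_module [OF Z free] by (simp add: em_cat_simps hopf_coaction_simps M')
  then show ?thesis
    unfolding coem_obj_iff
    using free comodule counit
    by (simp add: hopf_coaction_simps em_cat_simps M' free_comod_def coem_forget_def em_free_def hopf_comonad_simps
        act_comonad_simps free_comonoid_def)
qed

lemma hopf_coaction_natural:
  assumes "comonoid V C" and p: "p \<in> Arr (coem_cat A (act_comonad V A C))"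
  defines "B \<equiv> em_cat A S"
  shows "hopf_coaction T A S C (snd (snd p)) \<cdot>\<^bsub>B\<^esub> amap (free_comod A S) p
    = amap (hopf_comonad V T A S (free_module_comonoid V T C)) (amap (free_comod A S) p)
        \<cdot>\<^bsub>B\<^esub> hopf_coaction T A S C (fst p)"
proof -
  interpret C: comonoid V C by fact
  let ?c = "co_obj C"
  obtain X \<theta> f Y \<zeta> where p': "p = ((X, \<theta>), f, (Y, \<zeta>))" by (metis prod.collapse)
  have f: "X \<in> Obj A" "Y \<in> Obj A" "\<theta> \<in> Arr A" "Dom A \<theta> = X" "Cod A \<theta> = ?c \<diamond>\<^sub>o X"
    "\<zeta> \<in> Arr A" "Dom A \<zeta> = Y" "Cod A \<zeta> = ?c \<diamond>\<^sub>o Y" "f \<in> Arr A" "Dom A f = X" "Cod A f = Y"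
    and eq: "\<zeta> \<cdot> f = (\<one>\<^bsub>V\<^esub> ?c \<diamond> f) \<cdot> \<theta>"
    using p by (auto simp: p' coem_cat_simps coem_obj_iff act_comonad_simps)
  have "(chi S ?c Y \<cdot> amap S \<zeta>) \<cdot> amap S f = chi S ?c Y \<cdot> amap S (\<zeta> \<cdot> f)"
    using f by (simp add: SM.T.amap_comp)
  also have "\<dots> = (chi S ?c Y \<cdot> amap S (\<one>\<^bsub>V\<^esub> ?c \<diamond> f)) \<cdot> amap S \<theta>"
    unfolding eq using f by (simp add: SM.T.amap_comp)
  also have "\<dots> = (\<one>\<^bsub>V\<^esub> (omap T ?c) \<diamond> amap S f) \<cdot> (chi S ?c X \<cdot> amap S \<theta>)"
    using f chi_nat [of "\<one>\<^bsub>V\<^esub> ?c" f] by simp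
  finally show ?thesis
    using f by (simp add: B_def p' hopf_coaction_simps em_cat_simps free_comod_def coem_forget_def em_free_def
        hopf_comonad_simps act_comonad_simps free_comonoid_def)
qed

end

section \<open>The equivalence criterion for generalised Hopf modules\<close>

theorem theorem2p19:
  fixes V :: "('v, 'w) moncat"
    and T :: "('v, 'w) opmnd"
    and A :: "('v, 'w, 'o, 'a) actcat"
    and S :: "('v, 'o, 'a) comodmnd"
    and C :: "('v, 'w) comon"
  assumes "monoidal_category V"
    and "opmonoidal_monad V T"
    and "left_category V A"
    and "comodule_monad V T A S"
    and "comonoid V C"
    and "\<And>f g. coreflexive_split_pair A (em_cat A S) (em_free A S) f g \<Longrightarrow> \<exists>e. is_equaliser A f g e"
    and "preserves_equalisers_of A A
           (coreflexive_split_pair A (em_cat A S) (em_free A S)) S"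
    and "preserves_equalisers_of A A
           (coreflexive_split_pair A (em_cat A S) (em_free A S)) (act_comonad V A C)"
    and "preserves_equalisers_of A A
           (coreflexive_split_pair A (em_cat A S) (em_free A S))
           (comp_fctr (act_comonad V A C) (act_comonad V A C))"
    and "conservative A A S"
  shows "equivalence_of_categories
           (coem_cat A (act_comonad V A C))
           (hopf_modules V T A S (free_module_comonoid V T C))
           (comparison_functor T A S C)
         \<longleftrightarrow>
         galois (em_cat A S)
           (free_comod A S)
           (cofree_mod A (act_comonad V A C))
           (free_comod_counit A S (act_comonad V A C))
           (hopf_comonad V T A S (free_module_comonoid V T C))
           (hopf_coaction T A S C)"
proof -
  interpret H: opmonoidal_comodule_monad V T A S
    using assms(2-4) by (simp add: opmonoidal_comodule_monad_def)
  let ?D = "act_comonad V A C" and ?G = "hopf_comonad V T A S (free_module_comonoid V T C)"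
  interpret D: comonad A ?D
    by (rule H.act_comonad_comonad) fact
  interpret SD: monad_comonad A S ?D ..
  interpret G: comonad "em_cat A S" ?G
    by (rule H.hopf_comonad_comonad) fact
  interpret K: coaction_adjunction SD.X SD.B "free_comod A S" "cofree_mod A ?D" ?G
    SD.unit "free_comod_counit A S ?D" "hopf_coaction T A S C"
  proof (intro coaction_adjunction.intro coaction_adjunction_axioms.intro)
    show "(omap (free_comod A S) M, hopf_coaction T A S C M) \<in> coem_obj SD.B ?G" if "M \<in> Obj SD.X" for M
      using H.hopf_coaction_obj [OF assms(5)] that by (simp add: coem_cat_simps)
  next
    show "hopf_coaction T A S C (Cod SD.X p) \<cdot>\<^bsub>SD.B\<^esub> amap (free_comod A S) p
        = amap ?G (amap (free_comod A S) p) \<cdot>\<^bsub>SD.B\<^esub> hopf_coaction T A S C (Dom SD.X p)" if "p \<in> Arr SD.X" for p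
      using H.hopf_coaction_natural [OF assms(5) that] by (simp add: coem_cat_simps(2,3))
  qed (rule SD.free_comod_functor SD.cofree_mod_functor G.comonad_axioms SD.unit_nat_trans
      SD.counit_nat_trans; fail | rule SD.triangle_free SD.triangle_cofree; assumption)+
  have "equivalence_of_categories SD.X (coem_cat SD.B ?G) K.K \<longleftrightarrow>
      galois SD.B (free_comod A S) (cofree_mod A ?D) (free_comod_counit A S ?D) ?G (hopf_coaction T A S C)"
    using K.equivalence_imp_galois K.galois_imp_equivalence
      SD.free_comod_equalisers [OF assms(6-9)] SD.free_comod_conservative [OF assms(10)] by blast
  \<comment> \<open>The abstract \<open>K\<close> and the comparison functor are equal as records:
    \<open>free_comod\<close> is \<open>em_free\<close> after forgetting, and domains and codomains
    in the comodule category are the outer components of an arrow.\<close>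
  moreover have "K.K = comparison_functor T A S C"
    unfolding K.K_def
    by (simp add: comparison_functor_def Let_def free_comod_def comp_fctr_def coem_forget_def
        coem_cat_simps)
  ultimately show ?thesis
    by (simp add: hopf_modules_def)
qed

end
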